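(* Let $\mathcal{V}_{20}$ and $\mathcal{V}^*_{20}$ be the periodic configurations in the $20$-dimensional Euclidean space $V$ defined in the context (with $\mathcal{V}_{20}$ being Vardy's sphere packing centers), and let $L=\Lambda_{24}\cap V$. Then $\mathcal{V}^*_{20}$ is formally dual to $\mathcal{V}_{20}$. Moreover, $\mathcal{V}^*_{20}$ has particle density $2$, and the rescaling of $\mathcal{V}^*_{20}$ to particle density $1$ has stealth radius \[ 2^{-1/20}\sqrt{\tfrac{7}{2}}, \] which is strictly greater than $2^{17/20}$, the stealth radius of the rescaling of the dual lattice $L^*$ to particle density $1$.
   Context: Leech lattice coordinates. Fix an extended binary Golay code on the coordinate set $\{1,\dots,24\}$. The Leech lattice $\Lambda_{24}\subset\mathbb{R}^{24}$ is the set of vectors $\frac{1}{\sqrt8}(x_1,\dots,x_{24})$ with $x_i\in\mathbb{Z}$ such that for some $m\in\{0,1\}$: $x_i\equiv m \pmod 2$ for all $i$, $\sum_i x_i\equiv 4m\pmod 8$, and $\{i: (x_i-m)/2 \text{ is odd}\}$ is a codeword of the Golay code. Let $U\cong\mathbb{R}^4$ be the span of the first four coordinate vectors, $V=U^\perp\cong\mathbb{R}^{20}$, and $\pi_U,\pi_V$ the orthogonal projections onto $U$ and $V$. Let $L=\Lambda_{24}\cap V$ (the laminated lattice $\Lambda_{20}$), which is a lattice in $V$, and let $L^*=\{\xi\in V:\langle\xi,x\rangle\in\mathbb{Z}\text{ for all }x\in L\}$. The configurations. Elements of $U$ are written as vectors in $\mathbb{R}^4$. Let \[ A=\tfrac{1}{\sqrt8}\{(0,0,0,0),(1,1,1,1),(2,0,0,0),(1,1,1,-1)\},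 \] \[ \mathcal{V}_{20}=\{\pi_V(w): w\in\Lambda_{24}\text{ and }\pi_U(w)\in A\}. \] Let $f_1=\frac{1}{\sqrt8}(0,0,2,2)$, $f_2=\frac{1}{\sqrt8}(0,0,2,0)$, $f_3=\frac{1}{\sqrt8}(1,-1,1,1)$, $v=\frac{1}{\sqrt8}(4,2,2,0)$, $r_{a,b,c}=af_1+bf_2+cf_3$, \[ T=\{(0,0,0),(0,0,1),(0,1,0),(0,1,1),(1,0,0),(1,0,3),(1,3,0),(1,3,3)\}, \] \[ A^*=\{r_{a,b,c}:(a,b,c)\in T\}\cup\{r_{a,b,c}+v:(a,b,c)\in T\}, \] \[ \mathcal{V}^*_{20}=\{\pi_V(w): w\in\Lambda_{24}\text{ and }\pi_U(w)\in A^*\}. \] Periodic configurations and formal duality. A periodic configuration in $\mathbb{R}^d$ is a union $\mathcal{P}=\bigcup_{j=1}^n(\Lambda+v_j)$ of finitely many distinct translates of a lattice $\Lambda$; its particle density is $\operatorname{density}(\mathcal P)=n/\operatorname{vol}(\mathbb{R}^d/\Lambda)$. For a Schwartz function $f$ on $\mathbb{R}^d$, let $\Sigma_f(\mathcal P)=\frac1n\sum_{j,k=1}^n\sum_{x\in\Lambda}f(x+v_j-v_k)$. Periodic configurations $\mathcal P$ and $\mathcal Q$ are formally dual if $\Sigma_f(\mathcal P)=\operatorname{density}(\mathcal P)\,\Sigma_{\widehat f}(\mathcal Q)$ for all Schwartz functions $f$, where $\widehat f(\xi)=\int f(x)e^{-2\pi i\langle x,\xi\rangle}\,dx$. Stealth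 radius. For a periodic configuration $\mathcal{P}=\bigcup_{j=1}^n(\Lambda+v_j)$ (distinct translates) of particle density $1$, the structure factor of the stationary point process obtained from $\mathcal P$ by a uniformly random translation modulo $\Lambda$ is \[ S=\sum_{\xi\in\Lambda^*\setminus\{0\}}\Bigl|\tfrac1n\sum_{j=1}^n e^{2\pi i\langle v_j,\xi\rangle}\Bigr|^2\delta_\xi, \] with $\Lambda^*$ the dual lattice, and the stealth radius of $\mathcal P$ is the supremum of all $r\ge0$ such that $S$ vanishes on the open ball of radius $r$ about the origin, i.e. the smallest $|\xi|$ with $\xi\in\Lambda^*\setminus\{0\}$ and $\sum_{j=1}^n e^{2\pi i\langle v_j,\xi\rangle}\neq0$. *)

theory Defs
  imports "HOL-Analysis.Analysis" "HOL-Number_Theory.Cong"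
begin

section \<open>Lattices and periodic configurations\<close>

definition lattice_basis :: "'a::euclidean_space set \<Rightarrow> 'a set \<Rightarrow> bool" where
  "lattice_basis B \<Lambda> \<longleftrightarrow> independent B \<and> span B = UNIV \<and>
     \<Lambda> = {(\<Sum>b\<in>B. of_int (c b) *\<^sub>R b) | c :: 'a \<Rightarrow> int. True}"

definition is_lattice :: "'a::euclidean_space set \<Rightarrow> bool" where
  "is_lattice \<Lambda> \<longleftrightarrow> (\<exists>B. lattice_basis B \<Lambda>)"

definition fund_parallelepiped :: "'a::euclidean_space set \<Rightarrow> 'a set" where
  "fund_parallelepiped B = {(\<Sum>b\<in>B. t b *\<^sub>R b) | t. \<forall>b\<in>B. 0 \<le> t b \<and> t b < 1}"

text \<open>The volume of the quotient torus is the volume of any fundamental parallelepiped.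
  Here and below, the definite description selects the value common to all bases of a lattice,
  respectively to all presentations of a periodic configuration.\<close>

definition covolume :: "'a::euclidean_space set \<Rightarrow> real" where
  "covolume \<Lambda> = (THE v. \<exists>B. lattice_basis B \<Lambda> \<and> v = measure lebesgue (fund_parallelepiped B))"

definition dual_lattice :: "'a::euclidean_space set \<Rightarrow> 'a set" where
  "dual_lattice \<Lambda> = {\<xi>. \<forall>x\<in>\<Lambda>. \<xi> \<bullet> x \<in> \<int>}"

definition presentation :: "'a::euclidean_space set \<Rightarrow> 'a set \<Rightarrow> 'a set \<Rightarrow> bool" where
  "presentation \<Lambda> W P \<longleftrightarrow> is_lattice \<Lambda> \<and> finite W \<and> W \<noteq> {} \<and>
     inj_on (\<lambda>v. (+) v ` \<Lambda>) W \<and> P = (\<Union>v\<in>W. (+) v ` \<Lambda>)"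

definition periodic_configuration :: "'a::euclidean_space set \<Rightarrow> bool" where
  "periodic_configuration P \<longleftrightarrow> (\<exists>\<Lambda> W. presentation \<Lambda> W P)"

definition particle_density :: "'a::euclidean_space set \<Rightarrow> real" where
  "particle_density P =
     (THE \<delta>. \<exists>\<Lambda> W. presentation \<Lambda> W P \<and> \<delta> = real (card W) / covolume \<Lambda>)"

definition rescale :: "real \<Rightarrow> 'a::euclidean_space set \<Rightarrow> 'a set" where
  "rescale c P = (\<lambda>x. c *\<^sub>R x) ` P"

definition unit_density_rescaling :: "'a::euclidean_space set \<Rightarrow> 'a set" where
  "unit_density_rescaling P = rescale (THE c. c > 0 \<and> particle_density (rescale c P) = 1) P"

section \<open>Schwartz functions and formal duality\<close>

fun iterated_deriv :: "'a::euclidean_space list \<Rightarrow> ('a \<Rightarrow> complex) \<Rightarrow> 'a \<Rightarrow> complex" where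
  "iterated_deriv [] f = f"
| "iterated_deriv (v # vs) f = (\<lambda>x. frechet_derivative (iterated_deriv vs f) (at x) v)"

definition schwartz :: "('a::euclidean_space \<Rightarrow> complex) \<Rightarrow> bool" where
  "schwartz f \<longleftrightarrow> (\<forall>vs\<in>lists Basis.
     (\<forall>x. iterated_deriv vs f differentiable (at x)) \<and>
     (\<forall>k::nat. bounded (range (\<lambda>x. norm x ^ k *\<^sub>R iterated_deriv vs f x))))"

definition fourier :: "('a::euclidean_space \<Rightarrow> complex) \<Rightarrow> 'a \<Rightarrow> complex" where
  "fourier f \<xi> = (LINT x|lborel. f x * exp (- 2 * pi * \<i> * complex_of_real (x \<bullet> \<xi>)))"

definition pair_sum :: "('a::euclidean_space \<Rightarrow> complex) \<Rightarrow> 'a set \<Rightarrow> complex" where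
  "pair_sum f P = (THE s. \<exists>\<Lambda> W. presentation \<Lambda> W P \<and>
     s = (1 / of_nat (card W)) * (\<Sum>v\<in>W. \<Sum>w\<in>W. \<Sum>\<^sub>\<infinity>x\<in>\<Lambda>. f (x + v - w)))"

definition formally_dual :: "'a::euclidean_space set \<Rightarrow> 'a set \<Rightarrow> bool" where
  "formally_dual P Q \<longleftrightarrow> periodic_configuration P \<and> periodic_configuration Q \<and>
     (\<forall>f. schwartz f \<longrightarrow> pair_sum f P = of_real (particle_density P) * pair_sum (fourier f) Q)"

section \<open>Structure factor and stealth radius\<close>

text \<open>The structure factor is a purely atomic measure, given by its density with respect to
  counting measure.\<close>

definition structure_factor :: "'a::euclidean_space set \<Rightarrow> 'a measure" where
  "structure_factor P = (THE S. \<exists>\<Lambda> W. presentation \<Lambda> W P \<and>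
     S = density (count_space UNIV) (\<lambda>\<xi>.
       ennreal ((cmod ((1 / of_nat (card W)) *
         (\<Sum>v\<in>W. exp (2 * pi * \<i> * complex_of_real (v \<bullet> \<xi>)))))\<^sup>2)
       * indicator (dual_lattice \<Lambda> - {0}) \<xi>))"

definition stealth_radius :: "'a::euclidean_space set \<Rightarrow> real" where
  "stealth_radius P = Sup {r. 0 \<le> r \<and> emeasure (structure_factor P) (ball 0 r) = 0}"

section \<open>The Leech lattice\<close>

text \<open>Binary words are identified with their supports, so addition is symmetric difference.
  An extended binary Golay code is a linear code of length 24, dimension 12 and minimum
  distance 8.\<close>

definition extended_golay_code :: "'n::finite set set \<Rightarrow> bool" where
  "extended_golay_code C \<longleftrightarrow> CARD('n) = 24 \<and>
     {} \<in> C \<and> (\<forall>S\<in>C. \<forall>T\<in>C. sym_diff S T \<in> C) \<and> card C = 2 ^ 12 \<and>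
     Min (card ` (C - {{}})) = 8"

text \<open>The 24 coordinates are indexed by the disjoint sum \<^typ>\<open>4 + 20\<close>: the left summand gives
  the first four coordinates.\<close>

type_synonym idx = "4 + 20"

definition leech_lattice :: "idx set set \<Rightarrow> (real ^ idx) set" where
  "leech_lattice C = {(1 / sqrt 8) *\<^sub>R (\<chi> i. real_of_int (x i)) | x :: idx \<Rightarrow> int.
     \<exists>m\<in>{0, 1}. (\<forall>i. [x i = m] (mod 2)) \<and> [(\<Sum>i\<in>UNIV. x i) = 4 * m] (mod 8) \<and>
       {i. odd ((x i - m) div 2)} \<in> C}"

definition subspace_U :: "(real ^ idx) set" where
  "subspace_U = span (range (\<lambda>i. axis (Inl i) 1))"

definition subspace_V :: "(real ^ idx) set" where
  "subspace_V = orthogonal_comp subspace_U"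

text \<open>The orthogonal projections onto the two subspaces, expressed in the coordinates that
  identify these subspaces isometrically with 4-dimensional and 20-dimensional Euclidean space.\<close>

definition proj_U :: "real ^ idx \<Rightarrow> real ^ 4" where
  "proj_U x = (\<chi> i. x $ Inl i)"

definition proj_V :: "real ^ idx \<Rightarrow> real ^ 20" where
  "proj_V x = (\<chi> j. x $ Inr j)"

lemma inner_proj: "x \<bullet> y = proj_U x \<bullet> proj_U y + proj_V x \<bullet> proj_V y"
  by (simp add: inner_vec_def proj_U_def proj_V_def UNIV_Plus_UNIV[symmetric] Plus_def
      sum.union_disjoint sum.reindex del: UNIV_Plus_UNIV)
    (subst sum.union_disjoint; auto simp: sum.reindex)

lemma subspace_V_eq: "subspace_V = {x. proj_U x = 0}"
proof -
  have "x \<in> subspace_V \<longleftrightarrow> (\<forall>i. x $ Inl i = 0)" for x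
  proof
    assume "x \<in> subspace_V"
    then have "axis (Inl i) 1 \<bullet> x = 0" for i
      by (auto simp: subspace_V_def subspace_U_def orthogonal_comp_def orthogonal_def
          intro: span_base)
    then show "\<forall>i. x $ Inl i = 0"
      by (simp add: inner_axis')
  next
    assume *: "\<forall>i. x $ Inl i = 0"
    have "orthogonal y x" if "y \<in> subspace_U" for y
      using that unfolding subspace_U_def
      by (induction rule: span_induct)
        (use * in \<open>auto simp: orthogonal_def inner_axis' subspace_def inner_add_left\<close>)
    then show "x \<in> subspace_V"
      by (auto simp: subspace_V_def orthogonal_comp_def)
  qed
  then show ?thesis
    by (auto simp: proj_U_def vec_eq_iff)
qed

lemma subspace_U_eq: "subspace_U = {x. proj_V x = 0}"
proof -
  have "x \<in> subspace_U" if "proj_V x = 0" for x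
  proof -
    have "x = (\<Sum>i\<in>UNIV. x $ Inl i *\<^sub>R axis (Inl i) 1)"
    proof (rule vec_eq_iff[THEN iffD2], rule allI)
      fix k
      show "x $ k = (\<Sum>i\<in>UNIV. x $ Inl i *\<^sub>R axis (Inl i) 1) $ k"
        using that by (cases k) (auto simp: axis_def proj_V_def vec_eq_iff if_distrib cong: if_cong)
    qed
    also have "\<dots> \<in> subspace_U"
      unfolding subspace_U_def by (intro span_sum span_scale span_base) auto
    finally show ?thesis .
  qed
  moreover have "proj_V x = 0" if "x \<in> subspace_U" for x
    using that unfolding subspace_U_def
    by (induction rule: span_induct)
      (auto simp: subspace_def proj_V_def vec_eq_iff axis_def)
  ultimately show ?thesis by auto
qed

definition lattice_L :: "idx set set \<Rightarrow> (real ^ 20) set" where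
  "lattice_L C = proj_V ` (leech_lattice C \<inter> subspace_V)"

section \<open>The configurations\<close>

definition config_A :: "(real ^ 4) set" where
  "config_A = (\<lambda>x. (1 / sqrt 8) *\<^sub>R x) `
     {vector [0, 0, 0, 0], vector [1, 1, 1, 1], vector [2, 0, 0, 0], vector [1, 1, 1, -1]}"

definition V20 :: "idx set set \<Rightarrow> (real ^ 20) set" where
  "V20 C = {proj_V w | w. w \<in> leech_lattice C \<and> proj_U w \<in> config_A}"

definition f1 :: "real ^ 4" where "f1 = (1 / sqrt 8) *\<^sub>R vector [0, 0, 2, 2]"
definition f2 :: "real ^ 4" where "f2 = (1 / sqrt 8) *\<^sub>R vector [0, 0, 2, 0]"
definition f3 :: "real ^ 4" where "f3 = (1 / sqrt 8) *\<^sub>R vector [1, -1, 1, 1]"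
definition shift_v :: "real ^ 4" where "shift_v = (1 / sqrt 8) *\<^sub>R vector [4, 2, 2, 0]"

definition r_vec :: "real \<times> real \<times> real \<Rightarrow> real ^ 4" where
  "r_vec = (\<lambda>(a, b, c). a *\<^sub>R f1 + b *\<^sub>R f2 + c *\<^sub>R f3)"

definition index_T :: "(real \<times> real \<times> real) set" where
  "index_T = {(0,0,0), (0,0,1), (0,1,0), (0,1,1), (1,0,0), (1,0,3), (1,3,0), (1,3,3)}"

definition config_A_star :: "(real ^ 4) set" where
  "config_A_star = r_vec ` index_T \<union> (\<lambda>t. r_vec t + shift_v) ` index_T"

definition V20_star :: "idx set set \<Rightarrow> (real ^ 20) set" where
  "V20_star C = {proj_V w | w. w \<in> leech_lattice C \<and> proj_U w \<in> config_A_star}"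

end

theory Submission
  imports Defs
begin

text \<open>
  Write \<open>\<Lambda>\<close> for the Leech lattice and \<open>M\<close>, \<open>L\<close> for its sections by \<open>U\<close> and \<open>V\<close>. Since \<open>\<Lambda>\<close> is
  unimodular, \<open>\<Lambda> / (M + L)\<close> projects isomorphically onto both \<open>M* / M\<close> and \<open>L* / L\<close>, and the inner
  products of the two projections of a pair of lattice vectors add up to an integer. So there is a
  glue isomorphism \<open>M* / M \<rightarrow> L* / L\<close> that negates inner products modulo 1 (\<open>section_glue\<close>,
  \<open>dual_L\<close>). The two configurations are the unions of the cosets of \<open>L\<close> glued to the four elements of
  \<open>A\<close> and the sixteen elements of \<open>A*\<close>.

  By Poisson summation, two unions \<open>W + L\<close> and \<open>W' + L\<close> with \<open>W' - W'\<close> in \<open>L*\<close> are formally dual as soon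
  as, for each \<open>\<xi>\<close> in \<open>L*\<close>, the squared modulus of the average over \<open>W\<close> of the character \<open>\<xi>\<close> equals
  the number of pairs in \<open>W'\<close> whose difference is \<open>\<xi>\<close> modulo \<open>L\<close>, divided by the size of \<open>W'\<close>
  (\<open>formally_dualI\<close>). Through the glue this becomes an identity between sums of fourth roots of unity
  over \<open>A*\<close> and counts of differences in \<open>A\<close>, one for each of the 64 classes of \<open>M* / M\<close>, and these are
  computed (\<open>finite_fourier_check\<close>).

  The same identity shows that the structure factor of the dual configuration is supported on the
  differences of Vardy's configuration. Such a difference is the \<open>V\<close>-part of a vector of \<open>\<Lambda>\<close> of
  squared length at least 4 whose \<open>U\<close>-part is a difference in \<open>A\<close> and so has squared length at most
  1/2; hence the bound 7/2, attained by the minimal vector with entries \<open>1\<close> and a single \<open>-3\<close>.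
  For the lattice \<open>L*\<close> the structure factor lives on \<open>L\<close>, whose minimal squared length is 4. The scale
  factors come from the covolumes 8 of \<open>L\<close> and 1/8 of \<open>L*\<close>, which are found by counting cosets of cubic
  lattices.

  Three ingredients are of independent interest. The quantities given by definite descriptions do not
  depend on the presentation, because the convolution of the indicators of two fundamental domains
  weighs the points of the configuration in two ways (\<open>weighted_count_eq\<close>). Poisson summation rests
  on a uniqueness statement for Fourier coefficients, proved with powers of a trigonometric polynomial
  that peaks at one point (\<open>fourier_uniqueness_centre\<close>). Finally, a linear code with
  the parameters of the extended Golay code is self-dual and doubly even (\<open>golay_self_dual\<close>): its
  punctured codes are perfect, so the nonzero weights below 24 of the dual code are roots of a cubic
  polynomial, namely 8, 12 and 16.
\<close>

section \<open>Coordinates in a lattice\<close>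

locale lattice_coords =
  fixes B :: "'a::euclidean_space set" and D :: "'a \<Rightarrow> 'a" and \<Lambda> :: "'a set"
  assumes basis: "lattice_basis B \<Lambda>"
    and dual: "\<And>b b'. b \<in> B \<Longrightarrow> b' \<in> B \<Longrightarrow> D b \<bullet> b' = (if b = b' then 1 else 0)"

lemma lattice_coords_exist:
  assumes "lattice_basis B \<Lambda>"
  obtains D where "lattice_coords B D \<Lambda>"
proof -
  have ind: "independent B" using assms by (simp add: lattice_basis_def)
  have "\<exists>d. \<forall>b'\<in>B. d \<bullet> b' = (if b = b' then 1 else 0)" for b
  proof -
    obtain g :: "'a \<Rightarrow> real" where g: "linear g" "\<forall>x\<in>B. g x = (if b = x then 1 else 0)"
      using linear_independent_extend[OF ind, of "\<lambda>x. if b = x then 1 else 0 :: real"] by blast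
    have "adjoint g 1 \<bullet> x = g x" for x
      using adjoint_works[OF g(1), of x 1] by (simp add: inner_commute)
    with g(2) show ?thesis by metis
  qed
  then obtain D where "\<forall>b. \<forall>b'\<in>B. D b \<bullet> b' = (if b = b' then 1 else 0)" by metis
  with assms show ?thesis by (intro that[of D]) (simp add: lattice_coords_def)
qed

context lattice_coords
begin

abbreviation F where "F \<equiv> fund_parallelepiped B"

lemma finite_B: "finite B"
  using basis by (simp add: lattice_basis_def independent_imp_finite)

lemma B_nonempty: "B \<noteq> {}"
  using basis by (auto simp: lattice_basis_def)

lemma inner_D_sum: "b \<in> B \<Longrightarrow> D b \<bullet> (\<Sum>b'\<in>B. t b' *\<^sub>R b') = t b"
  by (simp add: inner_sum_right dual finite_B if_distrib cong: if_cong)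

lemma expand: "x = (\<Sum>b\<in>B. (D b \<bullet> x) *\<^sub>R b)"
proof -
  have "x \<in> span B" using basis by (simp add: lattice_basis_def)
  then obtain t where "x = (\<Sum>b\<in>B. t b *\<^sub>R b)"
    by (auto simp: span_finite[OF finite_B])
  then show ?thesis by (simp add: inner_D_sum)
qed

lemma inner_expand: "x \<bullet> y = (\<Sum>b\<in>B. (x \<bullet> b) * (D b \<bullet> y))"
  by (subst (1) expand[of y]) (simp add: inner_sum_right mult.commute)

lemma coords_eqI: "(\<And>b. b \<in> B \<Longrightarrow> D b \<bullet> x = D b \<bullet> y) \<Longrightarrow> x = y"
  by (subst expand[of x], subst expand[of y]) simp

lemma lattice_iff: "x \<in> \<Lambda> \<longleftrightarrow> (\<forall>b\<in>B. D b \<bullet> x \<in> \<int>)"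
proof
  assume "x \<in> \<Lambda>"
  then obtain c :: "'a \<Rightarrow> int" where "x = (\<Sum>b\<in>B. of_int (c b) *\<^sub>R b)"
    using basis by (auto simp: lattice_basis_def)
  then show "\<forall>b\<in>B. D b \<bullet> x \<in> \<int>" by (simp add: inner_D_sum)
next
  assume "\<forall>b\<in>B. D b \<bullet> x \<in> \<int>"
  then have "x = (\<Sum>b\<in>B. of_int \<lfloor>D b \<bullet> x\<rfloor> *\<^sub>R b)"
    by (subst (1) expand) (auto intro!: sum.cong simp: of_int_floor)
  then show "x \<in> \<Lambda>" using basis by (force simp: lattice_basis_def)
qed

lemma zero_mem: "0 \<in> \<Lambda>"
  by (simp add: lattice_iff)

lemma add_mem: "x \<in> \<Lambda> \<Longrightarrow> y \<in> \<Lambda> \<Longrightarrow> x + y \<in> \<Lambda>"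
  by (simp add: lattice_iff inner_add_right)

lemma minus_mem: "x \<in> \<Lambda> \<Longrightarrow> - x \<in> \<Lambda>"
  by (simp add: lattice_iff)

lemma diff_mem: "x \<in> \<Lambda> \<Longrightarrow> y \<in> \<Lambda> \<Longrightarrow> x - y \<in> \<Lambda>"
  by (simp add: lattice_iff inner_diff_right)

lemma basis_subset: "B \<subseteq> \<Lambda>"
  by (auto simp: lattice_iff dual)

lemma fund_iff: "x \<in> F \<longleftrightarrow> (\<forall>b\<in>B. 0 \<le> D b \<bullet> x \<and> D b \<bullet> x < 1)"
proof
  assume "x \<in> F"
  then show "\<forall>b\<in>B. 0 \<le> D b \<bullet> x \<and> D b \<bullet> x < 1"
    by (auto simp: fund_parallelepiped_def inner_D_sum)
next
  assume "\<forall>b\<in>B. 0 \<le> D b \<bullet> x \<and> D b \<bullet> x < 1"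
  then show "x \<in> F" unfolding fund_parallelepiped_def
    by (intro CollectI exI[of _ "\<lambda>b. D b \<bullet> x"]) (simp add: expand[symmetric])
qed

lemma countable_lattice: "countable \<Lambda>"
proof -
  have "\<Lambda> \<subseteq> (\<lambda>c. \<Sum>b\<in>B. of_int (c b) *\<^sub>R b) ` (\<Pi>\<^sub>E b\<in>B. (UNIV :: int set))"
  proof
    fix x assume "x \<in> \<Lambda>"
    then have *: "x = (\<Sum>b\<in>B. of_int \<lfloor>D b \<bullet> x\<rfloor> *\<^sub>R b)"
      by (subst (1) expand) (auto intro!: sum.cong simp: of_int_floor lattice_iff)
    show "x \<in> (\<lambda>c. \<Sum>b\<in>B. of_int (c b) *\<^sub>R b) ` (\<Pi>\<^sub>E b\<in>B. (UNIV :: int set))"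
      by (rule image_eqI[where x = "restrict (\<lambda>b. \<lfloor>D b \<bullet> x\<rfloor>) B"]) (simp_all add: *[symmetric])
  qed
  then show ?thesis
    using countable_PiE[OF finite_B, of "\<lambda>_. UNIV :: int set"]
    by (meson countable_image countable_subset countableI_type)
qed

lemma infinite_lattice: "infinite \<Lambda>"
proof -
  obtain b where b: "b \<in> B" using B_nonempty by auto
  have "inj (\<lambda>n::nat. real n *\<^sub>R b)"
    using b dual[OF b b] by (auto simp: inj_on_def)
  moreover have "range (\<lambda>n::nat. real n *\<^sub>R b) \<subseteq> \<Lambda>"
    using b by (auto simp: lattice_iff dual)
  ultimately show ?thesis
    using finite_subset range_inj_infinite by blast
qed

definition lat_floor :: "'a \<Rightarrow> 'a" where
  "lat_floor x = (\<Sum>b\<in>B. of_int \<lfloor>D b \<bullet> x\<rfloor> *\<^sub>R b)"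

lemma lat_floor_mem: "lat_floor x \<in> \<Lambda>"
  by (simp add: lattice_iff lat_floor_def inner_D_sum)

lemma diff_fund_iff: "l \<in> \<Lambda> \<Longrightarrow> x - l \<in> F \<longleftrightarrow> l = lat_floor x"
proof
  assume l: "l \<in> \<Lambda>" "x - l \<in> F"
  show "l = lat_floor x"
  proof (rule coords_eqI)
    fix b assume b: "b \<in> B"
    then obtain k where k: "D b \<bullet> l = of_int k" using l(1) by (auto simp: lattice_iff elim: Ints_cases)
    have "\<lfloor>D b \<bullet> x\<rfloor> = k"
      using l(2) b k by (auto simp: fund_iff inner_diff_right intro!: floor_unique)
    then show "D b \<bullet> l = D b \<bullet> lat_floor x" using b k by (simp add: lat_floor_def inner_D_sum)
  qed
next
  assume "l = lat_floor x"
  then show "x - l \<in> F"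
    by (auto simp: fund_iff lat_floor_def inner_diff_right inner_D_sum) linarith
qed

lemma fund_borel [measurable]: "F \<in> sets borel"
proof -
  have "F = (\<Inter>b\<in>B. {x. 0 \<le> D b \<bullet> x} \<inter> {x. D b \<bullet> x < 1})"
    by (auto simp: fund_iff)
  moreover have "closed {x. 0 \<le> D b \<bullet> x}" for b
    by (intro closed_Collect_le continuous_intros)
  moreover have "open {x. D b \<bullet> x < 1}" for b
    by (intro open_Collect_less continuous_intros)
  ultimately show ?thesis using finite_B B_nonempty
    by (simp add: sets.finite_INT sets.Int borel_closed borel_open)
qed

definition closed_fund :: "'a set" where
  "closed_fund = {x. \<forall>b\<in>B. 0 \<le> D b \<bullet> x \<and> D b \<bullet> x \<le> 1}"

lemma fund_subset_closed: "F \<subseteq> closed_fund"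
  by (auto simp: fund_iff closed_fund_def less_imp_le)

lemma norm_closed_fund: "x \<in> closed_fund \<Longrightarrow> norm x \<le> (\<Sum>b\<in>B. norm b)"
proof -
  assume x: "x \<in> closed_fund"
  have "norm x \<le> (\<Sum>b\<in>B. norm ((D b \<bullet> x) *\<^sub>R b))"
    by (subst (1) expand) (rule norm_sum)
  also have "\<dots> \<le> (\<Sum>b\<in>B. norm b)"
    using x by (intro sum_mono) (auto simp: closed_fund_def mult_left_le_one_le)
  finally show ?thesis .
qed

lemma compact_closed_fund: "compact closed_fund"
proof -
  have "closed_fund = (\<Inter>b\<in>B. {x. 0 \<le> D b \<bullet> x} \<inter> {x. D b \<bullet> x \<le> 1})"
    by (auto simp: closed_fund_def)
  moreover have "closed {x. 0 \<le> D b \<bullet> x}" "closed {x. D b \<bullet> x \<le> 1}" for b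
    by (intro closed_Collect_le continuous_intros)+
  ultimately have "closed closed_fund" by (metis (no_types, lifting) closed_INT closed_Int)
  moreover have "bounded closed_fund"
    using norm_closed_fund by (auto simp: bounded_iff)
  ultimately show ?thesis by (simp add: compact_eq_bounded_closed)
qed

lemma open_fund: "open {x. \<forall>b\<in>B. 0 < D b \<bullet> x \<and> D b \<bullet> x < 1}"
proof -
  have "{x. \<forall>b\<in>B. 0 < D b \<bullet> x \<and> D b \<bullet> x < 1} = (\<Inter>b\<in>B. {x. 0 < D b \<bullet> x} \<inter> {x. D b \<bullet> x < 1})"
    by auto
  moreover have "open ({x. 0 < D b \<bullet> x} \<inter> {x. D b \<bullet> x < 1})" for b
    by (intro open_Int open_Collect_less continuous_intros)
  ultimately show ?thesis using finite_B by auto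
qed

definition centre :: 'a where "centre = (\<Sum>b\<in>B. (1/2) *\<^sub>R b)"

lemma D_centre: "b \<in> B \<Longrightarrow> D b \<bullet> centre = 1/2"
  unfolding centre_def by (rule inner_D_sum)

lemma emeasure_fund_finite: "emeasure lborel F < \<infinity>"
proof -
  have "emeasure lborel F \<le> emeasure lborel closed_fund"
    using compact_closed_fund
    by (intro emeasure_mono fund_subset_closed) (auto simp: compact_imp_closed)
  also have "\<dots> < \<infinity>" using emeasure_compact_finite[OF compact_closed_fund] by (simp add: less_top)
  finally show ?thesis .
qed

lemma emeasure_open_pos:
  assumes "open S" "x \<in> S" shows "emeasure lborel (S::'a set) > 0"
proof -
  have "S \<notin> null_sets lebesgue"
    using assms by (metis completion.complete_sets_sandwich empty_iff interior_open
      negligible_iff_null_sets open_not_negligible)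
  then show ?thesis using assms(1)
    by (auto simp: null_sets_def zero_less_iff_neq_zero)
qed

lemma emeasure_fund_pos: "emeasure lborel F > 0"
proof -
  let ?O = "{x. \<forall>b\<in>B. 0 < D b \<bullet> x \<and> D b \<bullet> x < 1}"
  have "0 < emeasure lborel ?O"
    by (rule emeasure_open_pos[OF open_fund, of centre]) (simp add: D_centre)
  also have "\<dots> \<le> emeasure lborel F"
    by (intro emeasure_mono) (auto simp: fund_iff less_imp_le)
  finally show ?thesis .
qed

definition vol :: real where "vol = measure lborel F"

lemma emeasure_fund: "emeasure lborel F = ennreal vol"
  using emeasure_fund_finite by (simp add: vol_def emeasure_eq_ennreal_measure less_top)

lemma vol_pos: "vol > 0"
  using emeasure_fund_pos by (simp add: emeasure_fund)

lemma measure_lebesgue_fund: "measure lebesgue F = vol"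
  unfolding vol_def by (rule measure_completion) simp

end


section \<open>Averages over a periodic configuration\<close>

lemma nn_integral_lborel_shift:
  fixes f :: "'a::euclidean_space \<Rightarrow> ennreal"
  assumes [measurable]: "f \<in> borel_measurable borel"
  shows "(\<integral>\<^sup>+x. f (c + x) \<partial>lborel) = (\<integral>\<^sup>+x. f x \<partial>lborel)"
proof -
  have "(\<integral>\<^sup>+x. f x \<partial>distr lborel borel ((+) c)) = (\<integral>\<^sup>+x. f (c + x) \<partial>lborel)"
    by (subst nn_integral_distr) auto
  then show ?thesis by (simp add: lborel_distr_plus)
qed

lemma nn_integral_lborel_reflect:
  fixes f :: "'a::euclidean_space \<Rightarrow> ennreal"
  assumes [measurable]: "f \<in> borel_measurable borel"
  shows "(\<integral>\<^sup>+x. f (c - x) \<partial>lborel) = (\<integral>\<^sup>+x. f x \<partial>lborel)"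
proof -
  have "lborel = distr lborel borel (\<lambda>x::'a. c - x)"
    using lborel_affine[of "-1" c] by (simp add: density_1)
  then have "(\<integral>\<^sup>+x. f x \<partial>lborel) = (\<integral>\<^sup>+x. f x \<partial>distr lborel borel (\<lambda>x::'a. c - x))"
    by simp
  also have "\<dots> = (\<integral>\<^sup>+x. f (c - x) \<partial>lborel)"
    by (subst nn_integral_distr) auto
  finally show ?thesis by simp
qed

context lattice_coords
begin

lemma coset_eq_iff: "(+) v ` \<Lambda> = (+) w ` \<Lambda> \<longleftrightarrow> v - w \<in> \<Lambda>"
proof
  assume "(+) v ` \<Lambda> = (+) w ` \<Lambda>"
  moreover have "v \<in> (+) v ` \<Lambda>" using zero_mem by force
  ultimately obtain l where "l \<in> \<Lambda>" "v = w + l" by auto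
  then show "v - w \<in> \<Lambda>" by simp
next
  assume *: "v - w \<in> \<Lambda>"
  have "v + l \<in> (+) w ` \<Lambda>" if "l \<in> \<Lambda>" for l
    using add_mem[OF * that] by (intro image_eqI[of _ _ "v - w + l"]) auto
  moreover have "w + l \<in> (+) v ` \<Lambda>" if "l \<in> \<Lambda>" for l
    using diff_mem[OF that *] by (intro image_eqI[of _ _ "l - (v - w)"]) auto
  ultimately show "(+) v ` \<Lambda> = (+) w ` \<Lambda>" by auto
qed

text \<open>Every translate of a fundamental domain contains exactly one point of each coset.\<close>

lemma sum_over_window:
  fixes g :: "'a \<Rightarrow> ennreal"
  assumes "finite W" and inj: "inj_on (\<lambda>v. (+) v ` \<Lambda>) W" and P: "P = (\<Union>v\<in>W. (+) v ` \<Lambda>)"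
    and per: "\<And>p l. p \<in> P \<Longrightarrow> l \<in> \<Lambda> \<Longrightarrow> g (p + l) = g p"
  shows "(\<integral>\<^sup>+p. g p * indicator F (p - u) \<partial>count_space P) = (\<Sum>w\<in>W. g w)"
proof -
  define h where "h w = w - lat_floor (w - u)" for w
  have WP: "w \<in> P" if "w \<in> W" for w
    using that zero_mem by (force simp: P)
  have hP: "h w \<in> P" if "w \<in> W" for w
    using that minus_mem[OF lat_floor_mem, of "w - u"] by (force simp: P h_def)
  have inj_h: "inj_on h W"
  proof (rule inj_onI)
    fix v w assume "v \<in> W" "w \<in> W" "h v = h w"
    moreover have "v - w = lat_floor (v - u) - lat_floor (w - u)"
      using \<open>h v = h w\<close> by (simp add: h_def algebra_simps)
    ultimately show "v = w"
      using inj diff_mem[OF lat_floor_mem lat_floor_mem] by (simp add: inj_on_def coset_eq_iff)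
  qed
  have hF: "h w - u \<in> F" for w
    using diff_fund_iff[OF lat_floor_mem, of "w - u" "w - u"] by (simp add: h_def algebra_simps)
  have "(\<integral>\<^sup>+p. g p * indicator F (p - u) \<partial>count_space P) = (\<Sum>p\<in>h ` W. g p * indicator F (p - u))"
  proof (rule nn_integral_count_space')
    fix p assume p: "p \<in> P" "p \<notin> h ` W"
    then obtain w l where wl: "w \<in> W" "l \<in> \<Lambda>" "p = w + l" by (auto simp: P)
    have "p - u \<notin> F"
    proof
      assume "p - u \<in> F"
      then have "- l = lat_floor (w - u)"
        using wl diff_fund_iff[OF minus_mem[OF wl(2)], of "w - u"] by (simp add: algebra_simps)
      then have "p = h w" using wl by (simp add: h_def eq_commute[of "- l"])
      with p(2) wl(1) show False by blast
    qed
    then show "g p * indicator F (p - u) = 0" by simp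
  qed (use assms(1) hP in auto)
  also have "\<dots> = (\<Sum>w\<in>W. g (h w))"
    by (simp add: sum.reindex[OF inj_h] hF)
  also have "\<dots> = (\<Sum>w\<in>W. g w)"
    using per[OF WP minus_mem[OF lat_floor_mem]] by (intro sum.cong) (auto simp: h_def)
  finally show ?thesis .
qed

end

lemma presentation_coords:
  assumes "presentation \<Lambda> W P"
  obtains B D where "lattice_coords B D \<Lambda>"
proof -
  obtain B where "lattice_basis B \<Lambda>" using assms by (auto simp: presentation_def is_lattice_def)
  then show ?thesis using lattice_coords_exist that by metis
qed

text \<open>Weigh each point \<open>p\<close> by \<open>g p\<close> and by the volume of the
  set of \<open>u\<close> in the second domain with \<open>p - u\<close> in the first. Integrating over \<open>u\<close> last gives the
  left-hand side, and the substitution of \<open>p - u\<close> for \<open>u\<close> exchanges the two domains.\<close>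

lemma weighted_count_eq:
  fixes g :: "'a::euclidean_space \<Rightarrow> ennreal"
  assumes L1: "lattice_coords B1 D1 \<Lambda>1" and L2: "lattice_coords B2 D2 \<Lambda>2"
    and P1: "presentation \<Lambda>1 W1 P" and P2: "presentation \<Lambda>2 W2 P"
    and per1: "\<And>p l. p \<in> P \<Longrightarrow> l \<in> \<Lambda>1 \<Longrightarrow> g (p + l) = g p"
    and per2: "\<And>p l. p \<in> P \<Longrightarrow> l \<in> \<Lambda>2 \<Longrightarrow> g (p + l) = g p"
  shows "(\<Sum>w\<in>W1. g w) * emeasure lborel (fund_parallelepiped B2)
       = (\<Sum>w\<in>W2. g w) * emeasure lborel (fund_parallelepiped B1)"
proof -
  interpret L1: lattice_coords B1 D1 \<Lambda>1 by fact
  interpret L2: lattice_coords B2 D2 \<Lambda>2 by fact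
  have cP: "countable P"
    using P1 L1.countable_lattice unfolding presentation_def
    by (metis countable_UN countable_finite countable_image)
  have s1: "(\<integral>\<^sup>+p. g p * indicator L1.F (p - u) \<partial>count_space P) = (\<Sum>w\<in>W1. g w)" for u
    using P1 per1 by (intro L1.sum_over_window) (auto simp: presentation_def)
  have s2: "(\<integral>\<^sup>+p. g p * indicator L2.F (p - u) \<partial>count_space P) = (\<Sum>w\<in>W2. g w)" for u
    using P2 per2 by (intro L2.sum_over_window) (auto simp: presentation_def)
  have J: "(\<Sum>w\<in>W. g w) * emeasure lborel F'
      = (\<integral>\<^sup>+p. g p * (\<integral>\<^sup>+u. indicator F (p - u) * indicator F' u \<partial>lborel) \<partial>count_space P)"
    if s: "\<And>u. (\<integral>\<^sup>+p. g p * indicator F (p - u) \<partial>count_space P) = (\<Sum>w\<in>W. g w)"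
      and [measurable]: "F \<in> sets borel" "F' \<in> sets borel" for W and F F' :: "'a set"
  proof -
    have "(\<Sum>w\<in>W. g w) * emeasure lborel F'
        = (\<integral>\<^sup>+u. (\<integral>\<^sup>+p. g p * indicator F (p - u) \<partial>count_space P) * indicator F' u \<partial>lborel)"
      by (subst s) (simp add: nn_integral_cmult_indicator)
    also have "\<dots> = (\<integral>\<^sup>+u. (\<integral>\<^sup>+p. g p * (indicator F (p - u) * indicator F' u) \<partial>count_space P) \<partial>lborel)"
      by (subst nn_integral_multc[symmetric]) (auto simp: mult.assoc)
    also have "\<dots> = (\<integral>\<^sup>+p. (\<integral>\<^sup>+u. g p * (indicator F (p - u) * indicator F' u) \<partial>lborel) \<partial>count_space P)"
      by (rule nn_integral_count_space_nn_integral[OF cP]) measurable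
    also have "\<dots> = (\<integral>\<^sup>+p. g p * (\<integral>\<^sup>+u. indicator F (p - u) * indicator F' u \<partial>lborel) \<partial>count_space P)"
      by (intro nn_integral_cong nn_integral_cmult) measurable
    finally show ?thesis .
  qed
  have sym: "(\<integral>\<^sup>+u. indicator L1.F (p - u) * indicator L2.F u \<partial>lborel)
      = (\<integral>\<^sup>+u. indicator L2.F (p - u) * indicator L1.F u \<partial>lborel)" for p
    by (subst nn_integral_lborel_reflect[symmetric, where c = p]) (simp_all add: mult.commute)
  show ?thesis
    by (simp add: J[OF s1] J[OF s2] sym)
qed

text \<open>The level sets of \<open>h\<close> are themselves invariant under both lattices, so the weighted count
  compares their sizes one value at a time.\<close>

lemma average_eq_complex:
  fixes h :: "'a::euclidean_space \<Rightarrow> complex"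
  assumes P1: "presentation \<Lambda>1 W1 P" and P2: "presentation \<Lambda>2 W2 P"
    and per1: "\<And>p l. p \<in> P \<Longrightarrow> l \<in> \<Lambda>1 \<Longrightarrow> h (p + l) = h p"
    and per2: "\<And>p l. p \<in> P \<Longrightarrow> l \<in> \<Lambda>2 \<Longrightarrow> h (p + l) = h p"
  shows "(1 / of_nat (card W1)) * (\<Sum>w\<in>W1. h w) = (1 / of_nat (card W2)) * (\<Sum>w\<in>W2. h w)"
proof -
  obtain B1 D1 where L1: "lattice_coords B1 D1 \<Lambda>1" using presentation_coords[OF P1] .
  obtain B2 D2 where L2: "lattice_coords B2 D2 \<Lambda>2" using presentation_coords[OF P2] .
  interpret L1: lattice_coords B1 D1 \<Lambda>1 by fact
  interpret L2: lattice_coords B2 D2 \<Lambda>2 by fact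
  have fin: "finite W1" "finite W2" "W1 \<noteq> {}" "W2 \<noteq> {}" using P1 P2 by (auto simp: presentation_def)
  have level: "real (card {w\<in>W1. Q (h w)}) * L2.vol = real (card {w\<in>W2. Q (h w)}) * L1.vol" for Q
  proof -
    have "(\<Sum>w\<in>W1. if Q (h w) then 1 else 0) * ennreal L2.vol
        = (\<Sum>w\<in>W2. if Q (h w) then 1 else 0) * ennreal L1.vol"
      using weighted_count_eq[OF L1 L2 P1 P2, of "\<lambda>p. if Q (h p) then 1 else 0"] per1 per2
      by (simp add: L1.emeasure_fund L2.emeasure_fund)
    then have "ennreal (real (card {w\<in>W1. Q (h w)}) * L2.vol) = ennreal (real (card {w\<in>W2. Q (h w)}) * L1.vol)"
      using fin L1.vol_pos L2.vol_pos
      by (simp add: sum.If_cases Int_def ennreal_mult ennreal_of_nat_eq_real_of_nat)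
    then show ?thesis using L1.vol_pos L2.vol_pos
      by (simp add: ennreal_inj)
  qed
  have card: "real (card W1) * L2.vol = real (card W2) * L1.vol"
    using level[of "\<lambda>_. True"] by simp
  let ?I = "h ` W1 \<union> h ` W2"
  have by_level: "(\<Sum>w\<in>W. h w) = (\<Sum>c\<in>?I. of_nat (card {w\<in>W. h w = c}) * c)"
    if "finite W" "h ` W \<subseteq> ?I" for W
  proof -
    have "(\<Sum>w\<in>W. h w) = (\<Sum>c\<in>?I. \<Sum>w\<in>{w\<in>W. h w = c}. h w)"
      using that fin by (intro sum.group[symmetric]) auto
    then show ?thesis by simp
  qed
  have "(\<Sum>w\<in>W1. h w) * of_real L2.vol = (\<Sum>c\<in>?I. of_real (real (card {w\<in>W1. h w = c}) * L2.vol) * c)"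
    by (subst by_level[OF fin(1)]) (simp_all add: sum_distrib_right mult_ac sum_distrib_left)
  also have "\<dots> = (\<Sum>c\<in>?I. of_real (real (card {w\<in>W2. h w = c}) * L1.vol) * c)"
  proof (intro sum.cong refl)
    fix c
    have "real (card {w\<in>W1. h w = c}) * L2.vol = real (card {w\<in>W2. h w = c}) * L1.vol"
      using level[of "\<lambda>x. x = c"] .
    then show "of_real (real (card {w\<in>W1. h w = c}) * L2.vol) * c
        = of_real (real (card {w\<in>W2. h w = c}) * L1.vol) * c" by (rule arg_cong)
  qed
  also have "\<dots> = (\<Sum>w\<in>W2. h w) * of_real L1.vol"
    by (subst by_level[OF fin(2)]) (simp_all add: sum_distrib_right mult_ac sum_distrib_left)
  finally have main: "(\<Sum>w\<in>W1. h w) * of_real L2.vol = (\<Sum>w\<in>W2. h w) * of_real L1.vol" .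
  have "of_nat (card W1) * complex_of_real L2.vol = of_nat (card W2) * complex_of_real L1.vol"
    using arg_cong[OF card, of complex_of_real] by simp
  then have v: "complex_of_real L2.vol = of_nat (card W2) * complex_of_real L1.vol / of_nat (card W1)"
    using fin by (simp add: field_simps)
  show ?thesis
    using main L1.vol_pos fin unfolding v by (simp add: field_simps)
qed

lemma covolume_eq:
  assumes "lattice_coords B D \<Lambda>"
  shows "covolume \<Lambda> = lattice_coords.vol B"
proof -
  interpret lattice_coords B D \<Lambda> by fact
  have pres: "presentation \<Lambda> {0} \<Lambda>"
    using basis by (auto simp: presentation_def is_lattice_def)
  have "lattice_coords.vol B' = vol" if B': "lattice_basis B' \<Lambda>" for B'
  proof -
    obtain D' where L': "lattice_coords B' D' \<Lambda>" using lattice_coords_exist[OF B'] .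
    interpret L': lattice_coords B' D' \<Lambda> by fact
    show ?thesis
      using weighted_count_eq[OF L' lattice_coords_axioms pres pres, of "\<lambda>_. 1"] vol_pos L'.vol_pos
      by (simp add: emeasure_fund L'.emeasure_fund ennreal_inj)
  qed
  moreover have "measure lebesgue (fund_parallelepiped B') = lattice_coords.vol B'"
    if "lattice_basis B' \<Lambda>" for B'
    using lattice_coords_exist[OF that] lattice_coords.measure_lebesgue_fund by metis
  ultimately show ?thesis
    unfolding covolume_def
  proof (intro the_equality)
    show "\<exists>B'. lattice_basis B' \<Lambda> \<and> vol = measure lebesgue (fund_parallelepiped B')"
      by (intro exI[of _ B] conjI basis measure_lebesgue_fund[symmetric])
  next
    fix v assume "\<exists>B'. lattice_basis B' \<Lambda> \<and> v = measure lebesgue (fund_parallelepiped B')"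
    then obtain B' where "lattice_basis B' \<Lambda>" "v = measure lebesgue (fund_parallelepiped B')" by blast
    with \<open>\<And>B'. lattice_basis B' \<Lambda> \<Longrightarrow> lattice_coords.vol B' = vol\<close>
      \<open>\<And>B'. lattice_basis B' \<Lambda> \<Longrightarrow> measure lebesgue (fund_parallelepiped B') = lattice_coords.vol B'\<close>
    show "v = vol" by simp
  qed
qed

lemma particle_density_eq:
  assumes P: "presentation \<Lambda> W P"
  shows "particle_density P = real (card W) / covolume \<Lambda>"
  unfolding particle_density_def
proof (rule the_equality)
  show "\<exists>\<Lambda>' W'. presentation \<Lambda>' W' P \<and> real (card W) / covolume \<Lambda> = real (card W') / covolume \<Lambda>'"
    using P by blast
next
  fix \<delta> assume "\<exists>\<Lambda>' W'. presentation \<Lambda>' W' P \<and> \<delta> = real (card W') / covolume \<Lambda>'"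
  then obtain \<Lambda>' W' where P': "presentation \<Lambda>' W' P" and \<delta>: "\<delta> = real (card W') / covolume \<Lambda>'"
    by blast
  obtain B1 D1 where L1: "lattice_coords B1 D1 \<Lambda>" using presentation_coords[OF P] .
  obtain B2 D2 where L2: "lattice_coords B2 D2 \<Lambda>'" using presentation_coords[OF P'] .
  interpret L1: lattice_coords B1 D1 \<Lambda> by fact
  interpret L2: lattice_coords B2 D2 \<Lambda>' by fact
  have "ennreal (real (card W) * L2.vol) = ennreal (real (card W') * L1.vol)"
    using weighted_count_eq[OF L1 L2 P P', of "\<lambda>_. 1"] L1.vol_pos L2.vol_pos
    by (simp add: L1.emeasure_fund L2.emeasure_fund ennreal_mult ennreal_of_nat_eq_real_of_nat)
  then have "real (card W) * L2.vol = real (card W') * L1.vol"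
    using L1.vol_pos L2.vol_pos by (simp add: ennreal_inj)
  then show "\<delta> = real (card W) / covolume \<Lambda>"
    using L1.vol_pos L2.vol_pos by (simp add: \<delta> covolume_eq[OF L1] covolume_eq[OF L2] field_simps)
qed

lemma covolume_pos: "is_lattice \<Lambda> \<Longrightarrow> covolume \<Lambda> > 0"
proof -
  assume "is_lattice \<Lambda>"
  then obtain B where "lattice_basis B \<Lambda>" by (auto simp: is_lattice_def)
  then obtain D where "lattice_coords B D \<Lambda>" using lattice_coords_exist by blast
  then show ?thesis by (simp add: covolume_eq lattice_coords.vol_pos)
qed

lemma lattice_presentation: "is_lattice \<Lambda> \<Longrightarrow> presentation \<Lambda> {0} \<Lambda>"
  by (auto simp: presentation_def)

text \<open>A lattice presented by cosets of a sublattice has one density, computed in two ways; this replaces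
  determinants in all covolume computations.\<close>

lemma covolume_sublattice:
  assumes "presentation \<Lambda> W \<Gamma>" "is_lattice \<Gamma>"
  shows "covolume \<Lambda> = real (card W) * covolume \<Gamma>"
proof -
  have "covolume \<Lambda> > 0" using assms(1) by (auto simp: presentation_def intro: covolume_pos)
  then show ?thesis
  using particle_density_eq[OF assms(1)] particle_density_eq[OF lattice_presentation[OF assms(2)]]
    covolume_pos[OF assms(2)] by (simp add: field_simps)
qed

text \<open>The inner sums over a coset representative \<open>w\<close> and over the lattice merge into one sum over the whole
  configuration, which no longer mentions the presentation.\<close>

lemma pair_sum_eq:
  fixes f :: "'a::euclidean_space \<Rightarrow> complex"
  assumes P: "presentation \<Lambda> W P"
    and summable: "\<And>\<Lambda> t. is_lattice \<Lambda> \<Longrightarrow> (\<lambda>x. f (x + t)) summable_on \<Lambda>"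
  shows "pair_sum f P = (1 / of_nat (card W)) * (\<Sum>v\<in>W. \<Sum>w\<in>W. \<Sum>\<^sub>\<infinity>x\<in>\<Lambda>. f (x + v - w))"
proof -
  define g where "g p = (\<Sum>\<^sub>\<infinity>q\<in>P. f (p - q))" for p
  have inner: "(\<Sum>w\<in>W. \<Sum>\<^sub>\<infinity>x\<in>\<Lambda>. f (x + v - w)) = g v"
    and per: "\<And>l. l \<in> \<Lambda> \<Longrightarrow> g (v + l) = g v" if P: "presentation \<Lambda> W P" for \<Lambda> W v
  proof -
    obtain B D where "lattice_coords B D \<Lambda>" using presentation_coords[OF P] .
    then interpret lattice_coords B D \<Lambda> .
    have W: "finite W" "inj_on (\<lambda>v. (+) v ` \<Lambda>) W" "P = (\<Union>v\<in>W. (+) v ` \<Lambda>)" "is_lattice \<Lambda>"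
      using P by (auto simp: presentation_def)
    have bij: "bij_betw (\<lambda>x. w - x) \<Lambda> ((+) w ` \<Lambda>)" for w
    proof (rule bij_betw_imageI)
      have "w + l \<in> (\<lambda>x. w - x) ` \<Lambda>" if "l \<in> \<Lambda>" for l
        by (rule image_eqI[of _ _ "- l"]) (use minus_mem[OF that] in auto)
      moreover have "w - l \<in> (+) w ` \<Lambda>" if "l \<in> \<Lambda>" for l
        by (rule image_eqI[of _ _ "- l"]) (use minus_mem[OF that] in auto)
      ultimately show "(\<lambda>x. w - x) ` \<Lambda> = (+) w ` \<Lambda>" by auto
    qed (auto simp: inj_on_def)
    have sumw: "(\<lambda>q. f (v - q)) summable_on (+) w ` \<Lambda>" for w
      using summable[OF W(4), of "v - w"] summable_on_reindex_bij_betw[OF bij, of "\<lambda>q. f (v - q)" w]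
      by (simp add: algebra_simps)
    have disj: "(+) w ` \<Lambda> \<inter> (+) w' ` \<Lambda> = {}" if "w \<in> W" "w' \<in> W" "w \<noteq> w'" for w w'
    proof (rule ccontr)
      assume "(+) w ` \<Lambda> \<inter> (+) w' ` \<Lambda> \<noteq> {}"
      then obtain l l' where l: "l \<in> \<Lambda>" "l' \<in> \<Lambda>" "w + l = w' + l'" by auto
      then have "w - w' = l' - l" by (simp add: algebra_simps)
      then have "w - w' \<in> \<Lambda>" using diff_mem l by auto
      then show False using W(2) that by (auto simp: inj_on_def coset_eq_iff)
    qed
    have "(\<Sum>w\<in>W. \<Sum>\<^sub>\<infinity>x\<in>\<Lambda>. f (x + v - w)) = (\<Sum>w\<in>W. \<Sum>\<^sub>\<infinity>q\<in>(+) w ` \<Lambda>. f (v - q))"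
      using infsum_reindex_bij_betw[OF bij, of "\<lambda>q. f (v - q)"] by (simp add: algebra_simps)
    also have "\<dots> = g v"
      unfolding g_def W(3) using W(1) disj sumw
      by (intro sum_infsum) auto
    finally show "(\<Sum>w\<in>W. \<Sum>\<^sub>\<infinity>x\<in>\<Lambda>. f (x + v - w)) = g v" .
    fix l assume l: "l \<in> \<Lambda>"
    have "bij_betw (\<lambda>q. q + l) P P"
    proof (rule bij_betwI[where g = "\<lambda>q. q - l"])
      show "(\<lambda>q. q + l) \<in> P \<rightarrow> P" using add_mem[OF _ l] by (force simp: W(3) add.assoc)
      show "(\<lambda>q. q - l) \<in> P \<rightarrow> P"
        using diff_mem[OF _ l] by (force simp: W(3) add_diff_eq[symmetric])
    qed auto
    from infsum_reindex_bij_betw[OF this, of "\<lambda>q. f (v + l - q)"]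
    show "g (v + l) = g v" by (simp add: g_def)
  qed
  show ?thesis
    unfolding pair_sum_def
  proof (rule the_equality)
    fix s assume "\<exists>\<Lambda>' W'. presentation \<Lambda>' W' P \<and>
      s = (1 / of_nat (card W')) * (\<Sum>v\<in>W'. \<Sum>w\<in>W'. \<Sum>\<^sub>\<infinity>x\<in>\<Lambda>'. f (x + v - w))"
    then obtain \<Lambda>' W' where P': "presentation \<Lambda>' W' P"
      and s: "s = (1 / of_nat (card W')) * (\<Sum>v\<in>W'. \<Sum>w\<in>W'. \<Sum>\<^sub>\<infinity>x\<in>\<Lambda>'. f (x + v - w))" by blast
    show "s = (1 / of_nat (card W)) * (\<Sum>v\<in>W. \<Sum>w\<in>W. \<Sum>\<^sub>\<infinity>x\<in>\<Lambda>. f (x + v - w))"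
      unfolding s inner[OF P] inner[OF P']
      by (rule average_eq_complex[OF P' P]) (use per[OF P] per[OF P'] in auto)
  qed (use P in blast)
qed

section \<open>The structure factor and the stealth radius\<close>

definition phase_average :: "'a::euclidean_space set \<Rightarrow> 'a \<Rightarrow> complex" where
  "phase_average W \<xi> = (1 / of_nat (card W)) * (\<Sum>v\<in>W. exp (2 * pi * \<i> * complex_of_real (v \<bullet> \<xi>)))"

definition character :: "'a::euclidean_space \<Rightarrow> 'a \<Rightarrow> complex" where
  "character \<xi> x = exp (2 * pi * \<i> * complex_of_real (x \<bullet> \<xi>))"

lemma character_add: "character \<xi> (x + y) = character \<xi> x * character \<xi> y"
  by (simp add: character_def inner_add_left algebra_simps exp_add)

lemma character_eq_1_iff: "character \<xi> x = 1 \<longleftrightarrow> x \<bullet> \<xi> \<in> \<int>"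
proof -
  have "character \<xi> x = 1 \<longleftrightarrow> (\<exists>n::int. x \<bullet> \<xi> = of_int n)"
    by (auto simp: character_def exp_eq_1)
  then show ?thesis by (auto elim: Ints_cases)
qed

lemma character_norm [simp]: "norm (character \<xi> x) = 1"
  by (simp add: character_def)

lemma character_continuous [continuous_intros]: "continuous_on A (character \<xi>)"
  unfolding character_def by (intro continuous_intros)

lemma character_measurable [measurable]: "character \<xi> \<in> borel_measurable borel"
  by (rule borel_measurable_continuous_onI) (rule character_continuous)

lemma character_freq_add: "character (\<xi> + \<eta>) x = character \<xi> x * character \<eta> x"
  by (simp add: character_def inner_add_right exp_add[symmetric] algebra_simps)

lemma character_0 [simp]: "character 0 x = 1"
  by (simp add: character_def)

text \<open>Translation by a period \<open>t\<close> of the second lattice permutes the configuration and multiplies the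
  average by the character value at \<open>t\<close>; if the average is nonzero, that value is 1.\<close>

lemma phase_average_mem_dual:
  assumes P1: "presentation \<Lambda>1 W1 P" and P2: "presentation \<Lambda>2 W2 P"
    and xi: "\<xi> \<in> dual_lattice \<Lambda>1" and nz: "phase_average W1 \<xi> \<noteq> 0"
  shows "\<xi> \<in> dual_lattice \<Lambda>2"
  unfolding dual_lattice_def
proof (intro CollectI ballI)
  fix t assume t: "t \<in> \<Lambda>2"
  obtain B1 D1 where "lattice_coords B1 D1 \<Lambda>1" using presentation_coords[OF P1] .
  then interpret L1: lattice_coords B1 D1 \<Lambda>1 .
  obtain B2 D2 where "lattice_coords B2 D2 \<Lambda>2" using presentation_coords[OF P2] .
  then interpret L2: lattice_coords B2 D2 \<Lambda>2 .
  have W1: "finite W1" "W1 \<noteq> {}" "inj_on (\<lambda>v. (+) v ` \<Lambda>1) W1" "P = (\<Union>v\<in>W1. (+) v ` \<Lambda>1)" "is_lattice \<Lambda>1"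
    using P1 by (auto simp: presentation_def)
  have W2: "P = (\<Union>v\<in>W2. (+) v ` \<Lambda>2)" using P2 by (auto simp: presentation_def)
  have shift: "(+) t ` P = P"
  proof
    show "(+) t ` P \<subseteq> P" using L2.add_mem[OF t] by (force simp: W2 add.left_commute)
    show "P \<subseteq> (+) t ` P"
    proof
      fix p assume "p \<in> P"
      then have "p - t \<in> P" using L2.diff_mem[OF _ t] by (force simp: W2 add_diff_eq[symmetric])
      then show "p \<in> (+) t ` P" by force
    qed
  qed
  have P1': "presentation \<Lambda>1 ((+) t ` W1) P"
    unfolding presentation_def
  proof (intro conjI)
    show "inj_on (\<lambda>v. (+) v ` \<Lambda>1) ((+) t ` W1)"
      using W1(3) by (auto simp: inj_on_def L1.coset_eq_iff)
    show "P = (\<Union>v\<in>(+) t ` W1. (+) v ` \<Lambda>1)"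
      by (subst shift[symmetric]) (simp add: W1(4) image_UN image_image add.assoc)
  qed (use W1 in auto)
  have per: "character \<xi> (p + l) = character \<xi> p" if "l \<in> \<Lambda>1" for p l
  proof -
    have "character \<xi> l = 1"
      using that xi by (simp add: character_eq_1_iff dual_lattice_def inner_commute[of l])
    then show ?thesis by (simp add: character_add)
  qed
  have "phase_average W1 \<xi> = (1 / of_nat (card ((+) t ` W1))) * (\<Sum>w\<in>(+) t ` W1. character \<xi> w)"
    unfolding phase_average_def character_def[symmetric]
    by (rule average_eq_complex[OF P1 P1']) (auto simp: per)
  also have "\<dots> = character \<xi> t * phase_average W1 \<xi>"
    unfolding phase_average_def character_def[symmetric]
    by (simp add: card_image sum.reindex character_add sum_distrib_left)
  finally have "character \<xi> t = 1" using nz by simp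
  then show "\<xi> \<bullet> t \<in> \<int>" by (simp add: character_eq_1_iff inner_commute)
qed

lemma phase_average_eq:
  assumes P1: "presentation \<Lambda>1 W1 P" and P2: "presentation \<Lambda>2 W2 P"
    and xi: "\<xi> \<in> dual_lattice \<Lambda>1" "\<xi> \<in> dual_lattice \<Lambda>2"
  shows "phase_average W1 \<xi> = phase_average W2 \<xi>"
proof -
  have per: "character \<xi> (p + l) = character \<xi> p" if "l \<in> \<Lambda>" "\<xi> \<in> dual_lattice \<Lambda>" for p l \<Lambda>
  proof -
    have "character \<xi> l = 1"
      using that by (simp add: character_eq_1_iff dual_lattice_def inner_commute[of l])
    then show ?thesis by (simp add: character_add)
  qed
  show ?thesis
    unfolding phase_average_def character_def[symmetric]
    by (rule average_eq_complex[OF P1 P2]) (use per xi in auto)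
qed

text \<open>The two densities agree at frequencies in both dual lattices because averages do; at a frequency
  in only one of them, the average there vanishes.\<close>

lemma structure_factor_eq:
  assumes P: "presentation \<Lambda> W P"
  shows "structure_factor P = density (count_space UNIV)
    (\<lambda>\<xi>. ennreal ((cmod (phase_average W \<xi>))\<^sup>2) * indicator (dual_lattice \<Lambda> - {0}) \<xi>)"
  unfolding structure_factor_def phase_average_def[symmetric]
proof (rule the_equality)
  fix S assume "\<exists>\<Lambda>' W'. presentation \<Lambda>' W' P \<and> S = density (count_space UNIV)
    (\<lambda>\<xi>. ennreal ((cmod (phase_average W' \<xi>))\<^sup>2) * indicator (dual_lattice \<Lambda>' - {0}) \<xi>)"
  then obtain \<Lambda>' W' where P': "presentation \<Lambda>' W' P" and S: "S = density (count_space UNIV)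
    (\<lambda>\<xi>. ennreal ((cmod (phase_average W' \<xi>))\<^sup>2) * indicator (dual_lattice \<Lambda>' - {0}) \<xi>)" by blast
  have "ennreal ((cmod (phase_average W' \<xi>))\<^sup>2) * indicator (dual_lattice \<Lambda>' - {0}) \<xi>
      = ennreal ((cmod (phase_average W \<xi>))\<^sup>2) * indicator (dual_lattice \<Lambda> - {0}) \<xi>" for \<xi>
  proof (cases "\<xi> \<in> dual_lattice \<Lambda>"; cases "\<xi> \<in> dual_lattice \<Lambda>'")
    assume "\<xi> \<in> dual_lattice \<Lambda>" "\<xi> \<in> dual_lattice \<Lambda>'"
    then show ?thesis using phase_average_eq[OF P P'] by (simp split: split_indicator)
  next
    assume "\<xi> \<in> dual_lattice \<Lambda>" "\<xi> \<notin> dual_lattice \<Lambda>'"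
    then show ?thesis using phase_average_mem_dual[OF P P'] by (auto split: split_indicator)
  next
    assume "\<xi> \<notin> dual_lattice \<Lambda>" "\<xi> \<in> dual_lattice \<Lambda>'"
    then show ?thesis using phase_average_mem_dual[OF P' P] by (auto split: split_indicator)
  qed simp
  then show "S = density (count_space UNIV)
    (\<lambda>\<xi>. ennreal ((cmod (phase_average W \<xi>))\<^sup>2) * indicator (dual_lattice \<Lambda> - {0}) \<xi>)"
    by (simp add: S)
qed (use P in blast)

lemma stealth_radius_eqI:
  assumes P: "presentation \<Lambda> W P"
    and low: "\<And>\<xi>. \<xi> \<in> dual_lattice \<Lambda> \<Longrightarrow> \<xi> \<noteq> 0 \<Longrightarrow> phase_average W \<xi> \<noteq> 0 \<Longrightarrow> r \<le> norm \<xi>"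
    and att: "\<exists>\<xi>. \<xi> \<in> dual_lattice \<Lambda> \<and> \<xi> \<noteq> 0 \<and> phase_average W \<xi> \<noteq> 0 \<and> norm \<xi> = r"
  shows "stealth_radius P = r"
proof -
  let ?d = "\<lambda>\<xi>. ennreal ((cmod (phase_average W \<xi>))\<^sup>2) * indicator (dual_lattice \<Lambda> - {0}) \<xi>"
  have null: "emeasure (structure_factor P) A = 0 \<longleftrightarrow>
      (\<forall>\<xi>\<in>A. \<xi> \<in> dual_lattice \<Lambda> \<longrightarrow> \<xi> \<noteq> 0 \<longrightarrow> phase_average W \<xi> = 0)" for A
    unfolding structure_factor_eq[OF P]
    by (simp add: emeasure_density nn_integral_0_iff_AE AE_count_space)
      (auto split: split_indicator)
  obtain \<xi> where xi: "\<xi> \<in> dual_lattice \<Lambda>" "\<xi> \<noteq> 0" "phase_average W \<xi> \<noteq> 0" "norm \<xi> = r"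
    using att by blast
  have "{s. 0 \<le> s \<and> emeasure (structure_factor P) (ball 0 s) = 0} = {0..r}"
  proof (intro equalityI subsetI)
    fix s assume "s \<in> {s. 0 \<le> s \<and> emeasure (structure_factor P) (ball 0 s) = 0}"
    then have "0 \<le> s" "\<xi> \<notin> ball 0 s" using xi by (auto simp: null)
    then show "s \<in> {0..r}" using xi by auto
  next
    fix s assume "s \<in> {0..r}"
    then show "s \<in> {s. 0 \<le> s \<and> emeasure (structure_factor P) (ball 0 s) = 0}"
      using low by (force simp: null)
  qed
  moreover have "r \<ge> 0" using xi by auto
  ultimately show ?thesis by (simp add: stealth_radius_def)
qed


section \<open>Polynomial decay\<close>

text \<open>A product weight, so that integrability reduces to one variable, and which at the same time is
  comparable to its translates by bounded vectors.\<close>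

definition weight :: "'a::euclidean_space \<Rightarrow> real" where
  "weight x = (\<Prod>b\<in>Basis. 1 / (1 + (x \<bullet> b)\<^sup>2))"

definition weight_bounded :: "('a::euclidean_space \<Rightarrow> complex) \<Rightarrow> bool" where
  "weight_bounded f \<longleftrightarrow> (\<exists>C. \<forall>x. norm (f x) \<le> C * weight x)"

lemma one_plus_square_pos [simp]: "1 + (x::real)\<^sup>2 > 0"
  by (simp add: add_pos_nonneg)

lemma one_plus_square_neq [simp]: "1 + (x::real)\<^sup>2 \<noteq> 0"
  using one_plus_square_pos[of x] by linarith

lemma weight_pos: "weight x > 0"
  unfolding weight_def by (intro prod_pos) simp

lemma weight_measurable [measurable]: "weight \<in> borel_measurable borel"
  unfolding weight_def by measurable

lemma integrable_weight: "integrable lborel (weight :: 'a::euclidean_space \<Rightarrow> real)"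
proof (rule integrableI_bounded)
  let ?f = "\<lambda>x::real. ennreal (1 / (1 + x\<^sup>2))"
  have half: "(\<integral>\<^sup>+x. ?f x * indicator {0..} x \<partial>lborel) = ennreal (pi / 2 - arctan 0)"
    by (rule nn_integral_FTC_atLeast) (auto intro!: derivative_eq_intros tendsto_arctan_at_top simp: field_simps)
  have "(\<integral>\<^sup>+x. ?f x \<partial>lborel)
      \<le> (\<integral>\<^sup>+x. ?f x * indicator {0..} x + ?f (0 - x) * indicator {0..} (0 - x) \<partial>lborel)"
    by (intro nn_integral_mono) (auto split: split_indicator)
  also have "\<dots> = (\<integral>\<^sup>+x. ?f x * indicator {0..} x \<partial>lborel) + (\<integral>\<^sup>+x. ?f (0 - x) * indicator {0..} (0 - x) \<partial>lborel)"
    by (intro nn_integral_add) auto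
  also have "\<dots> < \<infinity>"
    by (subst nn_integral_lborel_reflect) (auto simp: half ennreal_plus[symmetric] simp del: ennreal_plus)
  finally have fin: "(\<integral>\<^sup>+x. ?f x \<partial>lborel) < \<infinity>" .
  have "(\<integral>\<^sup>+x. ennreal (norm (weight (x::'a))) \<partial>lborel) = (\<integral>\<^sup>+x. (\<Prod>b\<in>Basis. ?f ((x::'a) \<bullet> b)) \<partial>lborel)"
    by (intro nn_integral_cong) (simp add: weight_def prod_ennreal abs_prod)
  also have "\<dots> = (\<Prod>b\<in>(Basis::'a set). (\<integral>\<^sup>+x. ?f x \<partial>lborel))"
    by (rule nn_integral_lborel_prod) auto
  also have "\<dots> < \<infinity>" using fin
    by (cases "\<integral>\<^sup>+x. ?f x \<partial>lborel") (simp_all add: ennreal_power)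
  finally show "(\<integral>\<^sup>+x. ennreal (norm (weight (x::'a))) \<partial>lborel) < \<infinity>" .
qed simp

text \<open>Peetre's inequality, one coordinate at a time: \<open>1 + (a + e)\<^sup>2 \<le> 2 (1 + e\<^sup>2) (1 + a\<^sup>2)\<close>.\<close>

lemma weight_translate_le:
  fixes x d :: "'a::euclidean_space"
  assumes "norm d \<le> R"
  shows "weight x \<le> (2 * (1 + R\<^sup>2)) ^ DIM('a) * weight (x + d)"
proof -
  have "1 / (1 + (x \<bullet> b)\<^sup>2) \<le> 2 * (1 + R\<^sup>2) * (1 / (1 + ((x + d) \<bullet> b)\<^sup>2))" if b: "b \<in> Basis" for b
  proof -
    define a e where "a = x \<bullet> b" and "e = d \<bullet> b"
    have "\<bar>e\<bar> \<le> R" using Basis_le_norm[OF b, of d] assms by (simp add: e_def)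
    then have "e\<^sup>2 \<le> R\<^sup>2" using abs_le_square_iff[of e R] by auto
    then have "(1 + e\<^sup>2) * (1 + a\<^sup>2) \<le> (1 + R\<^sup>2) * (1 + a\<^sup>2)" by (intro mult_right_mono) auto
    moreover have "1 + (a + e)\<^sup>2 \<le> 2 * ((1 + e\<^sup>2) * (1 + a\<^sup>2))"
    proof -
      have "2 * ((1 + e\<^sup>2) * (1 + a\<^sup>2)) - (1 + (a + e)\<^sup>2) = 1 + (a - e)\<^sup>2 + 2 * (e * a)\<^sup>2"
        by (simp add: power2_eq_square algebra_simps)
      also have "\<dots> \<ge> 0" by simp
      finally show ?thesis by simp
    qed
    ultimately have "1 + (a + e)\<^sup>2 \<le> 2 * ((1 + R\<^sup>2) * (1 + a\<^sup>2))" by linarith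
    then have "1 + (a + e)\<^sup>2 \<le> 2 * (1 + R\<^sup>2) * (1 + a\<^sup>2)" by (simp only: mult.assoc)
    then show ?thesis
      by (simp add: inner_add_left a_def[symmetric] e_def[symmetric] divide_simps)
  qed
  then have "weight x \<le> (\<Prod>b\<in>Basis. 2 * (1 + R\<^sup>2) * (1 / (1 + ((x + d) \<bullet> b)\<^sup>2)))"
    unfolding weight_def by (intro prod_mono) auto
  also have "\<dots> = (2 * (1 + R\<^sup>2)) ^ DIM('a) * weight (x + d)"
    by (simp only: weight_def prod.distrib prod_constant power_mult_distrib)
  finally show ?thesis .
qed

lemma weight_shift_le:
  fixes x t :: "'a::euclidean_space"
  assumes "norm t \<le> R"
  shows "weight (x + t) \<le> (2 * (1 + R\<^sup>2)) ^ DIM('a) * weight x"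
  using weight_translate_le[of "- t" R "x + t"] assms by simp

lemma weight_bounded_nonneg:
  assumes "weight_bounded (f :: 'a::euclidean_space \<Rightarrow> complex)"
  shows "\<exists>C\<ge>0. \<forall>x. norm (f x) \<le> C * weight x"
proof -
  obtain C where C: "\<And>x. norm (f x) \<le> C * weight x" using assms by (auto simp: weight_bounded_def)
  have "C * weight (0::'a) \<ge> 0" using norm_ge_zero C order_trans by blast
  then have "C \<ge> 0" using weight_pos[of "0::'a"] by (simp add: zero_le_mult_iff)
  then show ?thesis using C by blast
qed

lemma weight_bounded_shift:
  assumes "weight_bounded f"
  shows "weight_bounded (\<lambda>x. f (x + t))"
proof -
  obtain C where "C \<ge> 0" and C: "\<And>x. norm (f x) \<le> C * weight x" using weight_bounded_nonneg[OF assms] by auto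
  have "norm (f (x + t)) \<le> C * ((2 * (1 + (norm t)\<^sup>2)) ^ DIM('a)) * weight x" for x
    using C[of "x + t"] mult_left_mono[OF weight_shift_le[of t "norm t" x] \<open>C \<ge> 0\<close>] by simp
  then show ?thesis unfolding weight_bounded_def by blast
qed

lemma weight_bounded_mult:
  assumes "weight_bounded f" "\<And>x. norm (g x) \<le> 1"
  shows "weight_bounded (\<lambda>x. f x * g x)"
proof -
  from assms obtain C where C: "\<And>x. norm (f x) \<le> C * weight x" by (auto simp: weight_bounded_def)
  have "norm (f x * g x) \<le> C * weight x" for x
    using mult_left_mono[OF assms(2)[of x] norm_ge_zero[of "f x"]] C[of x] by (simp add: norm_mult)
  then show ?thesis unfolding weight_bounded_def by blast
qed

lemma weight_bounded_integrable:
  fixes f :: "'a::euclidean_space \<Rightarrow> complex"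
  assumes "weight_bounded f" "f \<in> borel_measurable borel"
  shows "integrable lborel f"
proof -
  from assms obtain C where C: "\<And>x. norm (f x) \<le> C * weight x" by (auto simp: weight_bounded_def)
  have int: "integrable lborel (\<lambda>x::'a. C * weight x)" by (intro integrable_mult_right integrable_weight)
  have "norm (f x) \<le> norm (C * weight x)" for x
    by (rule order_trans[OF C]) simp
  then show ?thesis
    by (intro Bochner_Integration.integrable_bound[OF int _ AE_I2]) (use assms(2) in simp_all)
qed

context lattice_coords
begin

lemma nn_integral_tiling:
  fixes g :: "'a \<Rightarrow> ennreal"
  assumes [measurable]: "g \<in> borel_measurable borel"
  shows "(\<integral>\<^sup>+x. g x \<partial>lborel) = (\<integral>\<^sup>+l. (\<integral>\<^sup>+y. g (l + y) * indicator F y \<partial>lborel) \<partial>count_space \<Lambda>)"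
proof -
  have one: "(\<integral>\<^sup>+l. g x * indicator F (x - l) \<partial>count_space \<Lambda>) = g x" for x
    by (subst nn_integral_count_space'[where A = "{lat_floor x}"])
      (auto simp: lat_floor_mem diff_fund_iff[OF lat_floor_mem] diff_fund_iff split: split_indicator)
  have "(\<integral>\<^sup>+x. g x \<partial>lborel) = (\<integral>\<^sup>+x. \<integral>\<^sup>+l. g x * indicator F (x - l) \<partial>count_space \<Lambda> \<partial>lborel)"
    by (simp add: one)
  also have "\<dots> = (\<integral>\<^sup>+l. \<integral>\<^sup>+x. g x * indicator F (x - l) \<partial>lborel \<partial>count_space \<Lambda>)"
    by (rule nn_integral_count_space_nn_integral[OF countable_lattice]) measurable
  also have "\<dots> = (\<integral>\<^sup>+l. (\<integral>\<^sup>+y. g (l + y) * indicator F y \<partial>lborel) \<partial>count_space \<Lambda>)"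
  proof (rule nn_integral_cong)
    fix l
    show "(\<integral>\<^sup>+x. g x * indicator F (x - l) \<partial>lborel) = (\<integral>\<^sup>+y. g (l + y) * indicator F y \<partial>lborel)"
      by (subst nn_integral_lborel_shift[symmetric, where c = l]) simp_all
  qed
  finally show ?thesis .
qed

text \<open>On each translate of the fundamental domain the weight is at least a constant multiple of its
  value at the lattice point, so the sum is bounded by a multiple of the integral.\<close>

lemma weight_summable: "weight summable_on \<Lambda>"
proof (rule nonneg_bdd_above_summable_on)
  define R where "R = (\<Sum>b\<in>B. norm b)"
  define C where "C = (2 * (1 + R\<^sup>2)) ^ DIM('a)"
  have C: "C > 0" unfolding C_def by (intro zero_less_power mult_pos_pos) auto
  obtain I where I: "(\<integral>\<^sup>+x. ennreal (weight (x::'a)) \<partial>lborel) = ennreal I" "I \<ge> 0"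
  proof (rule that)
    show "(\<integral>\<^sup>+x. ennreal (weight (x::'a)) \<partial>lborel) = ennreal (LINT x|lborel. weight (x::'a))"
      by (rule nn_integral_eq_integral[OF integrable_weight]) (simp add: weight_pos less_imp_le)
    show "0 \<le> (LINT x|lborel. weight (x::'a))"
      by (rule Bochner_Integration.integral_nonneg) (simp add: weight_pos less_imp_le)
  qed
  have "sum weight S \<le> C * I / vol" if S: "finite S" "S \<subseteq> \<Lambda>" for S
  proof -
    have "ennreal (sum weight S * vol) = ennreal (\<Sum>l\<in>S. weight l * vol)"
      by (simp add: sum_distrib_right)
    also have "\<dots> = (\<Sum>l\<in>S. ennreal (weight l * vol))"
      using vol_pos by (intro sum_ennreal[symmetric]) (simp add: weight_pos less_imp_le)
    also have "\<dots> = (\<Sum>l\<in>S. ennreal (weight l) * emeasure lborel F)"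
      using vol_pos by (simp add: emeasure_fund ennreal_mult weight_pos less_imp_le)
    also have "\<dots> = (\<Sum>l\<in>S. (\<integral>\<^sup>+y. ennreal (weight l) * indicator F y \<partial>lborel))"
      by (simp add: nn_integral_cmult_indicator)
    also have "\<dots> \<le> (\<Sum>l\<in>S. (\<integral>\<^sup>+y. ennreal (C * weight (l + y)) * indicator F y \<partial>lborel))"
    proof (intro sum_mono nn_integral_mono)
      fix l y
      show "ennreal (weight l) * indicator F y \<le> ennreal (C * weight (l + y)) * indicator F y"
        using weight_translate_le[of y R l] norm_closed_fund[of y] fund_subset_closed
        by (auto simp: C_def R_def intro!: ennreal_leI split: split_indicator)
    qed
    also have "\<dots> = (\<integral>\<^sup>+l. (\<integral>\<^sup>+y. ennreal (C * weight (l + y)) * indicator F y \<partial>lborel) \<partial>count_space S)"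
      by (simp add: nn_integral_count_space_finite S)
    also have "\<dots> \<le> (\<integral>\<^sup>+l. (\<integral>\<^sup>+y. ennreal (C * weight (l + y)) * indicator F y \<partial>lborel) \<partial>count_space \<Lambda>)"
      using S(2) by (subst (1 2) nn_integral_count_space_indicator)
        (auto intro!: nn_integral_mono split: split_indicator)
    also have "\<dots> = (\<integral>\<^sup>+x. ennreal (C * weight (x::'a)) \<partial>lborel)"
      by (rule nn_integral_tiling[symmetric]) measurable
    also have "\<dots> = ennreal (C * I)"
      using C by (simp add: ennreal_mult' nn_integral_cmult I)
    finally have "sum weight S * vol \<le> C * I" using C I by (simp add: ennreal_le_iff)
    then show ?thesis using vol_pos by (simp add: field_simps)
  qed
  then show "bdd_above (sum weight ` {F. F \<subseteq> \<Lambda> \<and> finite F})"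
    by (intro bdd_aboveI2[where M = "C * I / vol"]) auto
qed (simp add: weight_pos less_imp_le)

lemma weight_bounded_abs_summable:
  assumes "weight_bounded f"
  shows "(\<lambda>x. norm (f x)) summable_on \<Lambda>"
proof -
  from assms obtain C where C: "\<And>x. norm (f x) \<le> C * weight x" by (auto simp: weight_bounded_def)
  show ?thesis
    by (rule Infinite_Sum.abs_summable_on_comparison_test'[OF summable_on_cmult_right[OF weight_summable, of C] C])
qed

lemma weight_bounded_summable:
  assumes "weight_bounded f"
  shows "f summable_on \<Lambda>"
  using abs_summable_summable[OF weight_bounded_abs_summable[OF assms]] .

end

lemma pair_sum_weight_bounded:
  assumes P: "presentation \<Lambda> W P" and f: "weight_bounded f"
  shows "pair_sum f P = (1 / of_nat (card W)) * (\<Sum>v\<in>W. \<Sum>w\<in>W. \<Sum>\<^sub>\<infinity>x\<in>\<Lambda>. f (x + v - w))"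
proof (rule pair_sum_eq[OF P])
  fix \<Lambda> :: "'a set" and t
  assume "is_lattice \<Lambda>"
  then obtain B where "lattice_basis B \<Lambda>" by (auto simp: is_lattice_def)
  then obtain D where "lattice_coords B D \<Lambda>" using lattice_coords_exist by blast
  from lattice_coords.weight_bounded_summable[OF this weight_bounded_shift[OF f]]
  show "(\<lambda>x. f (x + t)) summable_on \<Lambda>" .
qed

section \<open>Decay of the Fourier transform of a Schwartz function\<close>

definition partial :: "'a::euclidean_space \<Rightarrow> ('a \<Rightarrow> complex) \<Rightarrow> 'a \<Rightarrow> complex" where
  "partial b f = (\<lambda>x. frechet_derivative f (at x) b)"

lemma iterated_deriv_append: "iterated_deriv (us @ vs) f = iterated_deriv us (iterated_deriv vs f)"
  by (induction us) auto

lemma schwartz_partial: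
  assumes "schwartz f" "b \<in> Basis" shows "schwartz (partial b f)"
proof -
  have "iterated_deriv vs (partial b f) = iterated_deriv (vs @ [b]) f" for vs
    by (simp add: iterated_deriv_append partial_def)
  then show ?thesis using assms by (simp add: schwartz_def)
qed

lemma schwartz_differentiable: "schwartz f \<Longrightarrow> f differentiable (at x)"
  unfolding schwartz_def by (drule bspec[of _ _ "[]"]) auto

lemma schwartz_continuous: "schwartz f \<Longrightarrow> continuous_on UNIV f"
  by (simp add: continuous_at_imp_continuous_on differentiable_imp_continuous_within schwartz_differentiable)

lemma schwartz_measurable: "schwartz f \<Longrightarrow> f \<in> borel_measurable borel"
  by (rule borel_measurable_continuous_onI) (rule schwartz_continuous)

text \<open>The reciprocal of the weight is at most \<open>(1 + |x|\<^sup>2)\<^sup>n\<close>, which is controlled by the two powers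
  \<open>|x|\<^sup>0\<close> and \<open>|x|\<^sup>2\<^sup>n\<close>.\<close>

lemma schwartz_weight_bounded:
  fixes f :: "'a::euclidean_space \<Rightarrow> complex"
  assumes "schwartz f" shows "weight_bounded f"
proof -
  have bd: "bounded (range (\<lambda>x. norm x ^ k *\<^sub>R f x))" for k
    using assms unfolding schwartz_def by (drule_tac bspec[of _ _ "[]"]) auto
  let ?n = "DIM('a)"
  obtain c0 where c0: "\<And>x. norm (f x) \<le> c0"
    using bd[of 0] by (auto simp: bounded_iff)
  obtain c1 where c1: "\<And>x. norm x ^ (2 * ?n) * norm (f x) \<le> c1"
    using bd[of "2 * ?n"] by (auto simp: bounded_iff)
  have "norm (f x) \<le> 2 ^ ?n * (c0 + c1) * weight x" for x
  proof -
    have "(\<Prod>b\<in>Basis. 1 + (x \<bullet> b)\<^sup>2) \<le> (\<Prod>b\<in>(Basis::'a set). 1 + (norm x)\<^sup>2)"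
      using Basis_le_norm[of _ x] abs_le_square_iff[of _ "norm x"] by (intro prod_mono) auto
    also have "\<dots> = (1 + (norm x)\<^sup>2) ^ ?n" by simp
    also have "\<dots> \<le> 2 ^ ?n * (1 + norm x ^ (2 * ?n))"
    proof (cases "norm x \<le> 1")
      case True
      then have "(1 + (norm x)\<^sup>2) ^ ?n \<le> 2 ^ ?n"
        by (intro power_mono) (auto simp: power_le_one)
      moreover have "(2::real) ^ ?n * 1 \<le> 2 ^ ?n * (1 + norm x ^ (2 * ?n))"
        by (intro mult_left_mono) auto
      ultimately show ?thesis by linarith
    next
      case False
      then have "1 \<le> (norm x)\<^sup>2" by (simp add: one_le_power)
      then have "(1 + (norm x)\<^sup>2) ^ ?n \<le> (2 * (norm x)\<^sup>2) ^ ?n" by (intro power_mono) auto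
      also have "\<dots> = 2 ^ ?n * norm x ^ (2 * ?n)" by (simp add: power_mult_distrib power_mult)
      also have "\<dots> \<le> 2 ^ ?n * (1 + norm x ^ (2 * ?n))" by (intro mult_left_mono) auto
      finally show ?thesis .
    qed
    finally have "(\<Prod>b\<in>Basis. 1 + (x \<bullet> b)\<^sup>2) * norm (f x) \<le> 2 ^ ?n * (1 + norm x ^ (2 * ?n)) * norm (f x)"
      by (intro mult_right_mono) auto
    also have "\<dots> = 2 ^ ?n * (norm (f x) + norm x ^ (2 * ?n) * norm (f x))" by (simp add: algebra_simps)
    also have "\<dots> \<le> 2 ^ ?n * (c0 + c1)" using c0[of x] c1[of x] by (intro mult_left_mono) auto
    finally have "(\<Prod>b\<in>Basis. 1 + (x \<bullet> b)\<^sup>2) * norm (f x) \<le> 2 ^ ?n * (c0 + c1)" .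
    moreover have "(\<Prod>b\<in>Basis. 1 + (x \<bullet> b)\<^sup>2) > 0" by (intro prod_pos) auto
    ultimately show ?thesis
      by (simp add: weight_def prod_dividef field_simps)
  qed
  then show ?thesis unfolding weight_bounded_def by blast
qed

lemma integral_lborel_shift:
  fixes f :: "'a::euclidean_space \<Rightarrow> complex"
  assumes [measurable]: "f \<in> borel_measurable borel"
  shows "(LINT x|lborel. f (c + x)) = (LINT x|lborel. f x)"
proof -
  have "(LINT x|distr lborel borel ((+) c). f x) = (LINT x|lborel. f (c + x))"
    by (subst integral_distr) auto
  then show ?thesis by (simp add: lborel_distr_plus)
qed

lemma fourier_eq: "fourier f \<xi> = (LINT x|lborel. f x * character (- \<xi>) x)"
  by (simp add: fourier_def character_def)

lemma fourier_shift:
  assumes [measurable]: "f \<in> borel_measurable borel"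
  shows "fourier (\<lambda>x. f (x + t)) \<xi> = character \<xi> t * fourier f \<xi>"
proof -
  have "fourier f \<xi> = (LINT x|lborel. f (t + x) * character (- \<xi>) (t + x))"
    unfolding fourier_eq by (rule integral_lborel_shift[symmetric]) measurable
  also have "\<dots> = character (- \<xi>) t * fourier (\<lambda>x. f (x + t)) \<xi>"
    unfolding fourier_eq by (subst integral_mult_right_zero[symmetric])
      (simp add: character_add mult_ac add_ac)
  finally show ?thesis
    using character_freq_add[of \<xi> "- \<xi>" t] by (simp add: mult.assoc[symmetric])
qed

lemma difference_quotient_le:
  fixes f :: "'a::euclidean_space \<Rightarrow> complex"
  assumes f: "\<And>y. f differentiable (at y)" and h: "h > 0"
    and bd: "\<And>s. 0 \<le> s \<Longrightarrow> s \<le> h \<Longrightarrow> norm (partial b f (x + s *\<^sub>R b)) \<le> M"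
  shows "norm (f (x + h *\<^sub>R b) - f x) \<le> h * M"
proof -
  have der: "((\<lambda>s. f (x + s *\<^sub>R b)) has_derivative (\<lambda>r. r *\<^sub>R partial b f (x + s *\<^sub>R b))) (at s within {0..h})" for s
  proof -
    have fd: "(f has_derivative frechet_derivative f (at (x + s *\<^sub>R b))) (at (x + s *\<^sub>R b))"
      using f frechet_derivative_works by blast
    then have lin: "linear (frechet_derivative f (at (x + s *\<^sub>R b)))"
      by (rule has_derivative_linear)
    have "((\<lambda>s. x + s *\<^sub>R b) has_derivative (\<lambda>r. r *\<^sub>R b)) (at s within {0..h})"
      by (auto intro!: derivative_eq_intros)
    from has_derivative_compose[OF this fd]
    show ?thesis by (simp add: partial_def linear_scale[OF lin])
  qed
  have "norm (f (x + h *\<^sub>R b) - f (x + 0 *\<^sub>R b)) \<le> M * norm (h - 0)"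
  proof (rule differentiable_bound[OF _ der])
    fix s assume s: "s \<in> {0..h}"
    show "onorm (\<lambda>r. r *\<^sub>R partial b f (x + s *\<^sub>R b)) \<le> M"
      using bd[of s] s by (intro onorm_le) (auto simp: mult.commute[of M] intro: mult_left_mono)
  qed (use h in auto)
  then show ?thesis using h by (simp add: mult.commute)
qed

text \<open>Instead of integration by parts, the Fourier transform of a difference quotient is computed
  exactly by translation invariance, and the step tends to 0 under the integral sign.\<close>

lemma fourier_partial:
  fixes f :: "'a::euclidean_space \<Rightarrow> complex"
  assumes f: "schwartz f" and b: "b \<in> Basis"
  shows "fourier (partial b f) \<xi> = 2 * pi * \<i> * complex_of_real (\<xi> \<bullet> b) * fourier f \<xi>"
proof -
  define h :: "nat \<Rightarrow> real" where "h k = 1 / Suc k" for k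
  have h: "h k > 0" "h k \<le> 1" for k by (auto simp: h_def)
  have h0: "h \<longlonglongrightarrow> 0" unfolding h_def by (rule LIMSEQ_Suc[OF lim_1_over_n])
  note [measurable] = schwartz_measurable[OF f] schwartz_measurable[OF schwartz_partial[OF f b]]
  have int_f: "integrable lborel (\<lambda>x. f (t + x) * character (- \<xi>) x)" for t
    using weight_bounded_mult[OF weight_bounded_shift[OF schwartz_weight_bounded[OF f]]]
    by (intro weight_bounded_integrable) (auto simp: add.commute[of t])
  obtain C where C0: "C \<ge> 0" and C: "\<And>x. norm (partial b f x) \<le> C * weight x"
    using weight_bounded_nonneg[OF schwartz_weight_bounded[OF schwartz_partial[OF f b]]] by auto
  \<comment> \<open>the factor by which the weight can grow under translations of length at most 1\<close>
  define C' where "C' = C * 4 ^ DIM('a)"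
  define s where "s k x = (f (h k *\<^sub>R b + x) - f x) / complex_of_real (h k) * character (- \<xi>) x" for k x
  have bound: "norm (s k x) \<le> C' * weight x" for k x
  proof -
    have "norm (f (x + h k *\<^sub>R b) - f x) \<le> h k * (C' * weight x)"
    proof (rule difference_quotient_le)
      fix r assume r: "0 \<le> r" "r \<le> h k"
      then have "norm (r *\<^sub>R b) \<le> 1" using h[of k] b by simp
      then have "weight (x + r *\<^sub>R b) \<le> 4 ^ DIM('a) * weight x"
        using weight_shift_le[of "r *\<^sub>R b" 1 x] by simp
      from mult_left_mono[OF this C0] C[of "x + r *\<^sub>R b"]
      show "norm (partial b f (x + r *\<^sub>R b)) \<le> C' * weight x" by (simp add: C'_def)
    qed (use schwartz_differentiable[OF f] h in auto)
    then have "norm (f (h k *\<^sub>R b + x) - f x) / h k \<le> C' * weight x"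
      using h[of k] by (simp add: field_simps)
    then show ?thesis using h[of k] by (simp add: s_def norm_mult norm_divide)
  qed
  have lim: "(\<lambda>k. s k x) \<longlonglongrightarrow> partial b f x * character (- \<xi>) x" for x
  proof -
    have fd: "(f has_derivative frechet_derivative f (at x)) (at x)"
      using schwartz_differentiable[OF f] frechet_derivative_works by blast
    then have lin: "linear (frechet_derivative f (at x))" by (rule has_derivative_linear)
    have "(\<lambda>d. norm (f (x + d) - f x - frechet_derivative f (at x) d) / norm d) \<midarrow>0\<rightarrow> 0"
      using fd by (simp add: has_derivative_at)
    moreover have "filterlim (\<lambda>k. h k *\<^sub>R b) (at 0) sequentially"
      using tendsto_scaleR[OF h0 tendsto_const[of b]] h b
      by (intro filterlim_atI) (auto simp: nonzero_Basis less_imp_neq[symmetric] intro!: always_eventually)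
    ultimately have "(\<lambda>k. norm (f (x + h k *\<^sub>R b) - f x - frechet_derivative f (at x) (h k *\<^sub>R b)) / norm (h k *\<^sub>R b)) \<longlonglongrightarrow> 0"
      by (rule filterlim_compose)
    moreover have "norm (f (x + h k *\<^sub>R b) - f x - frechet_derivative f (at x) (h k *\<^sub>R b)) / norm (h k *\<^sub>R b)
        = norm ((f (h k *\<^sub>R b + x) - f x) / complex_of_real (h k) - partial b f x)" for k
    proof -
      have "(f (h k *\<^sub>R b + x) - f x) / complex_of_real (h k) - partial b f x
          = (f (x + h k *\<^sub>R b) - f x - frechet_derivative f (at x) (h k *\<^sub>R b)) / complex_of_real (h k)"
        using h[of k] by (simp add: linear_scale[OF lin] partial_def scaleR_conv_of_real field_simps add.commute)
      then show ?thesis using h[of k] b by (simp add: norm_divide)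
    qed
    ultimately have "(\<lambda>k. (f (h k *\<^sub>R b + x) - f x) / complex_of_real (h k)) \<longlonglongrightarrow> partial b f x"
      by (simp add: LIM_zero_cancel tendsto_norm_zero_iff)
    then show ?thesis unfolding s_def by (intro tendsto_mult tendsto_const)
  qed
  have lim1: "(\<lambda>k. LINT x|lborel. s k x) \<longlonglongrightarrow> (LINT x|lborel. partial b f x * character (- \<xi>) x)"
    by (rule integral_dominated_convergence[where w = "\<lambda>x. C' * weight x"])
      (use integrable_weight lim bound in \<open>auto simp: s_def\<close>)
  have eq: "(LINT x|lborel. s k x)
      = fourier f \<xi> * ((exp (complex_of_real (h k) * (2 * pi * \<i> * complex_of_real (\<xi> \<bullet> b))) - 1) / complex_of_real (h k))" for k
  proof -
    have "(LINT x|lborel. s k x) = (LINT x|lborel. (f (h k *\<^sub>R b + x) * character (- \<xi>) x - f (0 + x) * character (- \<xi>) x) / complex_of_real (h k))"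
      by (simp add: s_def algebra_simps diff_divide_distrib)
    also have "\<dots> = ((LINT x|lborel. f (h k *\<^sub>R b + x) * character (- \<xi>) x) - (LINT x|lborel. f (0 + x) * character (- \<xi>) x)) / complex_of_real (h k)"
      by (subst Bochner_Integration.integral_diff[OF int_f int_f, symmetric]) simp
    also have "(LINT x|lborel. f (h k *\<^sub>R b + x) * character (- \<xi>) x) = character \<xi> (h k *\<^sub>R b) * fourier f \<xi>"
      by (subst fourier_shift[symmetric]) (auto simp: fourier_eq add.commute)
    also have "character \<xi> (h k *\<^sub>R b) = exp (complex_of_real (h k) * (2 * pi * \<i> * complex_of_real (\<xi> \<bullet> b)))"
      by (simp add: character_def inner_commute[of b] mult_ac)
    finally show ?thesis by (simp add: fourier_eq[symmetric] field_simps)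
  qed
  have lim2: "(\<lambda>k. fourier f \<xi> * ((exp (complex_of_real (h k) * z) - 1) / complex_of_real (h k))) \<longlonglongrightarrow> fourier f \<xi> * z" for z :: complex
  proof -
    have "((\<lambda>w. exp (w * z)) has_field_derivative z) (at 0)"
      by (auto intro!: derivative_eq_intros)
    then have "(\<lambda>w. (exp (w * z) - 1) / w) \<midarrow>0\<rightarrow> z"
      by (simp add: has_field_derivative_iff)
    moreover have "filterlim (\<lambda>k. complex_of_real (h k)) (at 0) sequentially"
      using tendsto_of_real[OF h0, where 'a = complex] h
      by (intro filterlim_atI) (auto simp: less_imp_neq[symmetric] intro!: always_eventually)
    ultimately have "(\<lambda>k. (exp (complex_of_real (h k) * z) - 1) / complex_of_real (h k)) \<longlonglongrightarrow> z"
      by (rule filterlim_compose)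
    then show ?thesis by (intro tendsto_mult tendsto_const)
  qed
  show ?thesis
    unfolding fourier_eq[of "partial b f"]
    using LIMSEQ_unique[OF lim1[unfolded eq] lim2] by (simp add: mult_ac)
qed

text \<open>Each factor \<open>1 + \<xi>\<^sub>b\<^sup>2\<close> of the reciprocal weight is absorbed by two derivatives in direction \<open>b\<close>;
  hence the induction over sets of directions, for all Schwartz functions simultaneously.\<close>

lemma fourier_weight_bounded:
  fixes f :: "'a::euclidean_space \<Rightarrow> complex"
  assumes "schwartz f" shows "weight_bounded (fourier f)"
proof -
  have "\<exists>C. \<forall>\<xi>. (\<Prod>b\<in>S. 1 + (\<xi> \<bullet> b)\<^sup>2) * norm (fourier f \<xi>) \<le> C"
    if "finite S" "S \<subseteq> Basis" "schwartz f" for S :: "'a set" and f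
    using that
  proof (induction S arbitrary: f)
    case empty
    have "norm (fourier f \<xi>) \<le> (LINT x|lborel. norm (f x))" for \<xi>
      unfolding fourier_eq by (rule order_trans[OF integral_norm_bound]) (simp add: norm_mult)
    then show ?case by auto
  next
    case (insert b S)
    then have b: "b \<in> Basis" and S: "S \<subseteq> Basis" by auto
    let ?g = "partial b (partial b f)"
    have g: "schwartz ?g" using insert.prems b by (simp add: schwartz_partial)
    obtain C1 where C1: "\<And>\<xi>. (\<Prod>b\<in>S. 1 + (\<xi> \<bullet> b)\<^sup>2) * norm (fourier f \<xi>) \<le> C1"
      using insert.IH[OF S insert.prems(2)] by blast
    obtain C2 where C2: "\<And>\<xi>. (\<Prod>b\<in>S. 1 + (\<xi> \<bullet> b)\<^sup>2) * norm (fourier ?g \<xi>) \<le> C2"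
      using insert.IH[OF S g] by blast
    have "(\<Prod>b\<in>insert b S. 1 + (\<xi> \<bullet> b)\<^sup>2) * norm (fourier f \<xi>) \<le> C1 + C2" for \<xi>
    proof -
      let ?P = "\<Prod>b\<in>S. 1 + (\<xi> \<bullet> b)\<^sup>2"
      have P: "?P \<ge> 0" by (intro prod_nonneg) auto
      have "norm (fourier ?g \<xi>) = (2 * pi)\<^sup>2 * ((\<xi> \<bullet> b)\<^sup>2 * norm (fourier f \<xi>))"
        using insert.prems b
        by (simp add: fourier_partial schwartz_partial norm_mult power2_eq_square)
      moreover have "1 * ((\<xi> \<bullet> b)\<^sup>2 * norm (fourier f \<xi>)) \<le> (2 * pi)\<^sup>2 * ((\<xi> \<bullet> b)\<^sup>2 * norm (fourier f \<xi>))"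
        using pi_ge_two by (intro mult_right_mono one_le_power) auto
      ultimately have "(1 + (\<xi> \<bullet> b)\<^sup>2) * norm (fourier f \<xi>) \<le> norm (fourier f \<xi>) + norm (fourier ?g \<xi>)"
        by (simp add: algebra_simps)
      from mult_left_mono[OF this P] C1[of \<xi>] C2[of \<xi>] insert.hyps
      show ?thesis by (simp add: algebra_simps)
    qed
    then show ?case by blast
  qed
  from this[OF finite_Basis subset_refl assms]
  obtain C where C: "\<And>\<xi>. (\<Prod>b\<in>Basis. 1 + (\<xi> \<bullet> b)\<^sup>2) * norm (fourier f \<xi>) \<le> C" by blast
  have "norm (fourier f \<xi>) \<le> C * weight \<xi>" for \<xi>
  proof -
    have "(\<Prod>b\<in>Basis. 1 + (\<xi> \<bullet> b)\<^sup>2) > 0" by (intro prod_pos) auto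
    then show ?thesis using C[of \<xi>] by (simp add: weight_def prod_dividef field_simps)
  qed
  then show ?thesis unfolding weight_bounded_def by blast
qed


section \<open>The dual lattice\<close>

context lattice_coords
begin

lemma dual_lattice_iff: "\<xi> \<in> dual_lattice \<Lambda> \<longleftrightarrow> (\<forall>b\<in>B. \<xi> \<bullet> b \<in> \<int>)"
proof
  assume "\<xi> \<in> dual_lattice \<Lambda>"
  then show "\<forall>b\<in>B. \<xi> \<bullet> b \<in> \<int>" using basis_subset by (auto simp: dual_lattice_def)
next
  assume *: "\<forall>b\<in>B. \<xi> \<bullet> b \<in> \<int>"
  have "\<xi> \<bullet> x \<in> \<int>" if "x \<in> \<Lambda>" for x
    unfolding inner_expand[of \<xi> x]
    by (intro Ints_sum Ints_mult) (use * that in \<open>auto simp: lattice_iff\<close>)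
  then show "\<xi> \<in> dual_lattice \<Lambda>" by (simp add: dual_lattice_def)
qed

lemma D_mem_dual: "b \<in> B \<Longrightarrow> D b \<in> dual_lattice \<Lambda>"
  by (auto simp: dual_lattice_iff dual)

lemma inj_on_D: "inj_on D B"
  by (rule inj_onI) (metis dual zero_neq_one)

lemma dual_expand: "x = (\<Sum>b\<in>B. (x \<bullet> b) *\<^sub>R D b)"
proof -
  have "(x - (\<Sum>b\<in>B. (x \<bullet> b) *\<^sub>R D b)) \<bullet> y = 0" for y
  proof -
    have "(\<Sum>b\<in>B. (x \<bullet> b) *\<^sub>R D b) \<bullet> y = x \<bullet> y"
      by (simp add: inner_sum_left inner_expand[of x y])
    then show ?thesis by (simp add: inner_diff_left)
  qed
  from this[of "x - (\<Sum>b\<in>B. (x \<bullet> b) *\<^sub>R D b)"] show ?thesis by (simp only: inner_eq_zero_iff right_minus_eq)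
qed

text \<open>The vectors \<open>D b\<close> form the dual basis, so every statement about lattices in coordinates applies
  to the dual lattice as well.\<close>

lemma dual_coords: "lattice_coords (D ` B) (the_inv_into B D) (dual_lattice \<Lambda>)"
proof
  have span: "span (D ` B) = UNIV"
  proof -
    have "x \<in> span (D ` B)" for x
      by (subst dual_expand) (intro span_sum span_scale span_base imageI)
    then show ?thesis by auto
  qed
  have "card (D ` B) = card B" by (rule card_image[OF inj_on_D])
  also have "\<dots> = dim (UNIV :: 'a set)"
    using basis by (metis basis_card_eq_dim lattice_basis_def top_greatest)
  finally have card: "card (D ` B) = dim (UNIV :: 'a set)" .
  have ind: "independent (D ` B)"
    by (rule card_le_dim_spanning[where V = UNIV]) (use span card finite_B in auto)
  have "dual_lattice \<Lambda> = {(\<Sum>d\<in>D ` B. of_int (c d) *\<^sub>R d) | c :: 'a \<Rightarrow> int. True}" (is "_ = ?R")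
  proof
    show "dual_lattice \<Lambda> \<subseteq> ?R"
    proof
      fix x assume "x \<in> dual_lattice \<Lambda>"
      then have *: "\<And>b. b \<in> B \<Longrightarrow> of_int \<lfloor>x \<bullet> b\<rfloor> = x \<bullet> b" by (simp add: dual_lattice_iff of_int_floor)
      have "x = (\<Sum>d\<in>D ` B. of_int \<lfloor>x \<bullet> the_inv_into B D d\<rfloor> *\<^sub>R d)"
        by (subst (1) dual_expand) (simp add: sum.reindex[OF inj_on_D] the_inv_into_f_f[OF inj_on_D] *)
      then show "x \<in> ?R" by (intro CollectI exI[of _ "\<lambda>d. \<lfloor>x \<bullet> the_inv_into B D d\<rfloor>"] conjI TrueI)
    qed
    have "(\<Sum>b\<in>B. real_of_int (c (D b)) *\<^sub>R D b) \<bullet> b' \<in> \<int>" if "b' \<in> B" for c b'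
      using that by (auto simp: inner_sum_left dual intro!: Ints_sum)
    then show "?R \<subseteq> dual_lattice \<Lambda>"
      by (auto simp: sum.reindex[OF inj_on_D] dual_lattice_iff)
  qed
  with ind span show "lattice_basis (D ` B) (dual_lattice \<Lambda>)"
    by (simp add: lattice_basis_def)
  fix b b' assume "b \<in> D ` B" "b' \<in> D ` B"
  then obtain a a' where a: "a \<in> B" "b = D a" "a' \<in> B" "b' = D a'" by auto
  then show "the_inv_into B D b \<bullet> b' = (if b = b' then 1 else 0)"
    using dual[of a' a] inj_on_D by (auto simp: the_inv_into_f_f[OF inj_on_D] inner_commute[of a] inj_on_def)
qed

lemma dual_dual: "dual_lattice (dual_lattice \<Lambda>) = \<Lambda>"
  using lattice_coords.dual_lattice_iff[OF dual_coords] lattice_iff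
  by (auto simp: inner_commute)

lemma dual_add: "x \<in> dual_lattice \<Lambda> \<Longrightarrow> y \<in> dual_lattice \<Lambda> \<Longrightarrow> x + y \<in> dual_lattice \<Lambda>"
  and dual_minus: "x \<in> dual_lattice \<Lambda> \<Longrightarrow> - x \<in> dual_lattice \<Lambda>"
  by (auto simp: dual_lattice_iff inner_add_left)

lemma character_period: "\<xi> \<in> dual_lattice \<Lambda> \<Longrightarrow> l \<in> \<Lambda> \<Longrightarrow> character \<xi> (x + l) = character \<xi> x"
  using character_eq_1_iff[of \<xi> l] by (simp add: character_add dual_lattice_def inner_commute[of l])

end

section \<open>Fourier series of periodic functions\<close>

lemma infsum_eq_suminf:
  fixes f :: "'i \<Rightarrow> complex"
  assumes I: "countable I" "infinite I" and sum: "(\<lambda>i. norm (f i)) summable_on I"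
  shows "summable (\<lambda>n. norm (f (from_nat_into I n)))"
    and "(\<Sum>\<^sub>\<infinity>i\<in>I. f i) = (\<Sum>n. f (from_nat_into I n))"
proof -
  note bij = bij_betw_from_nat_into[OF I]
  have "(\<lambda>n. norm (f (from_nat_into I n))) summable_on UNIV"
    using sum summable_on_reindex_bij_betw[OF bij, of "\<lambda>i. norm (f i)"] by simp
  then show "summable (\<lambda>n. norm (f (from_nat_into I n)))" by (rule summable_on_imp_summable)
  have "(f has_sum infsum f I) I" using abs_summable_summable[OF sum] by (rule has_sum_infsum)
  then have "((\<lambda>n. f (from_nat_into I n)) has_sum infsum f I) UNIV"
    using has_sum_reindex_bij_betw[OF bij, of f] by simp
  from has_sum_imp_sums[OF this] show "(\<Sum>\<^sub>\<infinity>i\<in>I. f i) = (\<Sum>n. f (from_nat_into I n))"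
    by (simp add: sums_iff)
qed

lemma integral_infsum:
  fixes \<phi> :: "'i \<Rightarrow> 'b \<Rightarrow> complex"
  assumes I: "countable I" "infinite I" and fin: "finite_measure N"
    and int: "\<And>i. i \<in> I \<Longrightarrow> integrable N (\<phi> i)"
    and bd: "\<And>i x. i \<in> I \<Longrightarrow> x \<in> space N \<Longrightarrow> norm (\<phi> i x) \<le> M i"
    and M: "M summable_on I"
  shows "(LINT x|N. (\<Sum>\<^sub>\<infinity>i\<in>I. \<phi> i x)) = (\<Sum>\<^sub>\<infinity>i\<in>I. LINT x|N. \<phi> i x)"
proof -
  interpret finite_measure N by fact
  let ?e = "from_nat_into I"
  have eI: "?e n \<in> I" for n using I by (simp add: from_nat_into infinite_imp_nonempty)
  have abs: "(\<lambda>i. norm (\<phi> i x)) summable_on I" if "x \<in> space N" for x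
    by (rule Infinite_Sum.abs_summable_on_comparison_test'[OF M bd]) (use that in auto)
  have le: "(LINT x|N. norm (\<phi> i x)) \<le> measure N (space N) * M i" if "i \<in> I" for i
  proof -
    have "(LINT x|N. norm (\<phi> i x)) \<le> (LINT x|N. M i)"
      using int[OF that] bd[OF that] by (intro integral_mono) auto
    then show ?thesis by simp
  qed
  have abs2: "(\<lambda>i. norm (LINT x|N. \<phi> i x)) summable_on I"
    by (rule Infinite_Sum.abs_summable_on_comparison_test'[OF summable_on_cmult_right[OF M]])
      (rule order_trans[OF integral_norm_bound le])
  have Ms: "summable (\<lambda>n. M (?e n))"
    using M summable_on_reindex_bij_betw[OF bij_betw_from_nat_into[OF I], of M]
    by (intro summable_on_imp_summable) simp
  have "(LINT x|N. (\<Sum>\<^sub>\<infinity>i\<in>I. \<phi> i x)) = (LINT x|N. (\<Sum>n. \<phi> (?e n) x))"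
    by (rule Bochner_Integration.integral_cong) (simp_all add: infsum_eq_suminf(2)[OF I abs])
  also have "\<dots> = (\<Sum>n. LINT x|N. \<phi> (?e n) x)"
  proof (rule integral_suminf)
    show "AE x in N. summable (\<lambda>n. norm (\<phi> (?e n) x))"
      by (rule AE_I2) (rule infsum_eq_suminf(1)[OF I abs])
    show "summable (\<lambda>n. LINT x|N. norm (\<phi> (?e n) x))"
      by (rule summable_comparison_test'[OF summable_mult[OF Ms, of "measure N (space N)"], of 0])
        (use le[OF eI] in auto)
  qed (use int eI in auto)
  also have "\<dots> = (\<Sum>\<^sub>\<infinity>i\<in>I. LINT x|N. \<phi> i x)"
    by (rule infsum_eq_suminf(2)[OF I abs2, symmetric])
  finally show ?thesis .
qed

lemma continuous_infsum:
  fixes \<phi> :: "'i \<Rightarrow> 'a::euclidean_space \<Rightarrow> complex"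
  assumes cont: "\<And>i. i \<in> I \<Longrightarrow> continuous_on UNIV (\<phi> i)"
    and bd: "\<And>R. \<exists>M. M summable_on I \<and> (\<forall>i\<in>I. \<forall>x. norm x \<le> R \<longrightarrow> norm (\<phi> i x) \<le> M i)"
  shows "continuous_on UNIV (\<lambda>x. \<Sum>\<^sub>\<infinity>i\<in>I. \<phi> i x)"
proof -
  have "continuous_on (cball 0 R) (\<lambda>x. \<Sum>\<^sub>\<infinity>i\<in>I. \<phi> i x)" for R
  proof -
    obtain M where M: "M summable_on I" "\<And>i x. i \<in> I \<Longrightarrow> norm x \<le> R \<Longrightarrow> norm (\<phi> i x) \<le> M i"
      using bd[of R] by blast
    have "uniform_limit (cball 0 R) (\<lambda>S x. \<Sum>i\<in>S. \<phi> i x) (\<lambda>x. \<Sum>\<^sub>\<infinity>i\<in>I. \<phi> i x) (finite_subsets_at_top I)"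
      by (rule Weierstrass_m_test_general[OF _ M(1)]) (use M(2) in auto)
    moreover have "\<forall>\<^sub>F S in finite_subsets_at_top I. continuous_on (cball 0 R) (\<lambda>x. \<Sum>i\<in>S. \<phi> i x)"
      by (rule eventually_finite_subsets_at_top_weakI)
        (auto intro!: continuous_on_sum continuous_on_subset[OF cont])
    ultimately show ?thesis
      by (intro uniform_limit_theorem[of _ _ "finite_subsets_at_top I"]) auto
  qed
  then have cont_cball: "continuous_on (cball 0 R) (\<lambda>x. \<Sum>\<^sub>\<infinity>i\<in>I. \<phi> i x)" for R .
  have "continuous (at x) (\<lambda>x. \<Sum>\<^sub>\<infinity>i\<in>I. \<phi> i x)" for x
  proof -
    have "continuous_on (ball 0 (norm x + 1)) (\<lambda>x. \<Sum>\<^sub>\<infinity>i\<in>I. \<phi> i x)"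
      using cont_cball ball_subset_cball by (rule continuous_on_subset)
    moreover have "x \<in> ball 0 (norm x + 1)" by simp
    ultimately show ?thesis by (meson continuous_on_eq_continuous_at open_ball)
  qed
  then show ?thesis by (simp add: continuous_at_imp_continuous_on)
qed

context lattice_coords
begin

definition fund_measure :: "'a measure" where
  "fund_measure = restrict_space lborel F"

lemma space_fund_measure [simp]: "space fund_measure = F"
  by (simp add: fund_measure_def space_restrict_space)

lemma emeasure_fund_measure: "emeasure fund_measure (space fund_measure) = ennreal vol"
  by (simp add: fund_measure_def emeasure_restrict_space space_restrict_space emeasure_fund)

lemma finite_fund_measure: "finite_measure fund_measure"
  by (rule finite_measureI) (simp only: emeasure_fund_measure, simp)

lemma measure_fund_measure: "measure fund_measure F = vol"
  using emeasure_fund_measure vol_pos by (simp add: measure_def)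

lemma integral_fund_measure:
  "(LINT x|fund_measure. (f x :: complex)) = (LINT x|lborel. indicator F x *\<^sub>R f x)"
  unfolding fund_measure_def by (rule integral_restrict_space) auto

lemma measurable_fund_measure: "f \<in> borel_measurable borel \<Longrightarrow> f \<in> borel_measurable fund_measure"
  unfolding fund_measure_def by (rule measurable_restrict_space1) simp

lemma integrable_fund_measure_bounded:
  fixes f :: "'a \<Rightarrow> complex"
  assumes "f \<in> borel_measurable borel" "\<And>x. x \<in> F \<Longrightarrow> norm (f x) \<le> C"
  shows "integrable fund_measure f"
proof -
  interpret finite_measure fund_measure by (rule finite_fund_measure)
  show ?thesis
    by (rule integrable_const_bound[of _ C])
      (use assms in \<open>auto intro!: measurable_fund_measure AE_I2\<close>)
qed

lemma continuous_bounded_fund: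
  assumes "continuous_on UNIV (f :: 'a \<Rightarrow> 'b::real_normed_vector)"
  obtains C where "\<And>x. x \<in> closed_fund \<Longrightarrow> norm (f x) \<le> C"
proof -
  have "compact (f ` closed_fund)"
    using assms by (intro compact_continuous_image compact_closed_fund) (rule continuous_on_subset, auto)
  then have "bounded (f ` closed_fund)" by (rule compact_imp_bounded)
  then show ?thesis using that by (auto simp: bounded_iff)
qed

lemma integrable_fund_measure:
  fixes f :: "'a \<Rightarrow> complex"
  assumes "continuous_on UNIV f"
  shows "integrable fund_measure f"
proof -
  obtain C where "\<And>x. x \<in> closed_fund \<Longrightarrow> norm (f x) \<le> C" using continuous_bounded_fund[OF assms] by blast
  then show ?thesis
    using fund_subset_closed assms
    by (intro integrable_fund_measure_bounded[of _ C]) (auto intro: borel_measurable_continuous_onI)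
qed

lemma norm_fund: "y \<in> F \<Longrightarrow> norm y \<le> (\<Sum>b\<in>B. norm b)"
  using fund_subset_closed norm_closed_fund by blast

lemma weight_bounded_translates:
  assumes "weight_bounded G"
  shows "\<exists>M. M summable_on \<Lambda> \<and> (\<forall>l\<in>\<Lambda>. \<forall>x. norm x \<le> R \<longrightarrow> norm (G (x + l)) \<le> M l)"
proof -
  obtain C where C0: "C \<ge> 0" and C: "\<And>x. norm (G x) \<le> C * weight x" using weight_bounded_nonneg[OF assms] by auto
  let ?K = "C * (2 * (1 + R\<^sup>2)) ^ DIM('a)"
  have "norm (G (x + l)) \<le> ?K * weight l" if "norm x \<le> R" for x l
    using C[of "x + l"] mult_left_mono[OF weight_shift_le[OF that, of l] C0]
    by (simp add: add.commute mult.assoc)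
  then show ?thesis
    by (intro exI[of _ "\<lambda>l. ?K * weight l"] conjI summable_on_cmult_right weight_summable) auto
qed

text \<open>Unfolding: the integral over the space is the integral over one period of the periodization.\<close>

lemma integral_tiling:
  fixes G :: "'a \<Rightarrow> complex"
  assumes G: "weight_bounded G" and [measurable]: "G \<in> borel_measurable borel"
  shows "(LINT y|fund_measure. (\<Sum>\<^sub>\<infinity>l\<in>\<Lambda>. G (y + l))) = (LINT x|lborel. G x)"
proof -
  let ?e = "from_nat_into \<Lambda>"
  define A where "A l = {x. x - l \<in> F}" for l
  have eI: "?e n \<in> \<Lambda>" for n by (simp add: from_nat_into infinite_imp_nonempty infinite_lattice)
  have einj: "?e n = ?e m \<Longrightarrow> n = m" for n m
    using bij_betw_from_nat_into[OF countable_lattice infinite_lattice] by (auto simp: bij_betw_def inj_on_def)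
  have [measurable]: "A l \<in> sets borel" for l
    unfolding A_def by measurable
  obtain M where M: "M summable_on \<Lambda>" "\<And>l y. l \<in> \<Lambda> \<Longrightarrow> norm y \<le> (\<Sum>b\<in>B. norm b) \<Longrightarrow> norm (G (y + l)) \<le> M l"
    using weight_bounded_translates[OF G, of "\<Sum>b\<in>B. norm b"] by blast
  have int_eq: "(LINT y|fund_measure. G (y + l)) = (LINT x:A l|lborel. G x)" for l
  proof -
    have "(LINT x:A l|lborel. G x) = (LINT y|lborel. indicator (A l) (l + y) *\<^sub>R G (l + y))"
      unfolding set_lebesgue_integral_def by (rule integral_lborel_shift[symmetric]) measurable
    also have "\<dots> = (LINT y|fund_measure. G (y + l))"
      unfolding integral_fund_measure by (simp add: A_def indicator_def add.commute)
    finally show ?thesis ..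
  qed
  have UN: "(\<Union>n. A (?e n)) = UNIV"
  proof -
    have "x \<in> (\<Union>n. A (?e n))" for x
    proof -
      obtain n where "?e n = lat_floor x"
        using bij_betw_from_nat_into[OF countable_lattice infinite_lattice] lat_floor_mem[of x]
        by (metis bij_betw_def imageE)
      then show ?thesis using diff_fund_iff[OF lat_floor_mem, of x x] by (auto simp: A_def intro!: exI[of _ n])
    qed
    then show ?thesis by auto
  qed
  have Gint: "integrable lborel G" by (rule weight_bounded_integrable[OF G]) measurable
  have "(LINT x|lborel. G x) = (LINT x:(\<Union>n. A (?e n))|lborel. G x)"
    by (simp add: UN set_lebesgue_integral_def)
  also have "\<dots> = (\<Sum>n. LINT x:A (?e n)|lborel. G x)"
  proof (rule lebesgue_integral_countable_add)
    fix i j :: nat assume "i \<noteq> j"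
    then show "A (?e i) \<inter> A (?e j) = {}"
      using diff_fund_iff[OF eI] einj by (auto simp: A_def)
  qed (use Gint in \<open>auto simp: UN set_integrable_def\<close>)
  also have "\<dots> = (\<Sum>n. LINT y|fund_measure. G (y + ?e n))" by (simp add: int_eq)
  also have "\<dots> = (\<Sum>\<^sub>\<infinity>l\<in>\<Lambda>. LINT y|fund_measure. G (y + l))"
  proof (rule infsum_eq_suminf(2)[OF countable_lattice infinite_lattice, symmetric])
    interpret finite_measure fund_measure by (rule finite_fund_measure)
    show "(\<lambda>l. norm (LINT y|fund_measure. G (y + l))) summable_on \<Lambda>"
    proof (rule Infinite_Sum.abs_summable_on_comparison_test'[OF summable_on_cmult_right[OF M(1), of vol]])
      fix l assume l: "l \<in> \<Lambda>"
      have "integrable fund_measure (\<lambda>y. G (y + l))"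
        using M(2)[OF l norm_fund] by (intro integrable_fund_measure_bounded[of _ "M l"]) auto
      then have "(LINT y|fund_measure. norm (G (y + l))) \<le> (LINT y|fund_measure. M l)"
        using M(2)[OF l norm_fund] by (intro integral_mono) auto
      with integral_norm_bound[of fund_measure "\<lambda>y. G (y + l)"]
      have "norm (LINT y|fund_measure. G (y + l)) \<le> (LINT y|fund_measure. M l)" by linarith
      then show "norm (LINT y|fund_measure. G (y + l)) \<le> vol * M l"
        by (simp add: measure_fund_measure)
    qed
  qed
  also have "\<dots> = (LINT y|fund_measure. (\<Sum>\<^sub>\<infinity>l\<in>\<Lambda>. G (y + l)))"
  proof (rule integral_infsum[OF countable_lattice infinite_lattice finite_fund_measure _ _ M(1), symmetric])
    fix l assume "l \<in> \<Lambda>"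
    then show "integrable fund_measure (\<lambda>y. G (y + l))"
      using M(2) norm_fund by (intro integrable_fund_measure_bounded[of _ "M l"]) auto
  qed (use M(2) norm_fund in auto)
  finally show ?thesis ..
qed

text \<open>A shift \<open>s\<close> of the domain multiplies the integral by the character value at \<open>s\<close>, but leaves it
  unchanged by unfolding; for a nonzero frequency \<open>s\<close> is chosen with value \<open>-1\<close>.\<close>

lemma integral_character:
  assumes xi: "\<xi> \<in> dual_lattice \<Lambda>"
  shows "(LINT y|fund_measure. character \<xi> y) = (if \<xi> = 0 then complex_of_real vol else 0)"
proof (cases "\<xi> = 0")
  case True
  then show ?thesis by (simp add: measure_fund_measure scaleR_conv_of_real)
next
  case False
  \<comment> \<open>chosen so that the character takes the value \<open>-1\<close> at \<open>s\<close>\<close>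
  define s where "s = (1 / (2 * (\<xi> \<bullet> \<xi>))) *\<^sub>R \<xi>"
  have "s \<bullet> \<xi> = 1 / 2" using False by (simp add: s_def)
  then have ne: "character \<xi> s \<noteq> 1"
  proof -
    have "(1 / 2 :: real) \<notin> \<int>"
    proof
      assume "(1 / 2 :: real) \<in> \<int>"
      then obtain k :: int where "1 / 2 = real_of_int k" by (auto elim: Ints_cases)
      then have "real_of_int (2 * k) = real_of_int 1" by simp
      then have "2 * k = 1" by (simp only: of_int_eq_iff)
      then show False by presburger
    qed
    then show ?thesis using \<open>s \<bullet> \<xi> = 1 / 2\<close> character_eq_1_iff by metis
  qed
  define G where "G x = indicator F (x - s) *\<^sub>R character \<xi> x" for x
  have [measurable]: "G \<in> borel_measurable borel" unfolding G_def by measurable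
  have "weight_bounded G"
  proof -
    define R where "R = (\<Sum>b\<in>B. norm b) + norm s"
    have "norm (G x) \<le> (2 * (1 + R\<^sup>2)) ^ DIM('a) * weight x" for x
    proof (cases "x - s \<in> F")
      case True
      then have "norm x \<le> R" using norm_fund[OF True] norm_triangle_ineq[of "x - s" s] by (simp add: R_def)
      from weight_translate_le[OF this, of 0] True show ?thesis by (simp add: G_def weight_def)
    next
      case False
      then show ?thesis using weight_pos[of x] by (simp add: G_def less_imp_le)
    qed
    then show ?thesis unfolding weight_bounded_def by blast
  qed
  have "character \<xi> s * (LINT y|fund_measure. character \<xi> y) = (LINT y|lborel. G (s + y))"
    unfolding integral_fund_measure by (subst integral_mult_right_zero[symmetric])
      (simp add: G_def character_add scaleR_conv_of_real mult_ac)
  also have "\<dots> = (LINT y|lborel. G y)" by (rule integral_lborel_shift) measurable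
  also have "\<dots> = (LINT y|fund_measure. (\<Sum>\<^sub>\<infinity>l\<in>\<Lambda>. G (y + l)))"
    by (rule integral_tiling[symmetric]) fact+
  also have "\<dots> = (LINT y|fund_measure. character \<xi> y)"
  proof (rule Bochner_Integration.integral_cong[OF refl])
    fix y
    define n where "n = - lat_floor (y - s)"
    have n: "n \<in> \<Lambda>" by (simp add: n_def minus_mem lat_floor_mem)
    have "G (y + l) = (if l = n then character \<xi> y else 0)" if l: "l \<in> \<Lambda>" for l
    proof -
      have "y + l - s \<in> F \<longleftrightarrow> - l = lat_floor (y - s)"
        using diff_fund_iff[OF minus_mem[OF l], of "y - s"] by (simp add: algebra_simps)
      also have "\<dots> \<longleftrightarrow> l = n" unfolding n_def by (metis minus_minus)
      finally have "y + l - s \<in> F \<longleftrightarrow> l = n" .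
      then show ?thesis unfolding G_def character_period[OF xi l] indicator_def by (simp only: if_True if_False split: if_split) simp
    qed
    then have "(\<Sum>\<^sub>\<infinity>l\<in>\<Lambda>. G (y + l)) = (\<Sum>\<^sub>\<infinity>l\<in>{n}. character \<xi> y)"
      using n by (intro infsum_cong_neutral) auto
    then show "(\<Sum>\<^sub>\<infinity>l\<in>\<Lambda>. G (y + l)) = character \<xi> y" by simp
  qed
  finally have "(LINT y|fund_measure. character \<xi> y) = 0" using ne by simp
  then show ?thesis using False by simp
qed

text \<open>The trigonometric polynomial \<open>Q\<close> lies between 0 and 1 and equals 1 in the closed domain only
  at its centre. If \<open>H\<close> did not vanish there, the integrals of \<open>H\<close> against high powers of \<open>Q\<close>, which
  are combinations of Fourier coefficients, could not vanish. The centre, rather than a lattice point,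
  is taken because it is interior to the domain.\<close>

lemma fourier_uniqueness_centre:
  assumes H: "continuous_on UNIV H"
    and coeff: "\<And>\<eta>. \<eta> \<in> dual_lattice \<Lambda> \<Longrightarrow> (LINT t|fund_measure. H t * character \<eta> t) = 0"
  shows "H centre = 0"
proof (rule ccontr)
  assume nz: "H centre \<noteq> 0"
  define q :: "'a \<Rightarrow> 'a \<Rightarrow> real" where "q b t = (1 - cos (2 * pi * (D b \<bullet> t))) / 2" for b t
  define Q where "Q t = (\<Prod>b\<in>B. q b t)" for t
  have q01: "0 \<le> q b t" "q b t \<le> 1" for b t
    using cos_le_one[of "2 * pi * (D b \<bullet> t)"] cos_ge_minus_one[of "2 * pi * (D b \<bullet> t)"]
    by (auto simp: q_def)
  have Q01: "0 \<le> Q t" "Q t \<le> 1" for t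
    by (auto simp: Q_def intro!: prod_nonneg prod_le_1 q01)
  have q_cont: "continuous_on A (q b)" for A b
    unfolding q_def by (intro continuous_intros) auto
  have Q_cont: "continuous_on A Q" for A
    unfolding Q_def by (intro continuous_intros q_cont)
  have q_char: "complex_of_real (q b t) = 1/2 - character (D b) t / 4 - character (- D b) t / 4" for b t
    by (simp add: q_def character_def cos_exp_eq cos_of_real[symmetric] inner_commute[of t] field_simps
         del: cos_of_real) 
  \<comment> \<open>orthogonality to all products of \<open>k\<close> with characters is stable under multiplication by \<open>q b\<close>\<close>
  define K where "K k \<longleftrightarrow> continuous_on UNIV k \<and>
    (\<forall>\<eta>\<in>dual_lattice \<Lambda>. (LINT t|fund_measure. H t * character \<eta> t * complex_of_real (k t)) = 0)" for k :: "'a \<Rightarrow> real"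
  have K1: "K (\<lambda>_. 1)" using coeff by (simp add: K_def)
  have Kq: "K (\<lambda>t. q b t * k t)" if k: "K k" and b: "b \<in> B" for k b
    unfolding K_def
  proof (intro conjI ballI)
    show "continuous_on UNIV (\<lambda>t. q b t * k t)" using k by (intro continuous_intros q_cont) (simp add: K_def)
    fix \<eta> assume eta: "\<eta> \<in> dual_lattice \<Lambda>"
    let ?I = "\<lambda>\<eta>. LINT t|fund_measure. H t * character \<eta> t * complex_of_real (k t)"
    have int: "integrable fund_measure (\<lambda>t. H t * character \<eta> t * complex_of_real (k t))" for \<eta>
      using k by (intro integrable_fund_measure continuous_intros H) (simp add: K_def)
    have "(LINT t|fund_measure. H t * character \<eta> t * complex_of_real (q b t * k t))
       = (LINT t|fund_measure. (1/2) * (H t * character \<eta> t * complex_of_real (k t))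
           - (1/4) * (H t * character (\<eta> + D b) t * complex_of_real (k t))
           - (1/4) * (H t * character (\<eta> + - D b) t * complex_of_real (k t)))"
      by (intro Bochner_Integration.integral_cong refl)
        (simp only: of_real_mult q_char character_freq_add, simp add: algebra_simps)
    also have "\<dots> = (1/2) * ?I \<eta> - (1/4) * ?I (\<eta> + D b) - (1/4) * ?I (\<eta> + - D b)"
      by (simp add: int Bochner_Integration.integral_diff del: add_uminus_conv_diff)
    also have "\<dots> = 0"
      using k eta dual_add[OF eta D_mem_dual[OF b]] dual_add[OF eta dual_minus[OF D_mem_dual[OF b]]]
      by (simp add: K_def)
    finally show "(LINT t|fund_measure. H t * character \<eta> t * complex_of_real (q b t * k t)) = 0" .
  qed
  have KQ: "K (\<lambda>t. Q t * k t)" if "K k" for k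
  proof -
    have "K (\<lambda>t. (\<Prod>b\<in>S. q b t) * k t)" if "finite S" "S \<subseteq> B" for S
      using that
    proof induction
      case empty
      then show ?case using \<open>K k\<close> by simp
    next
      case (insert b S)
      then show ?case using Kq[of "\<lambda>t. (\<Prod>b\<in>S. q b t) * k t" b] by (simp add: mult.assoc)
    qed
    from this[OF finite_B subset_refl] show ?thesis by (simp add: Q_def)
  qed
  have KQn: "K (\<lambda>t. Q t ^ n)" for n
    by (induction n) (simp_all add: K1 KQ)
  \<comment> \<open>a real function, positive at the centre, that is orthogonal to every power of \<open>Q\<close>\<close>
  define g where "g t = Re (cnj (H centre) * H t)" for t
  have g_cont: "continuous_on A g" for A
    unfolding g_def by (intro continuous_intros continuous_on_subset[OF H]) auto
  have gc: "g centre > 0"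
    using nz by (simp add: g_def complex_neq_0 flip: power2_eq_square)
  have int_g: "integrable fund_measure (\<lambda>t. g t * Q t ^ n)" and int_gQ: "(LINT t|fund_measure. g t * Q t ^ n) = 0" for n
  proof -
    have int: "integrable fund_measure (\<lambda>t. cnj (H centre) * (H t * complex_of_real (Q t ^ n)))"
      by (intro integrable_fund_measure continuous_intros H Q_cont)
    have eq: "g t * Q t ^ n = Re (cnj (H centre) * (H t * complex_of_real (Q t ^ n)))" for t
      unfolding g_def by (simp add: mult.assoc[symmetric] del: of_real_power)
    show "integrable fund_measure (\<lambda>t. g t * Q t ^ n)" unfolding eq using int by (rule integrable_Re)
    have "(LINT t|fund_measure. g t * Q t ^ n) = Re (LINT t|fund_measure. cnj (H centre) * (H t * complex_of_real (Q t ^ n)))"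
      unfolding eq by (rule integral_Re[OF int])
    also have "(LINT t|fund_measure. cnj (H centre) * (H t * complex_of_real (Q t ^ n))) = 0"
    proof -
      have "0 \<in> dual_lattice \<Lambda>" by (simp add: dual_lattice_def)
      with KQn[of n] have "(LINT t|fund_measure. H t * complex_of_real (Q t ^ n)) = 0"
        unfolding K_def by (metis (no_types, lifting) Bochner_Integration.integral_cong character_0 mult.right_neutral)
      then show ?thesis by simp
    qed
    finally show "(LINT t|fund_measure. g t * Q t ^ n) = 0" by simp
  qed
  have Q_centre: "Q centre = 1" by (simp add: Q_def q_def D_centre)
  have Q_eq1: "t = centre" if t: "t \<in> closed_fund" "Q t = 1" for t
  proof (rule coords_eqI)
    fix b assume b: "b \<in> B"
    have "Q t = q b t * (\<Prod>b\<in>B - {b}. q b t)" unfolding Q_def by (rule prod.remove[OF finite_B b])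
    also have "\<dots> \<le> q b t * 1" using q01 by (intro mult_left_mono prod_le_1) auto
    finally have "cos (2 * pi * (D b \<bullet> t)) = - 1"
      using t q01[of b t] cos_ge_minus_one[of "2 * pi * (D b \<bullet> t)"] by (simp add: q_def)
    then obtain m :: int where "2 * pi * (D b \<bullet> t) = (2 * real_of_int m + 1) * pi"
      by (auto simp: cos_eq_minus1 algebra_simps)
    then have "pi * (2 * (D b \<bullet> t)) = pi * (2 * real_of_int m + 1)" by (simp add: algebra_simps)
    then have *: "2 * (D b \<bullet> t) = 2 * real_of_int m + 1" by (subst (asm) mult_cancel_left) simp
    moreover have "0 \<le> D b \<bullet> t" "D b \<bullet> t \<le> 1" using t b by (auto simp: closed_fund_def)
    ultimately have "m = 0" by linarith
    then show "D b \<bullet> t = D b \<bullet> centre" using * b by (simp add: D_centre)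
  qed
  define A where "A = closed_fund \<inter> {t. g t \<le> g centre / 2}"
  have "closed {t. g t \<le> g centre / 2}" by (intro closed_Collect_le g_cont continuous_intros)
  then have compA: "compact A" unfolding A_def by (rule compact_Int_closed[OF compact_closed_fund])
  obtain \<rho> where rho: "0 \<le> \<rho>" "\<rho> < 1" "\<And>t. t \<in> A \<Longrightarrow> Q t \<le> \<rho>"
  proof (cases "A = {}")
    case True
    then show ?thesis using that[of 0] by simp
  next
    case False
    obtain t0 where t0: "t0 \<in> A" "\<And>t. t \<in> A \<Longrightarrow> Q t \<le> Q t0"
      using continuous_attains_sup[OF compA False Q_cont] by blast
    have "Q t0 \<noteq> 1" using Q_eq1[of t0] t0(1) gc by (auto simp: A_def)
    then show ?thesis using that[of "Q t0"] t0 Q01[of t0] by force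
  qed
  \<comment> \<open>any bound strictly between \<open>\<rho>\<close>, where \<open>g\<close> may be negative, and 1, the value at the centre\<close>
  define \<sigma> where "\<sigma> = (1 + \<rho>) / 2"
  have sigma: "\<sigma> > 0" "\<rho> < \<sigma>" "\<sigma> < 1" using rho by (auto simp: \<sigma>_def)
  define S where "S = {x. \<forall>b\<in>B. 0 < D b \<bullet> x \<and> D b \<bullet> x < 1} \<inter> ({t. g centre / 2 < g t} \<inter> {t. \<sigma> < Q t})"
  have openS: "open S" unfolding S_def
    by (intro open_Int open_fund open_Collect_less continuous_intros g_cont Q_cont)
  have "centre \<in> S" using gc sigma by (simp add: S_def D_centre Q_centre)
  have SF: "S \<subseteq> F" by (auto simp: S_def fund_iff less_imp_le)
  have mS: "measure fund_measure S > 0"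
  proof -
    have "emeasure fund_measure S = emeasure lborel S"
      unfolding fund_measure_def using SF openS by (intro emeasure_restrict_space) auto
    moreover have "emeasure lborel S > 0" by (rule emeasure_open_pos[OF openS \<open>centre \<in> S\<close>])
    moreover have "emeasure fund_measure S < \<infinity>"
      using finite_measure.emeasure_finite[OF finite_fund_measure, of S] by (simp add: less_top)
    ultimately show ?thesis by (simp add: measure_def enn2real_positive_iff)
  qed
  obtain M where M: "\<And>x. x \<in> closed_fund \<Longrightarrow> norm (g x) \<le> M" using continuous_bounded_fund[OF g_cont] by blast
  have M0: "M \<ge> 0" using M[of centre] by (force simp: closed_fund_def D_centre)
  have Ssets: "S \<in> sets fund_measure"
    unfolding fund_measure_def using openS SF by (auto simp: sets_restrict_space_iff)
  have key: "g centre / 2 * measure fund_measure S * \<sigma> ^ n \<le> M * vol * \<rho> ^ n" for n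
  proof -
    have low: "g centre / 2 * \<sigma> ^ n * indicator S t - M * \<rho> ^ n \<le> g t * Q t ^ n" if t: "t \<in> F" for t
    proof (cases "t \<in> A")
      case True
      then have "t \<notin> S" by (auto simp: A_def S_def)
      have "\<bar>g t\<bar> * Q t ^ n \<le> M * \<rho> ^ n"
        using M[of t] rho(3)[OF True] Q01[of t] fund_subset_closed t M0
        by (intro mult_mono power_mono) auto
      moreover have "- (g t * Q t ^ n) \<le> \<bar>g t\<bar> * Q t ^ n"
        using mult_right_mono[OF abs_ge_minus_self[of "g t"], of "Q t ^ n"] Q01[of t] by simp
      ultimately show ?thesis using \<open>t \<notin> S\<close> by simp
    next
      case False
      then have gt: "g t > g centre / 2" using t fund_subset_closed by (auto simp: A_def)
      have "g centre / 2 * \<sigma> ^ n * indicator S t \<le> g t * Q t ^ n"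
      proof (cases "t \<in> S")
        case True
        then have "g centre / 2 * \<sigma> ^ n \<le> g t * Q t ^ n"
          using gt gc sigma by (intro mult_mono power_mono) (auto simp: S_def)
        then show ?thesis using True by simp
      next
        case False
        then show ?thesis using gt gc Q01[of t] by simp
      qed
      moreover have "M * \<rho> ^ n \<ge> 0" using M0 rho by simp
      ultimately show ?thesis by linarith
    qed
    interpret finite_measure fund_measure by (rule finite_fund_measure)
    have intS: "integrable fund_measure (\<lambda>t. g centre / 2 * \<sigma> ^ n * indicator S t :: real)"
    proof (intro integrable_mult_right integrable_real_indicator)
      show "emeasure fund_measure S < \<infinity>" using emeasure_finite[of S] by (metis infinity_ennreal_def less_top)
    qed (use Ssets in simp)
    have "(LINT t|fund_measure. g centre / 2 * \<sigma> ^ n * indicator S t - M * \<rho> ^ n) \<le> (LINT t|fund_measure. g t * Q t ^ n)"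
      by (rule integral_mono) (use low int_g intS in auto)
    then have "g centre / 2 * \<sigma> ^ n * measure fund_measure S - M * \<rho> ^ n * vol \<le> 0"
      using Ssets intS SF
      by (simp add: int_gQ Bochner_Integration.integral_diff measure_fund_measure Int_absorb2 mult_ac)
    then show ?thesis by (simp add: mult_ac)
  qed
  have lim: "(\<lambda>n. M * vol * (\<rho> / \<sigma>) ^ n) \<longlonglongrightarrow> M * vol * 0"
    using rho sigma by (intro tendsto_mult tendsto_const LIMSEQ_power_zero) simp
  have le: "g centre / 2 * measure fund_measure S \<le> M * vol * (\<rho> / \<sigma>) ^ n" for n
    using key[of n] sigma by (simp add: power_divide field_simps)
  have "g centre / 2 * measure fund_measure S \<le> M * vol * 0"
    by (rule LIMSEQ_le_const[OF lim]) (use le in blast)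
  then have "g centre / 2 * measure fund_measure S \<le> 0" by simp
  then show False using gc mS by (simp add: mult_le_0_iff)
qed

text \<open>Both sides are values of continuous functions with the same Fourier coefficients.\<close>

lemma poisson_centre:
  assumes f: "continuous_on UNIV f" "weight_bounded f" and fh: "weight_bounded (fourier f)"
  shows "(\<Sum>\<^sub>\<infinity>l\<in>\<Lambda>. f (centre + l)) = (1 / vol) * (\<Sum>\<^sub>\<infinity>\<xi>\<in>dual_lattice \<Lambda>. fourier f \<xi> * character \<xi> centre)"
proof -
  interpret L': lattice_coords "D ` B" "the_inv_into B D" "dual_lattice \<Lambda>" by (rule dual_coords)
  note [measurable] = borel_measurable_continuous_onI[OF f(1)]
  define H1 where "H1 t = (\<Sum>\<^sub>\<infinity>l\<in>\<Lambda>. f (t + l))" for t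
  define H2 where "H2 t = (\<Sum>\<^sub>\<infinity>\<xi>\<in>dual_lattice \<Lambda>. fourier f \<xi> * character \<xi> t)" for t
  have H1c: "continuous_on UNIV H1"
    unfolding H1_def
    by (rule continuous_infsum) (auto intro!: weight_bounded_translates f continuous_on_compose2[OF f(1)] continuous_intros)
  have H2c: "continuous_on UNIV H2"
    unfolding H2_def
  proof (rule continuous_infsum)
    show "\<exists>M. M summable_on dual_lattice \<Lambda> \<and> (\<forall>\<xi>\<in>dual_lattice \<Lambda>. \<forall>x. norm x \<le> R \<longrightarrow> norm (fourier f \<xi> * character \<xi> x) \<le> M \<xi>)" for R
      by (intro exI[of _ "\<lambda>\<xi>. norm (fourier f \<xi>)"]) (auto simp: norm_mult L'.weight_bounded_abs_summable[OF fh])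
  qed (intro continuous_intros)
  have coeff1: "(LINT t|fund_measure. H1 t * character \<eta> t) = fourier f (- \<eta>)" if eta: "\<eta> \<in> dual_lattice \<Lambda>" for \<eta>
  proof -
    have "(LINT t|fund_measure. H1 t * character \<eta> t)
        = (LINT t|fund_measure. (\<Sum>\<^sub>\<infinity>l\<in>\<Lambda>. f (t + l) * character \<eta> (t + l)))"
    proof (rule Bochner_Integration.integral_cong[OF refl])
      fix t
      have "(\<Sum>\<^sub>\<infinity>l\<in>\<Lambda>. f (t + l) * character \<eta> (t + l)) = (\<Sum>\<^sub>\<infinity>l\<in>\<Lambda>. f (t + l) * character \<eta> t)"
        by (intro infsum_cong) (simp add: character_period[OF eta])
      also have "\<dots> = H1 t * character \<eta> t"
        unfolding H1_def by (intro infsum_cmult_left)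
          (use weight_bounded_summable[OF weight_bounded_shift[OF f(2), of t]] in \<open>simp add: add.commute\<close>)
      finally show "H1 t * character \<eta> t = (\<Sum>\<^sub>\<infinity>l\<in>\<Lambda>. f (t + l) * character \<eta> (t + l))" ..
    qed
    also have "\<dots> = (LINT x|lborel. f x * character \<eta> x)"
      by (rule integral_tiling) (auto intro!: weight_bounded_mult f)
    finally show ?thesis by (simp add: fourier_eq)
  qed
  have coeff2: "(LINT t|fund_measure. H2 t * character \<eta> t) = vol * fourier f (- \<eta>)" if eta: "\<eta> \<in> dual_lattice \<Lambda>" for \<eta>
  proof -
    have "(LINT t|fund_measure. H2 t * character \<eta> t)
        = (LINT t|fund_measure. (\<Sum>\<^sub>\<infinity>\<xi>\<in>dual_lattice \<Lambda>. fourier f \<xi> * character (\<xi> + \<eta>) t))"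
    proof (rule Bochner_Integration.integral_cong[OF refl])
      fix t
      have "(\<lambda>\<xi>. fourier f \<xi> * character \<xi> t) summable_on dual_lattice \<Lambda>"
        by (rule abs_summable_summable) (simp add: norm_mult L'.weight_bounded_abs_summable[OF fh])
      then show "H2 t * character \<eta> t = (\<Sum>\<^sub>\<infinity>\<xi>\<in>dual_lattice \<Lambda>. fourier f \<xi> * character (\<xi> + \<eta>) t)"
        unfolding H2_def by (subst infsum_cmult_left[symmetric]) (simp_all add: character_freq_add mult.assoc)
    qed
    also have "\<dots> = (\<Sum>\<^sub>\<infinity>\<xi>\<in>dual_lattice \<Lambda>. LINT t|fund_measure. fourier f \<xi> * character (\<xi> + \<eta>) t)"
      by (rule integral_infsum[OF L'.countable_lattice L'.infinite_lattice finite_fund_measure _ _ L'.weight_bounded_abs_summable[OF fh]])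
        (auto simp: norm_mult intro!: integrable_fund_measure continuous_intros)
    also have "\<dots> = (\<Sum>\<^sub>\<infinity>\<xi>\<in>{- \<eta>}. fourier f \<xi> * vol)"
      using eta by (intro infsum_cong_neutral)
        (auto simp: integral_character dual_add dual_minus eq_neg_iff_add_eq_0 measure_fund_measure
          scaleR_conv_of_real)
    finally show ?thesis by (simp add: mult.commute)
  qed
  have "H1 centre - (1 / vol) * H2 centre = 0"
  proof (rule fourier_uniqueness_centre)
    show "continuous_on UNIV (\<lambda>t. H1 t - (1 / vol) * H2 t)" by (intro continuous_intros H1c H2c)
    fix \<eta> assume eta: "\<eta> \<in> dual_lattice \<Lambda>"
    have "(LINT t|fund_measure. (H1 t - (1 / vol) * H2 t) * character \<eta> t)
        = (LINT t|fund_measure. H1 t * character \<eta> t - (1 / vol) * (H2 t * character \<eta> t))"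
      by (simp add: algebra_simps)
    also have "\<dots> = (LINT t|fund_measure. H1 t * character \<eta> t) - (1 / vol) * (LINT t|fund_measure. H2 t * character \<eta> t)"
      by (subst Bochner_Integration.integral_diff) (auto intro!: integrable_fund_measure continuous_intros H1c H2c simp: less_imp_neq[OF vol_pos, symmetric])
    also have "\<dots> = 0"
    proof -
      have "vol \<noteq> 0" using vol_pos by linarith
      then have "complex_of_real vol \<noteq> 0" by (simp only: of_real_eq_0_iff not_False_eq_True)
      then have "complex_of_real (1 / vol) * (complex_of_real vol * z) = z" for z by (simp add: field_simps)
      then show ?thesis by (simp only: coeff1[OF eta] coeff2[OF eta] diff_self)
    qed
    finally show "(LINT t|fund_measure. (H1 t - (1 / vol) * H2 t) * character \<eta> t) = 0" .
  qed
  then show ?thesis by (simp add: H1_def H2_def)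
qed

text \<open>The class of functions is translation invariant, so the case of the centre gives all points.\<close>

theorem poisson_summation:
  assumes f: "schwartz f"
  shows "(\<Sum>\<^sub>\<infinity>l\<in>\<Lambda>. f (l + t)) = (1 / vol) * (\<Sum>\<^sub>\<infinity>\<xi>\<in>dual_lattice \<Lambda>. fourier f \<xi> * character \<xi> t)"
proof -
  define g where "g x = f (x + (t - centre))" for x
  have fg: "fourier g \<xi> = fourier f \<xi> * character \<xi> (t - centre)" for \<xi>
    unfolding g_def by (simp add: fourier_shift schwartz_measurable[OF f] mult.commute)
  have "(\<Sum>\<^sub>\<infinity>l\<in>\<Lambda>. g (centre + l)) = (1 / vol) * (\<Sum>\<^sub>\<infinity>\<xi>\<in>dual_lattice \<Lambda>. fourier g \<xi> * character \<xi> centre)"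
  proof (rule poisson_centre)
    show "continuous_on UNIV g" unfolding g_def
      by (rule continuous_on_compose2[OF schwartz_continuous[OF f]]) (auto intro!: continuous_intros)
    show "weight_bounded g" unfolding g_def by (rule weight_bounded_shift[OF schwartz_weight_bounded[OF f]])
    show "weight_bounded (fourier g)" unfolding fg
      by (rule weight_bounded_mult[OF fourier_weight_bounded[OF f]]) simp
  qed
  moreover have "fourier g \<xi> * character \<xi> centre = fourier f \<xi> * character \<xi> t" for \<xi>
    using character_add[of \<xi> "t - centre" centre] by (simp add: fg)
  ultimately show ?thesis by (simp add: g_def algebra_simps)
qed

end


section \<open>A criterion for formal duality\<close>

lemma infsum_finite_sum:
  fixes f :: "'i \<Rightarrow> 'x \<Rightarrow> complex"
  assumes "finite I" "\<And>i. i \<in> I \<Longrightarrow> f i summable_on A"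
  shows "(\<Sum>i\<in>I. \<Sum>\<^sub>\<infinity>x\<in>A. f i x) = (\<Sum>\<^sub>\<infinity>x\<in>A. \<Sum>i\<in>I. f i x)"
    and "(\<lambda>x. \<Sum>i\<in>I. f i x) summable_on A"
proof -
  have "((\<lambda>x. \<Sum>i\<in>I. f i x) has_sum (\<Sum>i\<in>I. \<Sum>\<^sub>\<infinity>x\<in>A. f i x)) A"
    using assms by (induction I rule: finite_induct) (auto intro: has_sum_0 has_sum_add)
  then show "(\<Sum>i\<in>I. \<Sum>\<^sub>\<infinity>x\<in>A. f i x) = (\<Sum>\<^sub>\<infinity>x\<in>A. \<Sum>i\<in>I. f i x)"
    "(\<lambda>x. \<Sum>i\<in>I. f i x) summable_on A"
    by (auto simp: infsumI summable_on_def)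
qed

lemma infsum_finite_sum2:
  fixes f :: "'i \<Rightarrow> 'j \<Rightarrow> 'x \<Rightarrow> complex"
  assumes "finite I" "finite J" "\<And>i j. i \<in> I \<Longrightarrow> j \<in> J \<Longrightarrow> f i j summable_on A"
  shows "(\<Sum>i\<in>I. \<Sum>j\<in>J. \<Sum>\<^sub>\<infinity>x\<in>A. f i j x) = (\<Sum>\<^sub>\<infinity>x\<in>A. \<Sum>i\<in>I. \<Sum>j\<in>J. f i j x)"
proof -
  have "(\<Sum>i\<in>I. \<Sum>j\<in>J. \<Sum>\<^sub>\<infinity>x\<in>A. f i j x) = (\<Sum>i\<in>I. \<Sum>\<^sub>\<infinity>x\<in>A. \<Sum>j\<in>J. f i j x)"
    using assms by (intro sum.cong refl infsum_finite_sum(1)) auto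
  also have "\<dots> = (\<Sum>\<^sub>\<infinity>x\<in>A. \<Sum>i\<in>I. \<Sum>j\<in>J. f i j x)"
    using assms by (intro infsum_finite_sum(1) infsum_finite_sum(2)) auto
  finally show ?thesis .
qed

lemma cnj_character: "cnj (character \<xi> x) = character \<xi> (- x)"
  by (simp add: character_def exp_cnj)

text \<open>The double sum is the product of the character sum and its conjugate.\<close>

lemma sum_character_differences:
  "(\<Sum>v\<in>W. \<Sum>w\<in>W. character \<xi> (v - w)) = of_real ((real (card W) * cmod (phase_average W \<xi>))\<^sup>2)"
proof (cases "card W = 0")
  case True
  then show ?thesis by (cases "finite W") auto
next
  case False
  then have "of_nat (card W) * phase_average W \<xi> = (\<Sum>v\<in>W. character \<xi> v)"
    by (simp add: phase_average_def character_def)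
  then have "(\<Sum>v\<in>W. character \<xi> v) * cnj (\<Sum>v\<in>W. character \<xi> v)
      = of_real ((real (card W) * cmod (phase_average W \<xi>))\<^sup>2)"
    by (metis complex_norm_square norm_mult norm_of_nat of_real_power)
  moreover have "(\<Sum>v\<in>W. character \<xi> v) * cnj (\<Sum>v\<in>W. character \<xi> v) = (\<Sum>v\<in>W. \<Sum>w\<in>W. character \<xi> (v - w))"
    by (simp add: sum_product cnj_character character_add[of \<xi> _ "- _", symmetric])
  ultimately show ?thesis by simp
qed

text \<open>Poisson summation turns the pair sum of \<open>P\<close> into a sum over \<open>L*\<close> of \<open>fourier f\<close> times the squared
  modulus of the character sum; the hypothesis \<open>count\<close> replaces this by the number of pairs, and
  sorting the pairs of \<open>W'\<close> by their difference modulo \<open>L\<close> yields the pair sum of \<open>Q\<close>.\<close>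

lemma formally_dualI:
  fixes L :: "'a::euclidean_space set"
  assumes P: "presentation L W P" and Q: "presentation L W' Q"
    and sub: "L \<subseteq> dual_lattice L"
    and diff: "\<And>a b. a \<in> W' \<Longrightarrow> b \<in> W' \<Longrightarrow> a - b \<in> dual_lattice L"
    and count: "\<And>\<xi>. \<xi> \<in> dual_lattice L \<Longrightarrow>
      real (card W') * (cmod (phase_average W \<xi>))\<^sup>2 = real (card {(a, b). a \<in> W' \<and> b \<in> W' \<and> \<xi> - (a - b) \<in> L})"
  shows "formally_dual P Q"
  unfolding formally_dual_def
proof (intro conjI allI impI)
  show "periodic_configuration P" "periodic_configuration Q"
    using P Q by (auto simp: periodic_configuration_def)
  fix f :: "'a \<Rightarrow> complex" assume f: "schwartz f"
  obtain B D where BD: "lattice_coords B D L" using presentation_coords[OF P] .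
  then interpret lattice_coords B D L .
  interpret L': lattice_coords "D ` B" "the_inv_into B D" "dual_lattice L" by (rule dual_coords)
  have W: "finite W" "W \<noteq> {}" and W': "finite W'" "W' \<noteq> {}" using P Q by (auto simp: presentation_def)
  note fb = schwartz_weight_bounded[OF f] and fhb = fourier_weight_bounded[OF f]
  define n m :: complex where "n = of_nat (card W)" and "m = of_nat (card W')"
  have nm: "n \<noteq> 0" "m \<noteq> 0" using W W' by (auto simp: n_def m_def)
  define N where "N \<xi> = complex_of_nat (card {(a, b). a \<in> W' \<and> b \<in> W' \<and> \<xi> - (a - b) \<in> L})" for \<xi>
  have sum_f: "(\<lambda>\<xi>. fourier f \<xi> * g \<xi>) summable_on dual_lattice L" if "\<And>\<xi>. norm (g \<xi>) \<le> 1" for g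
    by (rule L'.weight_bounded_summable[OF weight_bounded_mult[OF fhb that]])
  have "pair_sum f P = (1 / n) * (\<Sum>v\<in>W. \<Sum>w\<in>W. \<Sum>\<^sub>\<infinity>x\<in>L. f (x + v - w))"
    unfolding n_def by (rule pair_sum_weight_bounded[OF P fb])
  also have "\<dots> = (1 / n) * (\<Sum>v\<in>W. \<Sum>w\<in>W. (1 / vol) * (\<Sum>\<^sub>\<infinity>\<xi>\<in>dual_lattice L. fourier f \<xi> * character \<xi> (v - w)))"
    using poisson_summation[OF f] by (simp add: add_diff_eq[symmetric])
  also have "\<dots> = (1 / n) * ((1 / vol) * (\<Sum>\<^sub>\<infinity>\<xi>\<in>dual_lattice L. \<Sum>v\<in>W. \<Sum>w\<in>W. fourier f \<xi> * character \<xi> (v - w)))"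
    using W sum_f by (subst infsum_finite_sum2[symmetric]) (auto simp: sum_distrib_left)
  also have "(\<Sum>\<^sub>\<infinity>\<xi>\<in>dual_lattice L. \<Sum>v\<in>W. \<Sum>w\<in>W. fourier f \<xi> * character \<xi> (v - w))
      = (\<Sum>\<^sub>\<infinity>\<xi>\<in>dual_lattice L. (n\<^sup>2 / m) * (fourier f \<xi> * N \<xi>))"
  proof (rule infsum_cong)
    fix \<xi> assume xi: "\<xi> \<in> dual_lattice L"
    have "m * of_real ((cmod (phase_average W \<xi>))\<^sup>2) = N \<xi>"
      using arg_cong[OF count[OF xi], of complex_of_real] by (simp add: m_def N_def)
    then have "of_real ((cmod (phase_average W \<xi>))\<^sup>2) = N \<xi> / m" using nm by (simp add: field_simps)
    moreover have "(\<Sum>v\<in>W. \<Sum>w\<in>W. fourier f \<xi> * character \<xi> (v - w)) = fourier f \<xi> * (n\<^sup>2 * of_real ((cmod (phase_average W \<xi>))\<^sup>2))"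
      by (simp add: sum_distrib_left[symmetric] sum_character_differences n_def power_mult_distrib)
    ultimately show "(\<Sum>v\<in>W. \<Sum>w\<in>W. fourier f \<xi> * character \<xi> (v - w)) = (n\<^sup>2 / m) * (fourier f \<xi> * N \<xi>)"
      by simp
  qed
  also have "\<dots> = (n\<^sup>2 / m) * (\<Sum>\<^sub>\<infinity>\<xi>\<in>dual_lattice L. fourier f \<xi> * N \<xi>)"
    by (rule infsum_cmult_right')
  finally have lhs: "pair_sum f P = (n / vol) * ((1 / m) * (\<Sum>\<^sub>\<infinity>\<xi>\<in>dual_lattice L. fourier f \<xi> * N \<xi>))"
    using nm by (simp add: power2_eq_square)
  have shift: "(\<Sum>\<^sub>\<infinity>x\<in>L. fourier f (x + a - b))
      = (\<Sum>\<^sub>\<infinity>\<xi>\<in>dual_lattice L. fourier f \<xi> * (if \<xi> - (a - b) \<in> L then 1 else 0))"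
    if ab: "a \<in> W'" "b \<in> W'" for a b
  proof -
    have bij: "bij_betw (\<lambda>x. x + (a - b)) L {\<xi>. \<xi> - (a - b) \<in> L}"
      by (rule bij_betwI[where g = "\<lambda>\<xi>. \<xi> - (a - b)"]) (auto simp: algebra_simps)
    have "{\<xi>. \<xi> - (a - b) \<in> L} \<subseteq> dual_lattice L"
    proof
      fix \<xi> assume "\<xi> \<in> {\<xi>. \<xi> - (a - b) \<in> L}"
      then have "\<xi> - (a - b) \<in> dual_lattice L" using sub by blast
      from dual_add[OF this diff[OF ab]] show "\<xi> \<in> dual_lattice L" by simp
    qed
    then have "(\<Sum>\<^sub>\<infinity>\<xi>\<in>dual_lattice L. fourier f \<xi> * (if \<xi> - (a - b) \<in> L then 1 else 0))
        = (\<Sum>\<^sub>\<infinity>\<xi>\<in>{\<xi>. \<xi> - (a - b) \<in> L}. fourier f \<xi>)"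
      by (intro infsum_cong_neutral) auto
    also have "\<dots> = (\<Sum>\<^sub>\<infinity>x\<in>L. fourier f (x + (a - b)))"
      by (rule infsum_reindex_bij_betw[OF bij, symmetric])
    finally show ?thesis by (simp add: add_diff_eq)
  qed
  have "pair_sum (fourier f) Q = (1 / m) * (\<Sum>a\<in>W'. \<Sum>b\<in>W'. \<Sum>\<^sub>\<infinity>x\<in>L. fourier f (x + a - b))"
    unfolding m_def by (rule pair_sum_weight_bounded[OF Q fhb])
  also have "(\<Sum>a\<in>W'. \<Sum>b\<in>W'. \<Sum>\<^sub>\<infinity>x\<in>L. fourier f (x + a - b))
      = (\<Sum>a\<in>W'. \<Sum>b\<in>W'. \<Sum>\<^sub>\<infinity>\<xi>\<in>dual_lattice L. fourier f \<xi> * (if \<xi> - (a - b) \<in> L then 1 else 0))"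
    by (intro sum.cong refl shift)
  also have "\<dots> = (\<Sum>\<^sub>\<infinity>\<xi>\<in>dual_lattice L. \<Sum>a\<in>W'. \<Sum>b\<in>W'. fourier f \<xi> * (if \<xi> - (a - b) \<in> L then 1 else 0))"
    using W' sum_f by (intro infsum_finite_sum2) auto
  also have "\<dots> = (\<Sum>\<^sub>\<infinity>\<xi>\<in>dual_lattice L. fourier f \<xi> * N \<xi>)"
  proof (rule infsum_cong)
    fix \<xi>
    have "N \<xi> = (\<Sum>a\<in>W'. \<Sum>b\<in>W'. if \<xi> - (a - b) \<in> L then 1 else 0)"
    proof -
      have "{(a, b). a \<in> W' \<and> b \<in> W' \<and> \<xi> - (a - b) \<in> L} = {z \<in> W' \<times> W'. \<xi> - (fst z - snd z) \<in> L}" by auto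
      then have "N \<xi> = (\<Sum>z\<in>W' \<times> W'. if \<xi> - (fst z - snd z) \<in> L then 1 else 0)"
        using W' by (simp add: N_def sum.If_cases Int_def)
      then show ?thesis by (simp add: sum.cartesian_product case_prod_unfold)
    qed
    then show "(\<Sum>a\<in>W'. \<Sum>b\<in>W'. fourier f \<xi> * (if \<xi> - (a - b) \<in> L then 1 else 0)) = fourier f \<xi> * N \<xi>"
      by (simp only: sum_distrib_left)
  qed
  finally have rhs: "pair_sum (fourier f) Q = (1 / m) * (\<Sum>\<^sub>\<infinity>\<xi>\<in>dual_lattice L. fourier f \<xi> * N \<xi>)" .
  show "pair_sum f P = of_real (particle_density P) * pair_sum (fourier f) Q"
    unfolding lhs rhs by (simp add: particle_density_eq[OF P] covolume_eq[OF BD] n_def)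
qed

section \<open>Finite-index subgroups of integer lattices\<close>

definition int_span :: "'a::euclidean_space set \<Rightarrow> 'a set" where
  "int_span B = {(\<Sum>b\<in>B. of_int (c b) *\<^sub>R b) | c :: 'a \<Rightarrow> int. True}"

lemma int_span_insert:
  assumes "finite B" "b \<notin> B"
  shows "int_span (insert b B) = {of_int r *\<^sub>R b + y | r y. y \<in> int_span B}"
proof (intro equalityI subsetI)
  fix x assume "x \<in> int_span (insert b B)"
  then obtain c :: "'a \<Rightarrow> int" where "x = (\<Sum>b\<in>insert b B. of_int (c b) *\<^sub>R b)" by (auto simp: int_span_def)
  then have "x = of_int (c b) *\<^sub>R b + (\<Sum>b\<in>B. of_int (c b) *\<^sub>R b)" using assms by simp
  then show "x \<in> {of_int r *\<^sub>R b + y | r y. y \<in> int_span B}" unfolding int_span_def by blast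
next
  fix x assume "x \<in> {of_int r *\<^sub>R b + y | r y. y \<in> int_span B}"
  then obtain r and c :: "'a \<Rightarrow> int" where x: "x = of_int r *\<^sub>R b + (\<Sum>b\<in>B. of_int (c b) *\<^sub>R b)"
    by (auto simp: int_span_def)
  have "(\<Sum>b\<in>B. of_int (c b) *\<^sub>R b) = (\<Sum>b'\<in>B. of_int ((c(b := r)) b') *\<^sub>R b')"
    using assms by (intro sum.cong) auto
  then have "x = (\<Sum>b'\<in>insert b B. of_int ((c(b := r)) b') *\<^sub>R b')" using assms by (simp add: x)
  then show "x \<in> int_span (insert b B)" unfolding int_span_def by blast
qed

lemma int_span_diff: "x \<in> int_span B \<Longrightarrow> y \<in> int_span B \<Longrightarrow> x - y \<in> int_span B"
proof -
  assume "x \<in> int_span B" "y \<in> int_span B"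
  then obtain c d :: "'a \<Rightarrow> int" where "x = (\<Sum>b\<in>B. of_int (c b) *\<^sub>R b)" "y = (\<Sum>b\<in>B. of_int (d b) *\<^sub>R b)"
    by (auto simp: int_span_def)
  then have "x - y = (\<Sum>b\<in>B. of_int (c b - d b) *\<^sub>R b)" by (simp add: sum_subtractf scaleR_left_diff_distrib)
  then show ?thesis unfolding int_span_def by (intro CollectI exI[of _ "\<lambda>b. c b - d b"]) simp
qed

lemma int_span_subset_span: "int_span B \<subseteq> span B"
  unfolding int_span_def by clarify (rule span_sum, rule span_scale, rule span_base)

lemma mult_mem_of_diff_closed:
  fixes G :: "'a::euclidean_space set"
  assumes "0 \<in> G" and diff: "\<And>x y. x \<in> G \<Longrightarrow> y \<in> G \<Longrightarrow> x - y \<in> G" and "x \<in> G"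
  shows "of_int k *\<^sub>R x \<in> G"
proof -
  have neg: "- y \<in> G" if "y \<in> G" for y using diff[OF \<open>0 \<in> G\<close> that] by simp
  have nat: "of_nat n *\<^sub>R x \<in> G" for n
  proof (induction n)
    case (Suc n)
    from diff[OF this neg[OF \<open>x \<in> G\<close>]] show ?case by (simp add: algebra_simps)
  qed (use assms in simp)
  show ?thesis
    using nat[of "nat k"] neg[OF nat[of "nat (- k)"]] by (cases "k \<ge> 0") auto
qed

lemma int_subgroup_principal:
  fixes R :: "int set"
  assumes "k \<in> R" "k > 0" and diff: "\<And>x y. x \<in> R \<Longrightarrow> y \<in> R \<Longrightarrow> x - y \<in> R"
  obtains d where "d \<in> R" "d > 0" "\<And>r. r \<in> R \<Longrightarrow> d dvd r"
proof -
  let ?Q = "\<lambda>n::nat. n > 0 \<and> int n \<in> R"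
  have ex: "?Q (nat k)" using assms by simp
  define n where "n = (LEAST n. ?Q n)"
  have n: "?Q n" unfolding n_def by (rule LeastI[of ?Q, OF ex])
  have "0 \<in> R" using diff[of k k] assms by simp
  have neg: "- y \<in> R" if "y \<in> R" for y using diff[OF \<open>0 \<in> R\<close> that] by simp
  have nat: "int j * int n \<in> R" for j
  proof (induction j)
    case (Suc j)
    from diff[OF this neg[OF conjunct2[OF n]]] show ?case by (simp add: algebra_simps)
  qed (use \<open>0 \<in> R\<close> in simp)
  have mult: "j * int n \<in> R" for j :: int
    using nat[of "nat j"] neg[OF nat[of "nat (- j)"]] by (cases "j \<ge> 0") auto
  show ?thesis
  proof (rule that[of "int n"])
    fix r assume "r \<in> R"
    from diff[OF this mult[of "r div int n"]] have "r mod int n \<in> R"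
      by (simp add: minus_div_mult_eq_mod)
    then have "\<not> ?Q (nat (r mod int n)) \<Longrightarrow> r mod int n = 0"
    proof -
      assume "\<not> ?Q (nat (r mod int n))"
      moreover have "r mod int n \<ge> 0" using n by simp
      ultimately show "r mod int n = 0" using \<open>r mod int n \<in> R\<close> by (cases "r mod int n = 0") auto
    qed
    moreover have "\<not> ?Q (nat (r mod int n))"
    proof
      assume "?Q (nat (r mod int n))"
      then have "n \<le> nat (r mod int n)" unfolding n_def by (rule Least_le)
      moreover have "r mod int n < int n" using n by simp
      ultimately show False using n by linarith
    qed
    ultimately show "int n dvd r" by auto
  qed (use n in auto)
qed

text \<open>Hermite reduction: adjoin one basis vector \<open>b\<close> at a time. The \<open>b\<close>-coefficients occurring in \<open>G\<close> form
  a nonzero subgroup of the integers, and an element of \<open>G\<close> whose coefficient generates it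
  complements a basis of the elements of \<open>G\<close> with coefficient 0.\<close>

lemma subgroup_basis:
  fixes G :: "'a::euclidean_space set"
  assumes "finite B" "independent B" "G \<subseteq> int_span B" "0 \<in> G"
    and "\<And>x y. x \<in> G \<Longrightarrow> y \<in> G \<Longrightarrow> x - y \<in> G"
    and "k > 0" "\<And>b. b \<in> B \<Longrightarrow> of_int k *\<^sub>R b \<in> G"
  shows "\<exists>B'. finite B' \<and> independent B' \<and> span B' = span B \<and> G = int_span B'"
  using assms
proof (induction B arbitrary: G)
  case empty
  then show ?case by (intro exI[of _ "{}"]) (auto simp: int_span_def)
next
  case (insert b B)
  note diff = insert.prems(4)
  have indB: "independent B" and b: "b \<notin> span B"
    using insert.prems(1) insert.hyps by (auto simp: independent_insert)
  have zeroB: "0 \<in> int_span B" by (auto simp: int_span_def intro!: exI[of _ "\<lambda>_. 0"])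
  have "k *\<^sub>R b' \<in> int_span B" if "b' \<in> B" for b'
  proof -
    have "k *\<^sub>R b' = (\<Sum>a\<in>B. of_int (if a = b' then k else 0) *\<^sub>R a)"
      using that insert.hyps by (simp add: if_distrib[of real_of_int] if_distrib[of "\<lambda>r. r *\<^sub>R _"] cong: if_cong)
    then show ?thesis unfolding int_span_def by (intro CollectI exI[of _ "\<lambda>a. if a = b' then k else 0"] conjI TrueI)
  qed
  then have "\<exists>B'. finite B' \<and> independent B' \<and> span B' = span B \<and> G \<inter> int_span B = int_span B'"
    using insert.prems zeroB by (intro insert.IH[OF indB]) (auto intro: int_span_diff)
  then obtain B'' where B'': "finite B''" "independent B''" "span B'' = span B" "G \<inter> int_span B = int_span B''"
    by blast
  define R where "R = {r. \<exists>y\<in>int_span B. of_int r *\<^sub>R b + y \<in> G}"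
  have kR: "k \<in> R" using insert.prems(6)[of b] zeroB by (force simp: R_def)
  have "r - s \<in> R" if rs: "r \<in> R" "s \<in> R" for r s
  proof -
    obtain y z where yz: "y \<in> int_span B" "of_int r *\<^sub>R b + y \<in> G" "z \<in> int_span B" "of_int s *\<^sub>R b + z \<in> G"
      using rs by (auto simp: R_def)
    from diff[OF yz(2,4)] have "of_int (r - s) *\<^sub>R b + (y - z) \<in> G" by (simp add: algebra_simps)
    then show ?thesis using int_span_diff[OF yz(1,3)] by (auto simp: R_def)
  qed
  from int_subgroup_principal[OF kR insert.prems(5) this]
  obtain d where d: "d \<in> R" "d > 0" "\<And>r. r \<in> R \<Longrightarrow> d dvd r" by blast
  then obtain y0 where y0: "y0 \<in> int_span B" "of_int d *\<^sub>R b + y0 \<in> G" by (auto simp: R_def)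
  define g where "g = of_int d *\<^sub>R b + y0"
  have g: "g \<in> G" using y0 by (simp add: g_def)
  have y0s: "y0 \<in> span B" using y0(1) int_span_subset_span by blast
  have g_notin: "g \<notin> span B''"
  proof
    assume "g \<in> span B''"
    then have "of_int d *\<^sub>R b \<in> span B" using span_diff[OF _ y0s, of g] by (simp add: B''(3) g_def)
    then have "b \<in> span B" using d(2) span_scale[of "of_int d *\<^sub>R b" B "1 / of_int d"] by simp
    with b show False ..
  qed
  then have g_notin': "g \<notin> B''" using span_base by blast
  have ind: "independent (insert g B'')" using B''(2) g_notin by (simp add: independent_insert g_notin')
  have span: "span (insert g B'') = span (insert b B)"
  proof -
    have y0_insert: "y0 \<in> span (insert a B)" for a
      using y0s span_mono[of B "insert a B"] by blast
    have "b = (1 / of_int d) *\<^sub>R (g - y0)" using d(2) by (simp add: g_def)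
    moreover have "g - y0 \<in> span (insert g B)"
      by (rule span_diff[OF span_base y0_insert]) simp
    ultimately have "b \<in> span (insert g B)" by (metis span_scale)
    moreover have "g \<in> span (insert b B)" unfolding g_def
      by (rule span_add[OF span_scale[OF span_base] y0_insert]) simp
    ultimately have "span (insert g B) = span (insert b B)"
      by (intro span_eq[THEN iffD2]) (auto intro: span_base)
    moreover have "span (insert g B'') = span (insert g B)"
      using B''(3) by (simp add: span_insert)
    ultimately show ?thesis by simp
  qed
  have "G = int_span (insert g B'')"
  proof (intro equalityI subsetI)
    fix x assume x: "x \<in> G"
    then obtain r y where ry: "x = of_int r *\<^sub>R b + y" "y \<in> int_span B"
      using insert.prems(2) by (auto simp: int_span_insert[OF insert.hyps])
    then have "r \<in> R" using x by (auto simp: R_def)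
    then obtain q where q: "r = q * d" using d(3) by (metis dvdE mult.commute)
    have "x - of_int q *\<^sub>R g \<in> G"
      by (rule diff[OF x mult_mem_of_diff_closed[OF insert.prems(3) diff g]])
    moreover have "x - of_int q *\<^sub>R g = y - of_int q *\<^sub>R y0" by (simp add: ry(1) q g_def algebra_simps)
    moreover have "y - of_int q *\<^sub>R y0 \<in> int_span B"
      by (rule int_span_diff[OF ry(2) mult_mem_of_diff_closed[OF zeroB int_span_diff y0(1)]])
    ultimately have "x - of_int q *\<^sub>R g \<in> int_span B''" using B''(4) by auto
    moreover have "x = of_int q *\<^sub>R g + (x - of_int q *\<^sub>R g)" by simp
    ultimately show "x \<in> int_span (insert g B'')"
      unfolding int_span_insert[OF B''(1) g_notin'] by blast
  next
    fix x assume "x \<in> int_span (insert g B'')"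
    then obtain r y where ry: "x = of_int r *\<^sub>R g + y" "y \<in> int_span B''"
      by (auto simp: int_span_insert[OF B''(1) g_notin'])
    have "- y \<in> G" using ry(2) B''(4) diff[OF insert.prems(3)] by force
    from diff[OF mult_mem_of_diff_closed[OF insert.prems(3) diff g] this]
    show "x \<in> G" by (simp add: ry(1))
  qed
  with ind span B''(1) show ?case by blast
qed

lemma int_span_scaled_Basis:
  assumes "c > 0"
  shows "int_span ((\<lambda>b. c *\<^sub>R b) ` Basis) = {x::'a::euclidean_space. \<forall>b\<in>Basis. \<exists>k::int. x \<bullet> b = c * of_int k}" (is "_ = ?R")
proof -
  have inj: "inj_on (\<lambda>b. c *\<^sub>R b) (Basis :: 'a set)" using assms by (auto simp: inj_on_def)
  show ?thesis
  proof (intro equalityI subsetI)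
    fix x :: 'a assume "x \<in> int_span ((\<lambda>b. c *\<^sub>R b) ` Basis)"
    then obtain d :: "'a \<Rightarrow> int" where "x = (\<Sum>b\<in>(\<lambda>b. c *\<^sub>R b) ` Basis. of_int (d b) *\<^sub>R b)"
      by (auto simp: int_span_def)
    then have "x = (\<Sum>b\<in>Basis. (of_int (d (c *\<^sub>R b)) * c) *\<^sub>R b)" by (simp add: sum.reindex[OF inj])
    then have "x \<bullet> b = c * of_int (d (c *\<^sub>R b))" if "b \<in> Basis" for b
      using that by (simp add: inner_sum_left_Basis mult.commute)
    then show "x \<in> ?R" by blast
  next
    fix x assume "x \<in> ?R"
    then obtain k :: "'a \<Rightarrow> int" where k: "\<And>b. b \<in> Basis \<Longrightarrow> x \<bullet> b = c * of_int (k b)" by (auto simp: bchoice_iff)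
    have "x = (\<Sum>b\<in>Basis. (x \<bullet> b) *\<^sub>R b)" by (simp add: euclidean_representation)
    also have "\<dots> = (\<Sum>b\<in>(\<lambda>b. c *\<^sub>R b) ` Basis. of_int (k ((1 / c) *\<^sub>R b)) *\<^sub>R b)"
      using assms by (subst sum.reindex[OF inj]) (auto intro!: sum.cong simp: k mult.commute)
    finally show "x \<in> int_span ((\<lambda>b. c *\<^sub>R b) ` Basis)" unfolding int_span_def
      by (intro CollectI exI[of _ "\<lambda>b. k ((1 / c) *\<^sub>R b)"]) simp
  qed
qed

lemma scaled_Basis:
  assumes "c > 0"
  shows "independent ((\<lambda>b. c *\<^sub>R b) ` (Basis::'a::euclidean_space set))"
    and "span ((\<lambda>b. c *\<^sub>R b) ` Basis) = (UNIV::'a set)"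
proof -
  have inj: "inj_on (\<lambda>b. c *\<^sub>R b) (Basis :: 'a set)" using assms by (auto simp: inj_on_def)
  have "b \<in> span ((\<lambda>b. c *\<^sub>R b) ` Basis)" if "b \<in> Basis" for b :: 'a
    using span_scale[OF span_base[OF imageI[OF that, of "\<lambda>b. c *\<^sub>R b"]], of "1 / c"] assms by simp
  then have "span Basis \<subseteq> span ((\<lambda>b. c *\<^sub>R b) ` (Basis::'a set))"
    by (intro span_minimal subsetI subspace_span)
  then show sp: "span ((\<lambda>b. c *\<^sub>R b) ` Basis) = (UNIV::'a set)" by auto
  show "independent ((\<lambda>b. c *\<^sub>R b) ` (Basis::'a set))"
    by (rule card_le_dim_spanning[where V = UNIV]) (use sp in \<open>auto simp: card_image[OF inj]\<close>)
qed

definition cubic_lattice :: "real \<Rightarrow> 'a::euclidean_space set" where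
  "cubic_lattice c = {x. \<forall>b\<in>Basis. \<exists>k::int. x \<bullet> b = c * of_int k}"

lemma cubic_lattice_basis:
  "c > 0 \<Longrightarrow> lattice_basis ((\<lambda>b. c *\<^sub>R b) ` Basis) (cubic_lattice c)"
  unfolding lattice_basis_def int_span_def[symmetric] cubic_lattice_def
  by (simp add: scaled_Basis int_span_scaled_Basis)

lemma covolume_cubic:
  assumes c: "c > 0"
  shows "covolume (cubic_lattice c :: 'a::euclidean_space set) = c ^ DIM('a)"
proof -
  let ?B = "(\<lambda>b. c *\<^sub>R b) ` (Basis :: 'a set)"
  have "lattice_coords ?B (\<lambda>b. (1 / c^2) *\<^sub>R b) (cubic_lattice c)"
    using c by (auto simp: lattice_coords_def cubic_lattice_basis inner_Basis power2_eq_square)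
  then interpret lattice_coords ?B "\<lambda>b. (1 / c^2) *\<^sub>R b" "cubic_lattice c :: 'a set" .
  have F: "F = {x. \<forall>b\<in>Basis. 0 \<le> x \<bullet> b \<and> x \<bullet> b < c}"
    using c by (auto simp: fund_iff inner_commute power2_eq_square field_simps zero_le_mult_iff)
  have "box 0 (c *\<^sub>R One) \<subseteq> F" "F \<subseteq> cbox 0 (c *\<^sub>R One)"
    by (auto simp: F box_def cbox_def less_imp_le)
  then have "emeasure lborel (box 0 (c *\<^sub>R One) :: 'a set) \<le> emeasure lborel F"
     "emeasure lborel F \<le> emeasure lborel (cbox 0 (c *\<^sub>R One) :: 'a set)"
    by (auto intro!: emeasure_mono)
  then have "ennreal (c ^ DIM('a)) \<le> ennreal vol" "ennreal vol \<le> ennreal (c ^ DIM('a))"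
    using c by (simp_all add: emeasure_fund emeasure_lborel_box_eq emeasure_lborel_cbox_eq)
  then have "ennreal vol = ennreal (c ^ DIM('a))" by (rule antisym[rotated])
  then have "vol = c ^ DIM('a)" using vol_pos c by (simp add: ennreal_inj)
  then show ?thesis using covolume_eq[OF lattice_coords_axioms] by simp
qed

text \<open>Bases must come from an existence argument, because the code, and with it the Leech lattice, is
  given only abstractly.\<close>

lemma subgroup_is_lattice:
  fixes G :: "'a::euclidean_space set"
  assumes c: "c > 0" and sub: "G \<subseteq> cubic_lattice c" and k: "k > 0" "cubic_lattice (c * of_int k) \<subseteq> G"
    and diff: "\<And>x y. x \<in> G \<Longrightarrow> y \<in> G \<Longrightarrow> x - y \<in> G"
  shows "is_lattice G"
proof -
  let ?B = "(\<lambda>b. c *\<^sub>R b) ` (Basis :: 'a set)"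
  have "0 \<in> cubic_lattice (c * of_int k)" by (auto simp: cubic_lattice_def intro!: exI[of _ 0])
  then have "0 \<in> G" using k by auto
  moreover have "of_int k *\<^sub>R b \<in> G" if "b \<in> ?B" for b
  proof -
    have "of_int k *\<^sub>R b \<in> cubic_lattice (c * of_int k)"
      using that by (auto simp: cubic_lattice_def inner_Basis intro: exI[of _ 0] exI[of _ 1])
    then show ?thesis using k by auto
  qed
  moreover have "G \<subseteq> int_span ?B" using sub int_span_scaled_Basis[OF c, where 'a = 'a] by (simp add: cubic_lattice_def)
  ultimately obtain B' where "independent B'" "span B' = span ?B" "G = int_span B'"
    using subgroup_basis[of ?B G k] scaled_Basis(1)[OF c] diff k by auto
  then show ?thesis using scaled_Basis(2)[OF c]
    by (auto simp: is_lattice_def lattice_basis_def int_span_def)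
qed

section \<open>Rescaling\<close>

lemma rescale_lattice_basis:
  assumes c: "c > 0" and B: "lattice_basis B \<Lambda>"
  shows "lattice_basis ((\<lambda>b. c *\<^sub>R b) ` B) (rescale c \<Lambda>)"
proof -
  have inj: "inj_on (\<lambda>b. c *\<^sub>R b) B" using c by (auto simp: inj_on_def)
  have fin: "finite B" using B by (simp add: lattice_basis_def independent_imp_finite)
  have span: "span ((\<lambda>b. c *\<^sub>R b) ` B) = UNIV"
  proof -
    have "span ((\<lambda>b. c *\<^sub>R b) ` B) = (\<lambda>b. c *\<^sub>R b) ` span B"
      by (rule linear_span_image) (rule linear_scale_self)
    also have "\<dots> = UNIV" using B c
      by (auto simp: lattice_basis_def image_iff intro!: exI[of _ "(1 / c) *\<^sub>R _"])
    finally show ?thesis .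
  qed
  have "card B = dim (UNIV :: 'a set)"
    using B by (metis basis_card_eq_dim lattice_basis_def top_greatest)
  then have ind: "independent ((\<lambda>b. c *\<^sub>R b) ` B)"
    by (intro card_le_dim_spanning[where V = UNIV]) (use span fin in \<open>auto simp: card_image[OF inj]\<close>)
  have "rescale c \<Lambda> = {(\<Sum>b\<in>(\<lambda>b. c *\<^sub>R b) ` B. of_int (d b) *\<^sub>R b) | d :: 'a \<Rightarrow> int. True}" (is "_ = ?R")
  proof (intro equalityI subsetI)
    fix x assume "x \<in> rescale c \<Lambda>"
    then obtain d :: "'a \<Rightarrow> int" where "x = c *\<^sub>R (\<Sum>b\<in>B. of_int (d b) *\<^sub>R b)"
      using B by (auto simp: rescale_def lattice_basis_def)
    then have "x = (\<Sum>b\<in>(\<lambda>b. c *\<^sub>R b) ` B. of_int (d ((1 / c) *\<^sub>R b)) *\<^sub>R b)"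
      using c by (simp add: sum.reindex[OF inj] scaleR_sum_right mult.commute)
    then show "x \<in> ?R" by (intro CollectI exI[of _ "\<lambda>b. d ((1 / c) *\<^sub>R b)"]) simp
  next
    fix x assume "x \<in> ?R"
    then obtain d :: "'a \<Rightarrow> int" where "x = (\<Sum>b\<in>(\<lambda>b. c *\<^sub>R b) ` B. of_int (d b) *\<^sub>R b)" by auto
    then have "x = c *\<^sub>R (\<Sum>b\<in>B. of_int (d (c *\<^sub>R b)) *\<^sub>R b)"
      by (simp add: sum.reindex[OF inj] scaleR_sum_right mult.commute)
    moreover have "(\<Sum>b\<in>B. of_int (d (c *\<^sub>R b)) *\<^sub>R b) \<in> \<Lambda>"
      using B unfolding lattice_basis_def by (auto intro!: exI[of _ "\<lambda>b. d (c *\<^sub>R b)"])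
    ultimately show "x \<in> rescale c \<Lambda>" by (auto simp: rescale_def)
  qed
  with ind span show ?thesis by (simp add: lattice_basis_def)
qed

lemma covolume_rescale:
  fixes \<Lambda> :: "'a::euclidean_space set"
  assumes c: "c > 0" and L: "is_lattice \<Lambda>"
  shows "covolume (rescale c \<Lambda>) = c ^ DIM('a) * covolume \<Lambda>"
proof -
  obtain B where B: "lattice_basis B \<Lambda>" using L by (auto simp: is_lattice_def)
  obtain D where LC: "lattice_coords B D \<Lambda>" using lattice_coords_exist[OF B] .
  obtain D' where LC': "lattice_coords ((\<lambda>b. c *\<^sub>R b) ` B) D' (rescale c \<Lambda>)"
    using lattice_coords_exist[OF rescale_lattice_basis[OF c B]] .
  interpret lattice_coords B D \<Lambda> by fact
  interpret R: lattice_coords "(\<lambda>b. c *\<^sub>R b) ` B" D' "rescale c \<Lambda>" by fact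
  have inj: "inj_on (\<lambda>b. c *\<^sub>R b) B" using c by (auto simp: inj_on_def)
  have F: "R.F = (\<lambda>x. c *\<^sub>R x + 0) ` F"
  proof -
    have "(\<Sum>b\<in>(\<lambda>b. c *\<^sub>R b) ` B. t b *\<^sub>R b) = c *\<^sub>R (\<Sum>b\<in>B. t (c *\<^sub>R b) *\<^sub>R b)" for t
      by (simp add: sum.reindex[OF inj] scaleR_sum_right mult.commute)
    moreover have "c *\<^sub>R (\<Sum>b\<in>B. t b *\<^sub>R b) = (\<Sum>b\<in>(\<lambda>b. c *\<^sub>R b) ` B. t ((1 / c) *\<^sub>R b) *\<^sub>R b)" for t
      using c by (simp add: sum.reindex[OF inj] scaleR_sum_right mult.commute)
    ultimately show ?thesis
    proof (intro equalityI subsetI)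
      assume *: "\<And>t. (\<Sum>b\<in>(\<lambda>b. c *\<^sub>R b) ` B. t b *\<^sub>R b) = c *\<^sub>R (\<Sum>b\<in>B. t (c *\<^sub>R b) *\<^sub>R b)"
      fix x assume "x \<in> R.F"
      then obtain t where t: "x = (\<Sum>b\<in>(\<lambda>b. c *\<^sub>R b) ` B. t b *\<^sub>R b)" "\<forall>b\<in>(\<lambda>b. c *\<^sub>R b) ` B. 0 \<le> t b \<and> t b < 1"
        by (auto simp: fund_parallelepiped_def)
      then have "(\<Sum>b\<in>B. t (c *\<^sub>R b) *\<^sub>R b) \<in> F" unfolding fund_parallelepiped_def
        by (intro CollectI exI[of _ "\<lambda>b. t (c *\<^sub>R b)"]) auto
      then show "x \<in> (\<lambda>x. c *\<^sub>R x + 0) ` F" using t * by auto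
    next
      assume *: "\<And>t. c *\<^sub>R (\<Sum>b\<in>B. t b *\<^sub>R b) = (\<Sum>b\<in>(\<lambda>b. c *\<^sub>R b) ` B. t ((1 / c) *\<^sub>R b) *\<^sub>R b)"
      fix x assume "x \<in> (\<lambda>x. c *\<^sub>R x + 0) ` F"
      then obtain t where t: "x = c *\<^sub>R (\<Sum>b\<in>B. t b *\<^sub>R b)" "\<forall>b\<in>B. 0 \<le> t b \<and> t b < 1"
        by (auto simp: fund_parallelepiped_def)
      then show "x \<in> R.F" unfolding fund_parallelepiped_def
        using c by (intro CollectI exI[of _ "\<lambda>b. t ((1 / c) *\<^sub>R b)"]) (auto simp: *)
    qed
  qed
  have "measure lebesgue R.F = c ^ DIM('a) * measure lebesgue F"
    unfolding F using measure_lebesgue_affine[of c 0 F] c by simp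
  then show ?thesis
    by (simp add: covolume_eq[OF LC] covolume_eq[OF LC'] measure_lebesgue_fund R.measure_lebesgue_fund)
qed

lemma presentation_rescale:
  assumes c: "c > 0" and P: "presentation \<Lambda> W P"
  shows "presentation (rescale c \<Lambda>) (rescale c W) (rescale c P)"
proof -
  have W: "is_lattice \<Lambda>" "finite W" "W \<noteq> {}" "inj_on (\<lambda>v. (+) v ` \<Lambda>) W" "P = (\<Union>v\<in>W. (+) v ` \<Lambda>)"
    using P by (auto simp: presentation_def)
  have coset: "(+) (c *\<^sub>R v) ` rescale c \<Lambda> = rescale c ((+) v ` \<Lambda>)" for v
    by (auto simp: rescale_def image_image scaleR_add_right)
  have injr: "rescale c X = rescale c Y \<Longrightarrow> X = Y" for X Y :: "'a set"
    using c unfolding rescale_def by (subst (asm) inj_image_eq_iff) (auto simp: inj_on_def)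
  show ?thesis
    unfolding presentation_def
  proof (intro conjI)
    show "is_lattice (rescale c \<Lambda>)" using W(1) rescale_lattice_basis[OF c] by (auto simp: is_lattice_def)
    show "inj_on (\<lambda>v. (+) v ` rescale c \<Lambda>) (rescale c W)"
    proof (rule inj_onI)
      fix x y assume xy: "x \<in> rescale c W" "y \<in> rescale c W" "(+) x ` rescale c \<Lambda> = (+) y ` rescale c \<Lambda>"
      then obtain v w where vw: "v \<in> W" "w \<in> W" "x = c *\<^sub>R v" "y = c *\<^sub>R w" by (auto simp: rescale_def)
      then have "(+) v ` \<Lambda> = (+) w ` \<Lambda>" using xy(3) injr by (simp add: coset)
      then show "x = y" using vw W(4) by (auto simp: inj_on_def)
    qed
    have "rescale c P = (\<Union>v\<in>W. (+) (c *\<^sub>R v) ` rescale c \<Lambda>)"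
      unfolding W(5) coset by (simp add: rescale_def image_UN)
    then show "rescale c P = (\<Union>v\<in>rescale c W. (+) v ` rescale c \<Lambda>)"
      by (simp add: rescale_def)
  qed (use W in \<open>auto simp: rescale_def\<close>)
qed

lemma card_rescale: "c > 0 \<Longrightarrow> card (rescale c W) = card W"
  unfolding rescale_def by (rule card_image) (auto simp: inj_on_def)

lemma unit_density_rescaling_eq:
  fixes P :: "'a::euclidean_space set"
  assumes c: "c > 0" and P: "presentation \<Lambda> W P" and cd: "c ^ DIM('a) = particle_density P"
  shows "unit_density_rescaling P = rescale c P"
proof -
  have L: "is_lattice \<Lambda>" using P by (simp add: presentation_def)
  have "particle_density (rescale e P) = particle_density P / e ^ DIM('a)" if "e > 0" for e
    using particle_density_eq[OF presentation_rescale[OF that P]] particle_density_eq[OF P]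
    by (simp add: card_rescale that covolume_rescale L)
  then have "e > 0 \<and> particle_density (rescale e P) = 1 \<longleftrightarrow> e = c" for e
    using c power_eq_iff_eq_base[of "DIM('a)" e c] by (auto simp: cd[symmetric])
  then have "(THE e. e > 0 \<and> particle_density (rescale e P) = 1) = c" by simp
  then show ?thesis by (simp add: unit_density_rescaling_def)
qed

text \<open>Rescaling a configuration by \<open>c\<close> rescales its structure factor by \<open>1 / c\<close>.\<close>

lemma stealth_radius_unit_density:
  fixes P :: "'a::euclidean_space set"
  assumes c: "c > 0" and P: "presentation \<Lambda> W P" and cd: "c ^ DIM('a) = particle_density P"
    and low: "\<And>\<xi>. \<xi> \<in> dual_lattice \<Lambda> \<Longrightarrow> \<xi> \<noteq> 0 \<Longrightarrow> phase_average W \<xi> \<noteq> 0 \<Longrightarrow> r \<le> norm \<xi>"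
    and att: "\<xi>0 \<in> dual_lattice \<Lambda>" "\<xi>0 \<noteq> 0" "phase_average W \<xi>0 \<noteq> 0" "norm \<xi>0 = r"
  shows "stealth_radius (unit_density_rescaling P) = r / c"
  unfolding unit_density_rescaling_eq[OF c P cd]
proof (rule stealth_radius_eqI[OF presentation_rescale[OF c P]])
  have dual: "\<xi> \<in> dual_lattice (rescale c \<Lambda>) \<longleftrightarrow> c *\<^sub>R \<xi> \<in> dual_lattice \<Lambda>" for \<xi>
    by (auto simp: dual_lattice_def rescale_def)
  have phase: "phase_average (rescale c W) \<xi> = phase_average W (c *\<^sub>R \<xi>)" for \<xi>
    unfolding phase_average_def card_rescale[OF c] unfolding rescale_def
    using c by (subst sum.reindex) (auto simp: inj_on_def)
  show "\<exists>\<xi>. \<xi> \<in> dual_lattice (rescale c \<Lambda>) \<and> \<xi> \<noteq> 0 \<and> phase_average (rescale c W) \<xi> \<noteq> 0 \<and> norm \<xi> = r / c"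
    using c att by (intro exI[of _ "(1 / c) *\<^sub>R \<xi>0"]) (simp add: dual phase)
  fix \<xi> assume "\<xi> \<in> dual_lattice (rescale c \<Lambda>)" "\<xi> \<noteq> 0" "phase_average (rescale c W) \<xi> \<noteq> 0"
  then have "r \<le> norm (c *\<^sub>R \<xi>)" using c by (intro low) (auto simp: dual phase)
  then show "r / c \<le> norm \<xi>" using c by (simp add: field_simps)
qed


section \<open>Binary linear codes as families of sets\<close>

text \<open>The character of the group of subsets under symmetric difference that belongs to \<open>A\<close>.\<close>

definition parity_sign :: "'n set \<Rightarrow> 'n set \<Rightarrow> int" where
  "parity_sign A S = (- 1) ^ card (A \<inter> S)"

definition linear_code :: "'n set \<Rightarrow> 'n set set \<Rightarrow> bool" where
  "linear_code X D \<longleftrightarrow> finite X \<and> D \<subseteq> Pow X \<and> {} \<in> D \<and> (\<forall>S\<in>D. \<forall>T\<in>D. sym_diff S T \<in> D)"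

definition dual_code :: "'n set \<Rightarrow> 'n set set \<Rightarrow> 'n set set" where
  "dual_code X D = {T. T \<subseteq> X \<and> (\<forall>S\<in>D. even (card (S \<inter> T)))}"

lemma card_sym_diff:
  assumes "finite S" "finite T"
  shows "card (sym_diff S T) + 2 * card (S \<inter> T) = card S + card T"
proof -
  have "card (sym_diff S T) = card (S - T) + card (T - S)"
    using assms by (intro card_Un_disjoint) auto
  moreover have "card S = card (S - T) + card (S \<inter> T)" "card T = card (T - S) + card (S \<inter> T)"
    using assms by (subst card_Un_disjoint[symmetric]; auto intro!: arg_cong[of _ _ card])+
  ultimately show ?thesis by simp
qed

lemma parity_sign_sym_diff:
  assumes "finite S" "finite T"
  shows "parity_sign A (sym_diff S T) = parity_sign A S * parity_sign A T"
proof -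
  have eq: "A \<inter> sym_diff S T = sym_diff (A \<inter> S) (A \<inter> T)" by auto
  have "card (A \<inter> sym_diff S T) + 2 * card (A \<inter> S \<inter> (A \<inter> T)) = card (A \<inter> S) + card (A \<inter> T)"
    unfolding eq by (rule card_sym_diff) (use assms in auto)
  then have "(- 1 :: int) ^ (card (A \<inter> sym_diff S T) + 2 * card (A \<inter> S \<inter> (A \<inter> T))) = (- 1) ^ (card (A \<inter> S) + card (A \<inter> T))"
    by (rule arg_cong)
  then show ?thesis by (simp add: parity_sign_def power_add)
qed

lemma parity_sign_values: "parity_sign A S = (if even (card (A \<inter> S)) then 1 else - 1)"
  by (simp add: parity_sign_def)

lemma sum_parity_sign_code:
  assumes D: "linear_code X D" and T: "T \<subseteq> X"
  shows "(\<Sum>S\<in>D. parity_sign T S) = (if T \<in> dual_code X D then int (card D) else 0)"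
proof (cases "T \<in> dual_code X D")
  case True
  then show ?thesis by (simp add: parity_sign_values dual_code_def Int_commute)
next
  case False
  then obtain S0 where S0: "S0 \<in> D" "odd (card (S0 \<inter> T))" using T by (auto simp: dual_code_def)
  have fin: "finite S" if "S \<in> D" for S
    using D that finite_subset by (auto simp: linear_code_def)
  have bij: "bij_betw (\<lambda>S. sym_diff S S0) D D"
    by (rule bij_betwI[where g = "\<lambda>S. sym_diff S S0"]) (use D S0 in \<open>auto simp: linear_code_def\<close>)
  have "(\<Sum>S\<in>D. parity_sign T S) = (\<Sum>S\<in>D. parity_sign T (sym_diff S S0))"
    by (rule sum.reindex_bij_betw[OF bij, symmetric])
  also have "\<dots> = (\<Sum>S\<in>D. - parity_sign T S)"
    using S0 fin by (intro sum.cong refl) (simp add: parity_sign_sym_diff parity_sign_values[of T S0] Int_commute)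
  finally have "(\<Sum>S\<in>D. parity_sign T S) = - (\<Sum>S\<in>D. parity_sign T S)" by (simp add: sum_negf)
  then show ?thesis using False by simp
qed

lemma linear_code_Pow: "finite X \<Longrightarrow> linear_code X (Pow X)"
  by (auto simp: linear_code_def)

lemma dual_code_Pow: "dual_code X (Pow X) = {{}}"
proof -
  have "T = {}" if "T \<subseteq> X" "\<forall>S\<in>Pow X. even (card (S \<inter> T))" for T
  proof (rule ccontr)
    assume "T \<noteq> {}"
    then obtain a where "a \<in> T" by auto
    then have "{a} \<in> Pow X" "card ({a} \<inter> T) = 1" using that by auto
    with that(2) show False by (metis odd_one)
  qed
  then show ?thesis by (auto simp: dual_code_def)
qed

lemma sum_parity_sign_Pow:
  assumes "finite X" "T \<subseteq> X" "T \<noteq> {}"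
  shows "(\<Sum>S\<in>Pow X. parity_sign T S) = 0"
  using sum_parity_sign_code[OF linear_code_Pow[OF assms(1)] assms(2)] assms(3)
  by (simp add: dual_code_Pow)

lemma linear_dual_code:
  assumes "finite X" shows "linear_code X (dual_code X D)"
proof -
  have "even (card (S \<inter> sym_diff T U))" if "T \<subseteq> X" "U \<subseteq> X" "even (card (S \<inter> T))" "even (card (S \<inter> U))" for S T U
    using parity_sign_sym_diff[of T U S] that assms finite_subset[of _ X]
    by (simp add: parity_sign_values split: if_splits)
  then show ?thesis using assms by (auto simp: linear_code_def dual_code_def)
qed

text \<open>The signs are summed over all pairs of a codeword and a subset of \<open>X\<close>, in both orders.\<close>

lemma card_code_mult_dual:
  assumes D: "linear_code X D"
  shows "card D * card (dual_code X D) = 2 ^ card X"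
proof -
  have fX: "finite X" and fD: "finite D" and DX: "D \<subseteq> Pow X"
    using D finite_subset[of D "Pow X"] by (auto simp: linear_code_def)
  have "(\<Sum>T\<in>Pow X. \<Sum>S\<in>D. parity_sign T S) = (\<Sum>T\<in>Pow X. if T \<in> dual_code X D then int (card D) else 0)"
    by (intro sum.cong refl) (auto simp: sum_parity_sign_code[OF D])
  also have "\<dots> = int (card D * card (dual_code X D))"
  proof -
    have "Pow X \<inter> {T. T \<in> dual_code X D} = dual_code X D" by (auto simp: dual_code_def)
    then show ?thesis using fX by (simp add: sum.If_cases mult.commute)
  qed
  finally have 1: "(\<Sum>T\<in>Pow X. \<Sum>S\<in>D. parity_sign T S) = int (card D * card (dual_code X D))" .
  have "(\<Sum>T\<in>Pow X. \<Sum>S\<in>D. parity_sign T S) = (\<Sum>S\<in>D. \<Sum>T\<in>Pow X. parity_sign S T)"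
    by (subst sum.swap) (simp add: parity_sign_def Int_commute)
  also have "\<dots> = (\<Sum>S\<in>D. if S = {} then 2 ^ card X else 0)"
  proof (intro sum.cong refl)
    fix S assume "S \<in> D"
    then show "(\<Sum>T\<in>Pow X. parity_sign S T) = (if S = {} then 2 ^ card X else 0)"
      using sum_parity_sign_Pow[OF fX, of S] DX fX by (auto simp: parity_sign_def card_Pow)
  qed
  also have "\<dots> = 2 ^ card X" using fD D by (simp add: linear_code_def)
  finally have "int (card D * card (dual_code X D)) = int (2 ^ card X)" using 1 by simp
  then show ?thesis by (simp only: of_nat_eq_iff)
qed

lemma dual_dual_code:
  assumes D: "linear_code X D"
  shows "dual_code X (dual_code X D) = D"
proof -
  have fX: "finite X" using D by (simp add: linear_code_def)
  have "D \<subseteq> dual_code X (dual_code X D)"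
    using D by (auto simp: linear_code_def dual_code_def Int_commute)
  moreover have "finite (dual_code X (dual_code X D))"
    by (rule finite_subset[of _ "Pow X"]) (use fX in \<open>auto simp: dual_code_def\<close>)
  moreover have "card D = card (dual_code X (dual_code X D))"
    using card_code_mult_dual[OF D] card_code_mult_dual[OF linear_dual_code[OF fX, of D]]
    by (metis mult.commute mult_cancel_left power_not_zero zero_neq_numeral mult_eq_0_iff)
  ultimately show ?thesis using card_subset_eq by metis
qed

section \<open>The extended Golay code is self-dual and doubly even\<close>

text \<open>The value on weight \<open>t\<close> of the Fourier transform of the Hamming ball of radius 3 in 23 coordinates:
  \<open>k\<close> points of the subset lie inside, and \<open>l\<close> outside, a fixed set of size \<open>t\<close>.\<close>

definition lloyd :: "nat \<Rightarrow> int" where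
  "lloyd t = (\<Sum>k\<le>3. \<Sum>l\<le>3. if k + l \<le> 3 then (- 1) ^ k * int (t choose k) * int ((23 - t) choose l) else 0)"

lemma sum_Pow_card:
  fixes h :: "nat \<Rightarrow> int"
  assumes "finite A" "\<And>k. k > 3 \<Longrightarrow> h k = 0"
  shows "(\<Sum>P\<in>Pow A. h (card P)) = (\<Sum>k\<le>3. int (card A choose k) * h k)"
proof -
  have "(\<Sum>P\<in>Pow A. h (card P)) = (\<Sum>k\<le>card A. \<Sum>P\<in>{P \<in> Pow A. card P = k}. h (card P))"
    using assms(1) by (intro sum.group[symmetric]) (auto intro: card_mono)
  also have "\<dots> = (\<Sum>k\<le>card A. int (card A choose k) * h k)"
    using assms(1) by (intro sum.cong refl) (simp add: n_subsets)
  also have "\<dots> = (\<Sum>k\<le>max 3 (card A). int (card A choose k) * h k)"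
    by (intro sum.mono_neutral_left) auto
  also have "\<dots> = (\<Sum>k\<le>3. int (card A choose k) * h k)"
    using assms(2) by (intro sum.mono_neutral_right) auto
  finally show ?thesis .
qed

lemma sum_parity_sign_ball:
  assumes Y: "finite Y" "card Y = 23" and T: "T \<subseteq> Y"
  shows "(\<Sum>R\<in>{R. R \<subseteq> Y \<and> card R \<le> 3}. parity_sign T R) = lloyd (card T)"
proof -
  have fin: "finite T" "finite (Y - T)" using Y T finite_subset by auto
  have cY: "card (Y - T) = 23 - card T" using Y T fin by (simp add: card_Diff_subset)
  have inj: "inj_on (\<lambda>(P, Q). P \<union> Q) (Pow T \<times> Pow (Y - T))"
    by (auto simp: inj_on_def)
  have img: "(\<lambda>(P, Q). P \<union> Q) ` (Pow T \<times> Pow (Y - T)) = Pow Y"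
  proof (intro equalityI subsetI)
    fix R assume "R \<in> Pow Y"
    then show "R \<in> (\<lambda>(P, Q). P \<union> Q) ` (Pow T \<times> Pow (Y - T))"
      by (intro image_eqI[of _ _ "(R \<inter> T, R - T)"]) auto
  qed (use T in auto)
  have "(\<Sum>R\<in>{R. R \<subseteq> Y \<and> card R \<le> 3}. parity_sign T R) = (\<Sum>R\<in>Pow Y. if card R \<le> 3 then parity_sign T R else 0)"
    using Y by (simp add: sum.If_cases Pow_def Int_def)
  also have "\<dots> = (\<Sum>(P, Q)\<in>Pow T \<times> Pow (Y - T). if card (P \<union> Q) \<le> 3 then parity_sign T (P \<union> Q) else 0)"
    unfolding img[symmetric] by (subst sum.reindex[OF inj]) (simp add: case_prod_unfold)
  also have "\<dots> = (\<Sum>P\<in>Pow T. \<Sum>Q\<in>Pow (Y - T). if card P + card Q \<le> 3 then (- 1) ^ card P else 0)"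
    unfolding sum.cartesian_product[symmetric]
  proof (intro sum.cong refl)
    fix P Q assume PQ: "P \<in> Pow T" "Q \<in> Pow (Y - T)"
    then have "finite P" "finite Q" using fin by (auto intro: finite_subset)
    moreover have "P \<inter> Q = {}" using PQ by auto
    ultimately have "card (P \<union> Q) = card P + card Q" by (rule card_Un_disjoint)
    moreover have "T \<inter> (P \<union> Q) = P" using PQ by auto
    ultimately show "(if card (P \<union> Q) \<le> 3 then parity_sign T (P \<union> Q) else 0) = (if card P + card Q \<le> 3 then (- 1) ^ card P else 0)"
      by (simp add: parity_sign_def)
  qed
  also have "\<dots> = (\<Sum>P\<in>Pow T. \<Sum>l\<le>3. int ((23 - card T) choose l) * (if card P + l \<le> 3 then (- 1) ^ card P else 0))"
  proof (intro sum.cong refl)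
    fix P
    show "(\<Sum>Q\<in>Pow (Y - T). if card P + card Q \<le> 3 then (- 1) ^ card P else 0)
        = (\<Sum>l\<le>3. int ((23 - card T) choose l) * (if card P + l \<le> 3 then (- 1) ^ card P else 0))"
      using sum_Pow_card[OF fin(2), of "\<lambda>l. if card P + l \<le> 3 then (- 1) ^ card P else 0"] by (simp add: cY)
  qed
  also have "\<dots> = (\<Sum>k\<le>3. int (card T choose k) * (\<Sum>l\<le>3. int ((23 - card T) choose l) * (if k + l \<le> 3 then (- 1) ^ k else 0)))"
    by (rule sum_Pow_card[OF fin(1)]) auto
  also have "\<dots> = lloyd (card T)"
    unfolding lloyd_def sum_distrib_left by (intro sum.cong refl) auto
  finally show ?thesis .
qed

lemma choose_2_int: "2 * int (n choose 2) = int n * (int n - 1)"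
  by (induction n) (simp_all add: numeral_2_eq_2 algebra_simps)

lemma choose_3_int: "6 * int (n choose 3) = int n * (int n - 1) * (int n - 2)"
proof (induction n)
  case (Suc n)
  have "Suc n choose 3 = (n choose 2) + (n choose 3)" by (simp add: numeral_3_eq_3 numeral_2_eq_2)
  then have "6 * int (Suc n choose 3) = 3 * (2 * int (n choose 2)) + 6 * int (n choose 3)" by simp
  then show ?case unfolding choose_2_int Suc by (simp add: algebra_simps)
qed (simp add: numeral_3_eq_3)

lemma lloyd_factorization:
  assumes "t \<le> 23"
  shows "3 * lloyd t = - 4 * (int t - 8) * (int t - 12) * (int t - 16)"
proof -
  define n where "n = 23 - t"
  have n: "int n = 23 - int t" using assms by (simp add: n_def)
  have "{..3::nat} = {0, 1, 2, 3}" by auto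
  then have "lloyd t = (1 + int n + int (n choose 2) + int (n choose 3))
      - int t * (1 + int n + int (n choose 2)) + int (t choose 2) * (1 + int n) - int (t choose 3)"
    by (simp add: lloyd_def n_def[symmetric] algebra_simps)
  then have "6 * lloyd t = 6 + 6 * int n + 3 * (2 * int (n choose 2)) + 6 * int (n choose 3)
      - int t * (6 + 6 * int n + 3 * (2 * int (n choose 2))) + 3 * (2 * int (t choose 2)) * (1 + int n) - 6 * int (t choose 3)"
    by (simp add: algebra_simps)
  then show ?thesis
    unfolding choose_2_int choose_3_int n by (simp add: algebra_simps)
qed

definition shortened :: "'n set set \<Rightarrow> 'n set \<Rightarrow> 'n set set" where
  "shortened C X = {S \<in> C. S \<subseteq> X}"

definition punctured :: "'n set set \<Rightarrow> 'n set \<Rightarrow> 'n set set" where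
  "punctured C X = (\<lambda>S. S \<inter> X) ` C"

context
  fixes C :: "'n::finite set set"
  assumes C: "extended_golay_code C"
begin

lemma golay_linear: "linear_code UNIV C"
  using C by (simp add: extended_golay_code_def linear_code_def)

lemma golay_card: "card C = 2 ^ 12" and golay_length: "CARD('n) = 24"
  using C by (simp_all add: extended_golay_code_def)

lemma golay_min_weight:
  assumes "S \<in> C" "S \<noteq> {}" shows "card S \<ge> 8"
proof -
  have "Min (card ` (C - {{}})) \<le> card S" using assms by (intro Min_le) auto
  then show ?thesis using C by (simp add: extended_golay_code_def)
qed

text \<open>Puncturing at \<open>i\<close> gives a perfect code: the balls of radius 3 around its words are disjoint, and
  they fill the space since \<open>2\<^sup>1\<^sup>2 \<cdot> 2048 = 2\<^sup>2\<^sup>3\<close>. The sum over the space of the character of \<open>T\<close> is 0, and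
  it factors through code and ball; on the code the character is trivial.\<close>

lemma golay_dual_weight:
  assumes T: "T \<in> dual_code UNIV C" "T \<noteq> {}" and i: "i \<notin> T"
  shows "lloyd (card T) = 0"
proof -
  define Y where "Y = UNIV - {i}"
  define Ball where "Ball = {R. R \<subseteq> Y \<and> card R \<le> 3}"
  have Y: "finite Y" "card Y = 23" and TY: "T \<subseteq> Y"
    using golay_length i by (auto simp: Y_def card_Diff_subset)
  have cB: "card Ball = 2048"
    using sum_parity_sign_ball[OF Y, of "{}"] lloyd_factorization[of 0]
    by (simp add: parity_sign_def Ball_def)
  define \<phi> where "\<phi> = (\<lambda>(S, R). sym_diff (S - {i}) R)"
  have inj: "inj_on \<phi> (C \<times> Ball)"
  proof (rule inj_onI)
    fix z z' assume z: "z \<in> C \<times> Ball" "z' \<in> C \<times> Ball" "\<phi> z = \<phi> z'"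
    obtain S R S' R' where zz: "z = (S, R)" "z' = (S', R')" by fastforce
    have eq: "sym_diff (S - {i}) R = sym_diff (S' - {i}) R'" using z zz by (simp add: \<phi>_def)
    have "sym_diff S S' \<subseteq> R \<union> R' \<union> {i}"
    proof
      fix x assume "x \<in> sym_diff S S'"
      moreover have "x \<in> sym_diff (S - {i}) R \<longleftrightarrow> x \<in> sym_diff (S' - {i}) R'" using eq by simp
      ultimately show "x \<in> R \<union> R' \<union> {i}" by blast
    qed
    then have "card (sym_diff S S') \<le> card (R \<union> R' \<union> {i})" by (intro card_mono) auto
    also have "\<dots> \<le> card R + card R' + 1"
      by (rule order_trans[OF card_Un_le]) (simp add: card_Un_le)
    also have "\<dots> \<le> 7" using z zz by (auto simp: Ball_def)
    finally have "card (sym_diff S S') < 8" by simp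
    moreover have "sym_diff S S' \<in> C" using z zz golay_linear by (auto simp: linear_code_def)
    ultimately have "sym_diff S S' = {}" using golay_min_weight by (meson not_less)
    then have SS: "S = S'" by blast
    have "R = R'"
    proof (rule set_eqI)
      fix x
      have "x \<in> sym_diff (S - {i}) R \<longleftrightarrow> x \<in> sym_diff (S' - {i}) R'" using eq by simp
      then show "x \<in> R \<longleftrightarrow> x \<in> R'" using SS by blast
    qed
    then show "z = z'" using SS zz by simp
  qed
  have img: "\<phi> ` (C \<times> Ball) = Pow Y"
  proof (rule card_subset_eq)
    show "\<phi> ` (C \<times> Ball) \<subseteq> Pow Y" by (auto simp: \<phi>_def Ball_def Y_def)
    show "card (\<phi> ` (C \<times> Ball)) = card (Pow Y)"
      using Y cB golay_card by (simp add: card_image[OF inj] card_cartesian_product card_Pow)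
  qed (use Y in simp)
  have "0 = (\<Sum>Z\<in>Pow Y. parity_sign T Z)"
    using sum_parity_sign_Pow[OF Y(1) TY T(2)] by simp
  also have "\<dots> = (\<Sum>z\<in>C \<times> Ball. parity_sign T (\<phi> z))"
    unfolding img[symmetric] by (simp add: sum.reindex[OF inj])
  also have "\<dots> = (\<Sum>(S, R)\<in>C \<times> Ball. parity_sign T R)"
  proof (rule sum.cong[OF refl])
    fix z assume "z \<in> C \<times> Ball"
    then obtain S R where z: "z = (S, R)" "S \<in> C" "R \<in> Ball" by auto
    have "T \<inter> (S - {i}) = S \<inter> T" using i by auto
    then have "parity_sign T (S - {i}) = 1" using T z by (simp add: parity_sign_values dual_code_def)
    then show "parity_sign T (\<phi> z) = (case z of (S, R) \<Rightarrow> parity_sign T R)"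
      using parity_sign_sym_diff[of "S - {i}" R T] by (simp add: z \<phi>_def)
  qed
  also have "\<dots> = (\<Sum>S\<in>C. \<Sum>R\<in>Ball. parity_sign T R)"
    by (rule sum.cartesian_product[symmetric])
  also have "\<dots> = 2 ^ 12 * lloyd (card T)"
    using sum_parity_sign_ball[OF Y TY] golay_card by (simp add: Ball_def)
  finally show ?thesis by simp
qed

lemma golay_dual_doubly_even:
  assumes T: "T \<in> dual_code UNIV C" shows "4 dvd card T"
proof (cases "T = {} \<or> T = UNIV")
  case True
  then show ?thesis using golay_length by auto
next
  case False
  then obtain i where i: "i \<notin> T" by auto
  have "card T < CARD('n)" using i by (intro psubset_card_mono) auto
  then have "card T = 8 \<or> card T = 12 \<or> card T = 16"
    using golay_dual_weight[OF T _ i] False lloyd_factorization[of "card T"] golay_length by auto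
  then show ?thesis by auto
qed

text \<open>A doubly even linear code is self-orthogonal; by cardinality it then equals its dual.\<close>

lemma golay_self_dual: "dual_code UNIV C = C"
proof -
  let ?D = "dual_code UNIV C"
  have lin: "linear_code UNIV ?D" by (rule linear_dual_code) simp
  have "even (card (S \<inter> T))" if "S \<in> ?D" "T \<in> ?D" for S T
  proof -
    have "sym_diff S T \<in> ?D" using lin that by (auto simp: linear_code_def)
    from golay_dual_doubly_even[OF this] golay_dual_doubly_even[OF that(1)] golay_dual_doubly_even[OF that(2)]
    show ?thesis using card_sym_diff[of S T] by (simp add: dvd_def) presburger
  qed
  then have "?D \<subseteq> dual_code UNIV ?D" by (auto simp: dual_code_def)
  then have sub: "?D \<subseteq> C" by (simp add: dual_dual_code[OF golay_linear])
  have "2 ^ 12 * card ?D = (2 ^ 12 * 2 ^ 12 :: nat)"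
    using card_code_mult_dual[OF golay_linear] golay_card golay_length by simp
  then have "card ?D = card C" using golay_card by simp
  with sub show ?thesis by (intro card_subset_eq) auto
qed

lemma golay_doubly_even: "S \<in> C \<Longrightarrow> 4 dvd card S"
  using golay_dual_doubly_even golay_self_dual by simp

lemma golay_orthogonal: "S \<in> C \<Longrightarrow> T \<in> C \<Longrightarrow> even (card (S \<inter> T))"
  using golay_self_dual by (auto simp: dual_code_def)

lemma linear_punctured: "linear_code X (punctured C X)"
proof -
  have "sym_diff (S \<inter> X) (T \<inter> X) \<in> punctured C X" if "S \<in> C" "T \<in> C" for S T
    unfolding punctured_def using golay_linear that
    by (intro image_eqI[of _ _ "sym_diff S T"]) (auto simp: linear_code_def)
  moreover have "{} \<in> punctured C X" using golay_linear by (force simp: punctured_def linear_code_def)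
  ultimately show ?thesis by (auto simp: linear_code_def punctured_def)
qed

lemma dual_punctured: "dual_code X (punctured C X) = shortened C X"
proof -
  have "T \<in> dual_code X (punctured C X) \<longleftrightarrow> T \<subseteq> X \<and> T \<in> dual_code UNIV C" for T
    by (auto simp: dual_code_def punctured_def Int_assoc Int_absorb1)
  then show ?thesis by (auto simp: golay_self_dual shortened_def)
qed

lemma dual_shortened: "dual_code X (shortened C X) = punctured C X"
  using dual_dual_code[OF linear_punctured, of X] by (simp add: dual_punctured)

text \<open>Fewer than 8 coordinates of a codeword can be prescribed, since no nonzero word of the dual
  code, which is the code itself, is supported on them.\<close>

lemma punctured_small:
  assumes "card X < 8" shows "punctured C X = Pow X"
proof -
  have "shortened C X = {{}}"
  proof -
    have "S = {}" if "S \<in> C" "S \<subseteq> X" for S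
      using golay_min_weight[OF that(1)] card_mono[OF _ that(2)] assms by fastforce
    then show ?thesis using golay_linear by (auto simp: shortened_def linear_code_def)
  qed
  then have "dual_code X {{}} = punctured C X" using dual_shortened[of X] by simp
  then show ?thesis by (auto simp: dual_code_def)
qed

lemma card_punctured_large:
  assumes "card (- X) < 8" shows "card (punctured C X) = 2 ^ 12"
proof -
  have "inj_on (\<lambda>S. S \<inter> X) C"
  proof (rule inj_onI)
    fix S T assume ST: "S \<in> C" "T \<in> C" "S \<inter> X = T \<inter> X"
    have "sym_diff S T \<subseteq> - X" using ST(3) by blast
    then have "card (sym_diff S T) < 8" using card_mono[of "- X" "sym_diff S T"] assms by simp
    moreover have "sym_diff S T \<in> C" using ST golay_linear by (auto simp: linear_code_def)
    ultimately have "sym_diff S T = {}" using golay_min_weight by (meson not_less)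
    then show "S = T" by blast
  qed
  then show ?thesis by (simp add: punctured_def card_image golay_card)
qed

end


section \<open>Integer coordinates for the Leech lattice\<close>

text \<open>Vectors over any finite index set, in the coordinates that carry the factor \<open>1 / sqrt 8\<close>; the index
  types 4, 20 and their sum all occur.\<close>

definition leech_vec :: "('k::finite \<Rightarrow> int) \<Rightarrow> real ^ 'k" where
  "leech_vec x = (1 / sqrt 8) *\<^sub>R (\<chi> i. real_of_int (x i))"

lemma leech_vec_nth [simp]: "leech_vec x $ i = real_of_int (x i) / sqrt 8"
  by (simp add: leech_vec_def)

lemma leech_vec_inner: "leech_vec x \<bullet> leech_vec y = real_of_int (\<Sum>i\<in>UNIV. x i * y i) / 8"
  by (simp add: inner_vec_def sum_divide_distrib)

lemma leech_vec_diff: "leech_vec x - leech_vec y = leech_vec (\<lambda>i. x i - y i)"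
  by (simp add: vec_eq_iff diff_divide_distrib)

lemma leech_vec_eq_iff [simp]: "leech_vec x = leech_vec y \<longleftrightarrow> x = y"
  by (auto simp: vec_eq_iff)

lemma leech_vec_zero: "leech_vec (\<lambda>_. 0) = 0"
  by (simp add: vec_eq_iff)

lemma norm_leech_vec: "(norm (leech_vec x))\<^sup>2 = real_of_int (\<Sum>i\<in>UNIV. (x i)\<^sup>2) / 8"
  unfolding power2_norm_eq_inner leech_vec_inner by (simp add: power2_eq_square)

lemma proj_U_leech_vec [simp]: "proj_U (leech_vec x) = leech_vec (x \<circ> Inl)"
  by (simp add: proj_U_def vec_eq_iff)

lemma proj_V_leech_vec [simp]: "proj_V (leech_vec x) = leech_vec (x \<circ> Inr)"
  by (simp add: proj_V_def vec_eq_iff)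

lemma proj_diff: "proj_U (v - w) = proj_U v - proj_U w" "proj_V (v - w) = proj_V v - proj_V w"
  by (simp_all add: proj_U_def proj_V_def vec_eq_iff)

lemma proj_add: "proj_U (v + w) = proj_U v + proj_U w" "proj_V (v + w) = proj_V v + proj_V w"
  by (simp_all add: proj_U_def proj_V_def vec_eq_iff)

lemma proj_zero: "proj_U 0 = 0" "proj_V 0 = 0"
  by (simp_all add: proj_U_def proj_V_def vec_eq_iff)

lemma sum_idx: "(\<Sum>i\<in>(UNIV :: idx set). f i) = (\<Sum>i\<in>UNIV. f (Inl i)) + (\<Sum>j\<in>UNIV. f (Inr j))"
proof -
  have "(\<Sum>i\<in>(UNIV :: idx set). f i) = sum f (UNIV <+> UNIV)" by simp
  also have "\<dots> = (\<Sum>i\<in>UNIV. f (Inl i)) + (\<Sum>j\<in>UNIV. f (Inr j))"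
    by (subst sum.Plus) (simp_all del: UNIV_Plus_UNIV)
  finally show ?thesis .
qed

text \<open>Coordinates \<open>a\<close> of the vector with entries \<open>m + 2 a\<^sub>i\<close>. Unlike in the definition of the lattice,
  \<open>m\<close> is an arbitrary integer; this makes closure under subtraction immediate.\<close>

definition leech_coord :: "idx set set \<Rightarrow> int \<Rightarrow> (idx \<Rightarrow> int) \<Rightarrow> bool" where
  "leech_coord C m a \<longleftrightarrow> 4 dvd (\<Sum>i\<in>UNIV. a i) + 2 * m \<and> {i. odd (a i)} \<in> C"

text \<open>The section of the Leech lattice by \<open>U\<close> in integer coordinates, a scaled \<open>D\<^sub>4\<close> lattice.\<close>

definition in_section_U :: "(4 \<Rightarrow> int) \<Rightarrow> bool" where
  "in_section_U u \<longleftrightarrow> (\<forall>i. 4 dvd u i) \<and> 8 dvd (\<Sum>i\<in>UNIV. u i)"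

lemma even_sum_odd_set: "even (\<Sum>i\<in>(UNIV::'k::finite set). (a i :: int)) \<longleftrightarrow> even (card {i. odd (a i)})"
  by (subst even_sum_iff) simp_all

context
  fixes C :: "idx set set"
  assumes C: "extended_golay_code C"
begin

lemma golay_even: "S \<in> C \<Longrightarrow> even (card S)"
  using golay_doubly_even[OF C, of S] by presburger

lemma UNIV_in_golay: "UNIV \<in> C"
proof -
  have "UNIV \<in> dual_code UNIV C"
    using golay_even by (auto simp: dual_code_def)
  then show ?thesis by (simp add: golay_self_dual[OF C])
qed

lemma golay_sym_diff: "S \<in> C \<Longrightarrow> T \<in> C \<Longrightarrow> sym_diff S T \<in> C"
  using golay_linear[OF C] by (auto simp: linear_code_def)

lemma golay_empty: "{} \<in> C"
  using golay_linear[OF C] by (auto simp: linear_code_def)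

text \<open>Shifting \<open>a\<close> by an odd number complements its set of odd entries, and the complement of a
  codeword is a codeword because the all-ones word lies in the code.\<close>

lemma leech_coord_shift:
  assumes "leech_coord C m a"
  shows "leech_coord C (m - 2 * k) (\<lambda>i. a i + k)"
proof -
  have "(\<Sum>i\<in>UNIV. a i + k) + 2 * (m - 2 * k) = (\<Sum>i\<in>UNIV. a i) + 2 * m + 4 * (5 * k)"
    by (simp add: sum.distrib)
  moreover have "4 dvd (\<Sum>i\<in>UNIV. a i) + 2 * m" using assms by (simp add: leech_coord_def)
  ultimately have "4 dvd (\<Sum>i\<in>UNIV. a i + k) + 2 * (m - 2 * k)" by (metis dvd_add dvd_triv_left)
  moreover have "{i. odd (a i + k)} \<in> C"
  proof (cases "even k")
    case True
    then show ?thesis using assms by (simp add: leech_coord_def)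
  next
    case False
    then have "{i. odd (a i + k)} = sym_diff UNIV {i. odd (a i)}" by auto
    then show ?thesis using golay_sym_diff[OF UNIV_in_golay, of "{i. odd (a i)}"] assms
      by (simp add: leech_coord_def)
  qed
  ultimately show ?thesis by (simp add: leech_coord_def)
qed

lemma leech_coord_normalize:
  assumes "leech_coord C m0 a0" "w = leech_vec (\<lambda>i. m0 + 2 * a0 i)"
  obtains m a where "m \<in> {0, 1}" "leech_coord C m a" "w = leech_vec (\<lambda>i. m + 2 * a i)"
proof (rule that)
  have m: "m0 mod 2 = m0 - 2 * (m0 div 2)" by (simp add: minus_mult_div_eq_mod)
  show "m0 mod 2 \<in> {0, 1}" by auto
  show "leech_coord C (m0 mod 2) (\<lambda>i. a0 i + m0 div 2)" unfolding m by (rule leech_coord_shift[OF assms(1)])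
  show "w = leech_vec (\<lambda>i. m0 mod 2 + 2 * (a0 i + m0 div 2))" unfolding m by (simp add: assms(2))
qed

lemma leech_iff: "w \<in> leech_lattice C \<longleftrightarrow> (\<exists>m a. leech_coord C m a \<and> w = leech_vec (\<lambda>i. m + 2 * a i))"
proof
  assume "w \<in> leech_lattice C"
  then obtain x m where x: "w = leech_vec x" "\<forall>i. [x i = m] (mod 2)" "[(\<Sum>i\<in>UNIV. x i) = 4 * m] (mod 8)"
    "{i. odd ((x i - m) div 2)} \<in> C"
    by (auto simp: leech_lattice_def leech_vec_def)
  define a where "a i = (x i - m) div 2" for i
  have "x i = m + 2 * a i" for i
  proof -
    have "2 dvd x i - m" using x(2) by (simp add: cong_iff_dvd_diff)
    then show ?thesis by (simp add: a_def)
  qed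
  then have xa: "x = (\<lambda>i. m + 2 * a i)" by auto
  have "8 dvd (\<Sum>i\<in>UNIV. m + 2 * a i) - 4 * m" using x(3) by (simp add: cong_iff_dvd_diff xa)
  also have "(\<Sum>i\<in>UNIV. m + 2 * a i) - 4 * m = 2 * ((\<Sum>i\<in>UNIV. a i) + 2 * m) + 8 * (2 * m)"
    by (simp add: sum.distrib sum_distrib_left)
  finally have "4 dvd (\<Sum>i\<in>UNIV. a i) + 2 * m" by presburger
  then have "leech_coord C m a" using x(4) by (simp add: leech_coord_def a_def)
  with x(1) xa show "\<exists>m a. leech_coord C m a \<and> w = leech_vec (\<lambda>i. m + 2 * a i)" by blast
next
  assume "\<exists>m a. leech_coord C m a \<and> w = leech_vec (\<lambda>i. m + 2 * a i)"
  then obtain m0 a0 where "leech_coord C m0 a0" "w = leech_vec (\<lambda>i. m0 + 2 * a0 i)" by blast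
  then obtain m a where "m \<in> {0, 1}" and la: "leech_coord C m a" and wa: "w = leech_vec (\<lambda>i. m + 2 * a i)"
    by (rule leech_coord_normalize)
  moreover have "[m + 2 * a i = m] (mod 2)" for i by (simp add: cong_iff_dvd_diff)
  moreover have "[(\<Sum>i\<in>UNIV. m + 2 * a i) = 4 * m] (mod 8)"
  proof -
    have "(\<Sum>i\<in>UNIV. m + 2 * a i) - 4 * m = 2 * ((\<Sum>i\<in>UNIV. a i) + 2 * m) + 8 * (2 * m)"
      by (simp add: sum.distrib sum_distrib_left)
    moreover have "4 dvd (\<Sum>i\<in>UNIV. a i) + 2 * m" using la by (simp add: leech_coord_def)
    ultimately show ?thesis unfolding cong_iff_dvd_diff by presburger
  qed
  moreover have "{i. odd ((m + 2 * a i - m) div 2)} \<in> C" using la by (simp add: leech_coord_def)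
  ultimately show "w \<in> leech_lattice C"
    unfolding leech_lattice_def wa leech_vec_def
    by (intro CollectI exI[of _ "\<lambda>i. m + 2 * a i"] conjI refl bexI[of _ m] allI)
qed

lemma leech_normal_form:
  assumes "w \<in> leech_lattice C"
  obtains m a where "m \<in> {0, 1}" "leech_coord C m a" "w = leech_vec (\<lambda>i. m + 2 * a i)"
proof -
  obtain m a where "leech_coord C m a" "w = leech_vec (\<lambda>i. m + 2 * a i)"
    using assms unfolding leech_iff by blast
  then show ?thesis by (rule leech_coord_normalize) (rule that)
qed

lemma leech_diff:
  assumes "v \<in> leech_lattice C" "w \<in> leech_lattice C"
  shows "v - w \<in> leech_lattice C"
proof -
  obtain m a n b where v: "leech_coord C m a" "v = leech_vec (\<lambda>i. m + 2 * a i)"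
    and w: "leech_coord C n b" "w = leech_vec (\<lambda>i. n + 2 * b i)"
    using assms unfolding leech_iff by blast
  have eq: "(\<Sum>i\<in>UNIV. a i - b i) + 2 * (m - n) = ((\<Sum>i\<in>UNIV. a i) + 2 * m) - ((\<Sum>i\<in>UNIV. b i) + 2 * n)"
    by (simp add: sum_subtractf)
  have "4 dvd (\<Sum>i\<in>UNIV. a i) + 2 * m" "4 dvd (\<Sum>i\<in>UNIV. b i) + 2 * n"
    using v w by (auto simp: leech_coord_def)
  then have "4 dvd (\<Sum>i\<in>UNIV. a i - b i) + 2 * (m - n)" unfolding eq by (rule dvd_diff)
  moreover have "{i. odd (a i - b i)} = sym_diff {i. odd (a i)} {i. odd (b i)}" by auto
  then have "{i. odd (a i - b i)} \<in> C" using v w golay_sym_diff by (simp add: leech_coord_def)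
  ultimately have "leech_coord C (m - n) (\<lambda>i. a i - b i)" by (simp add: leech_coord_def)
  moreover have "v - w = leech_vec (\<lambda>i. (m - n) + 2 * (a i - b i))"
    by (simp add: v w leech_vec_diff algebra_simps)
  ultimately show ?thesis unfolding leech_iff by blast
qed

lemma leech_zero: "0 \<in> leech_lattice C"
  unfolding leech_iff
  by (intro exI[of _ 0] exI[of _ "\<lambda>_. 0"]) (simp add: leech_coord_def golay_empty leech_vec_zero)

lemma leech_add: "v \<in> leech_lattice C \<Longrightarrow> w \<in> leech_lattice C \<Longrightarrow> v + w \<in> leech_lattice C"
  using leech_diff[OF _ leech_diff[OF leech_zero], of v w] by simp

lemma leech_integral:
  assumes "v \<in> leech_lattice C" "w \<in> leech_lattice C"
  shows "v \<bullet> w \<in> \<int>"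
proof -
  obtain m a n b where v: "leech_coord C m a" "v = leech_vec (\<lambda>i. m + 2 * a i)"
    and w: "leech_coord C n b" "w = leech_vec (\<lambda>i. n + 2 * b i)"
    using assms unfolding leech_iff by blast
  obtain s t where st: "(\<Sum>i\<in>UNIV. a i) = 4 * s - 2 * m" "(\<Sum>i\<in>UNIV. b i) = 4 * t - 2 * n"
    using v(1) w(1) unfolding leech_coord_def dvd_def by (metis add_diff_cancel_right')
  have "{i. odd (a i * b i)} = {i. odd (a i)} \<inter> {i. odd (b i)}" by auto
  then have "even (\<Sum>i\<in>UNIV. a i * b i)"
    using golay_orthogonal[OF C, of "{i. odd (a i)}" "{i. odd (b i)}"] v w
    by (simp add: even_sum_odd_set leech_coord_def)
  then obtain r where r: "(\<Sum>i\<in>UNIV. a i * b i) = 2 * r" by blast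
  have "(\<Sum>i\<in>UNIV. (m + 2 * a i) * (n + 2 * b i))
      = 24 * (m * n) + 2 * m * (\<Sum>i\<in>UNIV. b i) + 2 * n * (\<Sum>i\<in>UNIV. a i) + 4 * (\<Sum>i\<in>UNIV. a i * b i)"
  proof -
    have "(m + 2 * a i) * (n + 2 * b i) = m * n + 2 * m * b i + 2 * n * a i + 4 * (a i * b i)" for i
      by (simp add: algebra_simps)
    then show ?thesis by (simp only: sum.distrib sum_distrib_left[symmetric]) simp
  qed
  also have "\<dots> = 8 * (2 * m * n + m * t + n * s + r)"
    unfolding st r by (simp add: algebra_simps)
  finally have "v \<bullet> w = real_of_int (2 * m * n + m * t + n * s + r)"
    unfolding v w leech_vec_inner by simp
  then show ?thesis by simp
qed

text \<open>If the entries are even and not all divisible by 4, at least 8 of them are nonzero. If all are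
  divisible by 4, their sum, a multiple of 8, forces two nonzero entries or one of size 8. If the
  entries are odd, one of them has size at least 3, since entries \<open>\<plusminus>1\<close> alone would require a codeword
  of size 2 modulo 4.\<close>

lemma leech_min_norm:
  assumes w: "w \<in> leech_lattice C" "w \<noteq> 0"
  shows "(norm w)\<^sup>2 \<ge> 4"
proof -
  obtain m a where m01: "m \<in> {0, 1}" and la: "leech_coord C m a" and wa: "w = leech_vec (\<lambda>i. m + 2 * a i)"
    using w(1) by (rule leech_normal_form)
  have sum4: "4 dvd (\<Sum>i\<in>UNIV. a i) + 2 * m" and oC: "{i. odd (a i)} \<in> C"
    using la by (auto simp: leech_coord_def)
  have sq1: "z \<noteq> 0 \<Longrightarrow> z\<^sup>2 \<ge> 1" for z :: int
    using zero_less_power2[of z] by linarith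
  have "(\<Sum>i\<in>UNIV. (m + 2 * a i)\<^sup>2) \<ge> 32"
  proof (cases "m = 0")
    case True
    have eq: "(\<Sum>i\<in>UNIV. (m + 2 * a i)\<^sup>2) = 4 * (\<Sum>i\<in>UNIV. (a i)\<^sup>2)"
      by (simp add: True sum_distrib_left power_mult_distrib)
    have "(\<Sum>i\<in>UNIV. (a i)\<^sup>2) \<ge> 8"
    proof (cases "{i. odd (a i)} = {}")
      case False
      have "int (card {i. odd (a i)}) = (\<Sum>i\<in>{i. odd (a i)}. 1)" by simp
      also have "\<dots> \<le> (\<Sum>i\<in>{i. odd (a i)}. (a i)\<^sup>2)" by (intro sum_mono sq1) auto
      also have "\<dots> \<le> (\<Sum>i\<in>UNIV. (a i)\<^sup>2)" by (intro sum_mono2) auto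
      finally show ?thesis using golay_min_weight[OF C oC False] by linarith
    next
      case True
      define b where "b i = a i div 2" for i
      have ab: "a i = 2 * b i" for i using True by (auto simp: b_def)
      have "even (\<Sum>i\<in>UNIV. b i)"
        using sum4 unfolding ab \<open>m = 0\<close> sum_distrib_left[symmetric] by presburger
      moreover have "{i. odd (b i)} = {i. odd ((b i)\<^sup>2)}" by simp
      ultimately have even: "even (\<Sum>i\<in>UNIV. (b i)\<^sup>2)"
        unfolding even_sum_odd_set by (simp only:)
      have "\<exists>j. b j \<noteq> 0"
      proof (rule ccontr)
        assume "\<nexists>j. b j \<noteq> 0"
        then have "w = leech_vec (\<lambda>_. 0)" by (simp add: wa \<open>m = 0\<close> ab)
        with w(2) show False by (simp add: leech_vec_zero)
      qed
      then obtain j where "b j \<noteq> 0" by blast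
      then have "1 \<le> (b j)\<^sup>2" by (rule sq1)
      also have "\<dots> \<le> (\<Sum>i\<in>UNIV. (b i)\<^sup>2)" by (intro member_le_sum) auto
      finally have "(\<Sum>i\<in>UNIV. (b i)\<^sup>2) \<ge> 2" using even by presburger
      then show ?thesis by (simp add: ab power_mult_distrib sum_distrib_left[symmetric])
    qed
    then show ?thesis unfolding eq by linarith
  next
    case False
    then have m1: "m = 1" using m01 by simp
    show ?thesis
    proof (cases "\<forall>i. (m + 2 * a i)\<^sup>2 = 1")
      case True
      have av: "a i = - of_bool (odd (a i))" for i
      proof -
        have "1 + 2 * a i = 1 \<or> 1 + 2 * a i = - 1" using True m1 by (metis power2_eq_1_iff)
        then have "a i = 0 \<or> a i = - 1" by auto
        then show ?thesis by auto
      qed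
      have "(\<Sum>i\<in>UNIV. a i) = - (\<Sum>i\<in>UNIV. of_bool (odd (a i)))"
        by (subst av) (rule sum_negf)
      also have "(\<Sum>i\<in>UNIV. of_bool (odd (a i)) :: int) = int (card {i. odd (a i)})"
        by (simp add: of_bool_def sum.If_cases)
      finally have "(\<Sum>i\<in>UNIV. a i) = - int (card {i. odd (a i)})" .
      moreover have "4 dvd int (card {i. odd (a i)})"
        using golay_doubly_even[OF C oC] by (metis int_dvd_int_iff of_nat_numeral)
      ultimately show ?thesis using sum4 m1 by presburger
    next
      case False
      then obtain j where j: "(m + 2 * a j)\<^sup>2 \<noteq> 1" by blast
      have sq: "(m + 2 * a i)\<^sup>2 \<ge> 1" for i
        by (rule sq1) (use m1 in presburger)
      have "(m + 2 * a j)\<^sup>2 \<ge> 9"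
      proof -
        have "\<bar>m + 2 * a j\<bar> \<noteq> 1" using j by (metis power2_abs power_one)
        then have "\<bar>m + 2 * a j\<bar> \<ge> 3" using m1 by presburger
        then have "3\<^sup>2 \<le> \<bar>m + 2 * a j\<bar>\<^sup>2" by (intro power_mono) auto
        then show ?thesis by simp
      qed
      moreover have "(\<Sum>i\<in>UNIV - {j}. (m + 2 * a i)\<^sup>2) \<ge> (\<Sum>i\<in>UNIV - {j}. 1)"
        by (intro sum_mono sq)
      moreover have "(\<Sum>i\<in>UNIV - {j}. 1 :: int) = 23" by (simp add: card_Diff_subset)
      moreover have "(\<Sum>i\<in>UNIV. (m + 2 * a i)\<^sup>2) = (m + 2 * a j)\<^sup>2 + (\<Sum>i\<in>UNIV - {j}. (m + 2 * a i)\<^sup>2)"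
        by (rule sum.remove) auto
      ultimately show ?thesis by linarith
    qed
  qed
  then have "real_of_int 32 \<le> real_of_int (\<Sum>i\<in>UNIV. (m + 2 * a i)\<^sup>2)" by (simp only: of_int_le_iff)
  then show ?thesis unfolding wa norm_leech_vec by linarith
qed

text \<open>Changing one entry by 4 repairs the congruence modulo 8 without affecting the codeword.\<close>

lemma leech_adjust:
  assumes "{i. odd (a i)} \<in> C"
  shows "\<exists>k. leech_coord C m (a(i0 := a i0 + 2 * k))"
proof -
  have "even (card {i. odd (a i)})" by (rule golay_even[OF assms])
  then have ev: "even (\<Sum>i\<in>UNIV. a i)" by (simp add: even_sum_odd_set)
  define k where "k = (if 4 dvd (\<Sum>i\<in>UNIV. a i) + 2 * m then 0 else 1 :: int)"
  have "(\<Sum>i\<in>UNIV. (a(i0 := a i0 + 2 * k)) i) = (\<Sum>i\<in>UNIV. a i + (if i = i0 then 2 * k else 0))"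
    by (intro sum.cong) auto
  also have "\<dots> = (\<Sum>i\<in>UNIV. a i) + 2 * k" by (simp add: sum.distrib)
  finally have sum: "(\<Sum>i\<in>UNIV. (a(i0 := a i0 + 2 * k)) i) = (\<Sum>i\<in>UNIV. a i) + 2 * k" .
  have "4 dvd (\<Sum>i\<in>UNIV. (a(i0 := a i0 + 2 * k)) i) + 2 * m"
    using ev unfolding sum by (auto simp: k_def) presburger
  moreover have "{i. odd ((a(i0 := a i0 + 2 * k)) i)} \<in> C"
  proof -
    have "{i. odd ((a(i0 := a i0 + 2 * k)) i)} = {i. odd (a i)}" by auto
    then show ?thesis using assms by (simp only:)
  qed
  ultimately show ?thesis unfolding leech_coord_def by blast
qed

section \<open>The glue between the two orthogonal sections\<close>

lemma lattice_L_eq: "lattice_L C = {proj_V w | w. w \<in> leech_lattice C \<and> proj_U w = 0}"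
  by (auto simp: lattice_L_def subspace_V_eq)

lemma leech_U_iff:
  "leech_vec u \<in> {proj_U w | w. w \<in> leech_lattice C \<and> proj_V w = 0} \<longleftrightarrow> in_section_U u"
proof
  assume "leech_vec u \<in> {proj_U w | w. w \<in> leech_lattice C \<and> proj_V w = 0}"
  then obtain w where w: "w \<in> leech_lattice C" "proj_V w = 0" "leech_vec u = proj_U w" by blast
  obtain m a where m01: "m \<in> {0, 1}" and lm: "leech_coord C m a" and wm: "w = leech_vec (\<lambda>i. m + 2 * a i)"
    using w(1) by (rule leech_normal_form)
  have "leech_vec ((\<lambda>i. m + 2 * a i) \<circ> Inr) = (leech_vec (\<lambda>_. 0) :: real ^ 20)" using w(2) wm by (simp add: leech_vec_zero)
  then have z: "m + 2 * a (Inr j) = 0" for j unfolding leech_vec_eq_iff by (metis comp_apply)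
  have "even m" using z[of 0] by presburger
  then have "m = 0" using m01 by auto
  then have la: "leech_coord C 0 a" and wa: "w = leech_vec (\<lambda>i. 2 * a i)" and aR: "\<And>j. a (Inr j) = 0"
    using lm wm z by simp_all
  have "{i. odd (a i)} \<subseteq> range Inl"
  proof
    fix i assume "i \<in> {i. odd (a i)}"
    then show "i \<in> range Inl" using aR by (cases i) auto
  qed
  then have "card {i. odd (a i)} \<le> card (range (Inl :: 4 \<Rightarrow> idx))" by (intro card_mono) auto
  also have "\<dots> = 4" by (simp add: card_image)
  finally have "card {i. odd (a i)} < 8" by simp
  then have "{i. odd (a i)} = {}" using golay_min_weight[OF C] la by (auto simp: leech_coord_def) fastforce
  then have ev: "even (a i)" for i by auto
  have u: "u i = 2 * a (Inl i)" for i using w(3) unfolding wa proj_U_leech_vec leech_vec_eq_iff by simp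
  have "4 dvd u i" for i using ev[of "Inl i"] u[of i] by presburger
  moreover have "8 dvd (\<Sum>i\<in>UNIV. u i)"
  proof -
    have "4 dvd (\<Sum>i\<in>UNIV. a (Inl i))" using la by (simp add: leech_coord_def sum_idx aR)
    then show ?thesis unfolding u sum_distrib_left[symmetric] by presburger
  qed
  ultimately show "in_section_U u" by (simp add: in_section_U_def)
next
  assume u: "in_section_U u"
  define a :: "idx \<Rightarrow> int" where "a = case_sum (\<lambda>i. u i div 2) (\<lambda>_. 0)"
  have u4: "4 dvd u i" for i using u by (simp add: in_section_U_def)
  have u2: "u i = 2 * (u i div 2)" and ev: "even (u i div 2)" for i
    using u4[of i] by presburger+
  have "(\<Sum>i\<in>UNIV. u i) = 2 * (\<Sum>i\<in>UNIV. u i div 2)"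
    unfolding sum_distrib_left by (intro sum.cong refl u2)
  moreover have "8 dvd (\<Sum>i\<in>UNIV. u i)" using u by (simp add: in_section_U_def)
  ultimately have "4 dvd (\<Sum>i\<in>UNIV. u i div 2)" by presburger
  then have "leech_coord C 0 a"
  proof -
    assume "4 dvd (\<Sum>i\<in>UNIV. u i div 2)"
    moreover have "even (a i)" for i using ev by (cases i) (simp_all add: a_def)
    then have "{i. odd (a i)} = {}" by simp
    ultimately show ?thesis using golay_empty by (simp add: leech_coord_def sum_idx a_def)
  qed
  then have "leech_vec (\<lambda>i. 0 + 2 * a i) \<in> leech_lattice C" unfolding leech_iff by blast
  moreover have "proj_V (leech_vec (\<lambda>i. 0 + 2 * a i)) = 0" by (simp add: a_def comp_def leech_vec_zero)
  moreover have "proj_U (leech_vec (\<lambda>i. 0 + 2 * a i)) = leech_vec u" by (simp add: a_def comp_def u2[symmetric])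
  ultimately show "leech_vec u \<in> {proj_U w | w. w \<in> leech_lattice C \<and> proj_V w = 0}"
    by (intro CollectI exI[of _ "leech_vec (\<lambda>i. 0 + 2 * a i)"]) auto
qed

text \<open>A lattice vector may be changed by the \<open>V\<close>-section without moving its \<open>U\<close>-part, and conversely.\<close>

lemma section_glue:
  assumes w: "w \<in> leech_lattice C" "proj_U w = leech_vec u"
  shows "proj_V w \<in> lattice_L C \<longleftrightarrow> in_section_U u"
proof
  assume "proj_V w \<in> lattice_L C"
  then obtain w' where w': "w' \<in> leech_lattice C" "proj_U w' = 0" "proj_V w' = proj_V w"
    by (auto simp: lattice_L_eq)
  then have "w - w' \<in> leech_lattice C" "proj_V (w - w') = 0" "proj_U (w - w') = leech_vec u"
    using w leech_diff by (auto simp: proj_diff)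
  then show "in_section_U u" unfolding leech_U_iff[symmetric] by (intro CollectI exI[of _ "w - w'"]) auto
next
  assume "in_section_U u"
  then obtain w' where w': "w' \<in> leech_lattice C" "proj_V w' = 0" "proj_U w' = leech_vec u"
    unfolding leech_U_iff[symmetric] by auto
  then have "w - w' \<in> leech_lattice C" "proj_U (w - w') = 0" "proj_V (w - w') = proj_V w"
    using w leech_diff by (auto simp: proj_diff)
  then show "proj_V w \<in> lattice_L C" unfolding lattice_L_eq by (intro CollectI exI[of _ "w - w'"]) auto
qed

text \<open>Every vector of \<open>U\<close> with entries of equal parity is the \<open>U\<close>-part of a lattice vector, because the four
  coordinates of a codeword there are arbitrary.\<close>

lemma leech_over_U: "\<exists>w. w \<in> leech_lattice C \<and> proj_U w = leech_vec (\<lambda>i. m + 2 * q i)"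
proof -
  let ?X = "range (Inl :: 4 \<Rightarrow> idx)"
  have "card ?X = 4" by (simp add: card_image)
  then have "punctured C ?X = Pow ?X" by (intro punctured_small[OF C]) simp
  then have "Inl ` {i. odd (q i)} \<in> punctured C ?X" by auto
  then obtain T where T: "T \<in> C" "T \<inter> ?X = Inl ` {i. odd (q i)}" 
    by (auto simp: punctured_def)
  define a :: "idx \<Rightarrow> int" where "a = case_sum q (\<lambda>j. of_bool (Inr j \<in> T))"
  have Tl: "Inl i \<in> T \<longleftrightarrow> odd (q i)" for i using T(2) by (auto simp: set_eq_iff)
  have "odd (a i) \<longleftrightarrow> i \<in> T" for i by (cases i) (auto simp: a_def Tl)
  then have "{i. odd (a i)} \<in> C" using T(1) by simp
  from leech_adjust[OF this, of m "Inr 0"]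
  obtain k where k: "leech_coord C m (a(Inr 0 := a (Inr 0) + 2 * k))" by blast
  let ?w = "leech_vec (\<lambda>i. m + 2 * (a(Inr 0 := a (Inr 0) + 2 * k)) i)"
  have "?w \<in> leech_lattice C" unfolding leech_iff using k by blast
  moreover have "proj_U ?w = leech_vec (\<lambda>i. m + 2 * q i)" by (simp add: a_def comp_def)
  ultimately show ?thesis by blast
qed

lemma leech_over_V:
  assumes "Inr ` {j. odd (c j)} \<in> punctured C (range Inr)"
  shows "\<exists>w. w \<in> leech_lattice C \<and> proj_V w = leech_vec (\<lambda>j. m + 2 * c j)"
proof -
  let ?X = "range (Inr :: 20 \<Rightarrow> idx)"
  obtain T where T: "T \<in> C" "T \<inter> ?X = Inr ` {j. odd (c j)}" 
    using assms by (auto simp: punctured_def) 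
  define a :: "idx \<Rightarrow> int" where "a = case_sum (\<lambda>i. of_bool (Inl i \<in> T)) c"
  have Tr: "Inr j \<in> T \<longleftrightarrow> odd (c j)" for j using T(2) by (auto simp: set_eq_iff)
  have "odd (a i) \<longleftrightarrow> i \<in> T" for i by (cases i) (auto simp: a_def Tr)
  then have "{i. odd (a i)} \<in> C" using T(1) by simp
  from leech_adjust[OF this, of m "Inl 0"]
  obtain k where k: "leech_coord C m (a(Inl 0 := a (Inl 0) + 2 * k))" by blast
  let ?w = "leech_vec (\<lambda>i. m + 2 * (a(Inl 0 := a (Inl 0) + 2 * k)) i)"
  have "?w \<in> leech_lattice C" unfolding leech_iff using k by blast
  moreover have "proj_V ?w = leech_vec (\<lambda>j. m + 2 * c j)" by (simp add: a_def comp_def)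
  ultimately show ?thesis by blast
qed

lemma lattice_L_memI:
  assumes "4 dvd (\<Sum>j\<in>UNIV. c j)" "Inr ` {j. odd (c j)} \<in> C"
  shows "leech_vec (\<lambda>j. 2 * c j) \<in> lattice_L C"
proof -
  define a :: "idx \<Rightarrow> int" where "a = case_sum (\<lambda>_. 0) c"
  have "odd (a i) \<longleftrightarrow> i \<in> Inr ` {j. odd (c j)}" for i by (cases i) (auto simp: a_def)
  then have "{i. odd (a i)} = Inr ` {j. odd (c j)}" by auto
  then have "leech_coord C 0 a" using assms by (simp add: leech_coord_def sum_idx a_def)
  then have "leech_vec (\<lambda>i. 0 + 2 * a i) \<in> leech_lattice C" unfolding leech_iff by blast
  moreover have "proj_V (leech_vec (\<lambda>i. 0 + 2 * a i)) = leech_vec (\<lambda>j. 2 * c j)" by (simp add: a_def comp_def)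
  moreover have "proj_U (leech_vec (\<lambda>i. 0 + 2 * a i)) = 0" by (simp add: a_def comp_def leech_vec_zero)
  ultimately show ?thesis unfolding lattice_L_eq
    by (intro CollectI exI[of _ "leech_vec (\<lambda>i. 0 + 2 * a i)"]) auto
qed

text \<open>Pairing \<open>\<xi>\<close> with vectors of \<open>L\<close> of the shapes \<open>(8, 0, ...)\<close> and \<open>(4, 4, 0, ...)\<close> shows that its
  coordinates are integers of equal parity; pairing with twice the codewords that avoid the first four
  coordinates shows that the odd halves form a word orthogonal to the shortened code, that is, a
  punctured codeword.\<close>

lemma dual_L: "dual_lattice (lattice_L C) = proj_V ` leech_lattice C"
proof (intro equalityI subsetI)
  fix \<xi> assume "\<xi> \<in> proj_V ` leech_lattice C"
  then obtain w where w: "w \<in> leech_lattice C" "\<xi> = proj_V w" by blast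
  have "\<xi> \<bullet> x \<in> \<int>" if x: "x \<in> lattice_L C" for x
  proof -
    obtain w' where w': "w' \<in> leech_lattice C" "proj_U w' = 0" "x = proj_V w'"
      using x by (auto simp: lattice_L_eq)
    then show ?thesis using leech_integral[OF w(1) w'(1)] w by (simp add: inner_proj)
  qed
  then show "\<xi> \<in> dual_lattice (lattice_L C)" by (simp add: dual_lattice_def)
next
  fix \<xi> assume xi: "\<xi> \<in> dual_lattice (lattice_L C)"
  have int: "\<xi> \<bullet> leech_vec (\<lambda>j. 2 * c j) \<in> \<int>" if "4 dvd (\<Sum>j\<in>UNIV. c j)" "Inr ` {j. odd (c j)} \<in> C" for c
    using xi lattice_L_memI[OF that] by (simp add: dual_lattice_def)
  have "\<exists>z::int. \<xi> $ j = real_of_int z / sqrt 8" for j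
  proof -
    have "\<xi> \<bullet> leech_vec (\<lambda>i. 2 * (if i = j then 4 else 0)) \<in> \<int>"
      by (rule int) (auto simp: golay_empty)
    also have "\<xi> \<bullet> leech_vec (\<lambda>i. 2 * (if i = j then 4 else 0)) = \<xi> $ j * (8 / sqrt 8)"
    proof -
      have "\<xi> \<bullet> leech_vec (\<lambda>i. 2 * (if i = j then 4 else 0)) = (\<Sum>i\<in>UNIV. if i = j then \<xi> $ j * (8 / sqrt 8) else 0)"
        unfolding inner_vec_def by (intro sum.cong) auto
      then show ?thesis by simp
    qed
    also have "8 / sqrt 8 = sqrt (8::real)" by (simp add: real_div_sqrt)
    finally obtain z where "\<xi> $ j * sqrt 8 = real_of_int z" by (auto elim: Ints_cases)
    then show ?thesis by (intro exI[of _ z]) (simp add: field_simps)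
  qed
  then obtain z where "\<And>j. \<xi> $ j = real_of_int (z j) / sqrt 8" by metis
  then have z: "\<xi> = leech_vec z" by (simp add: vec_eq_iff)
  have par: "even (z i + z j)" for i j
  proof (cases "i = j")
    case False
    have "\<xi> \<bullet> leech_vec (\<lambda>k. 2 * (if k = i \<or> k = j then 2 else 0)) \<in> \<int>"
    proof (rule int)
      have "(\<Sum>k\<in>UNIV. if k = i \<or> k = j then 2 else 0 :: int) = (\<Sum>k\<in>UNIV. (if k = i then 2 else 0) + (if k = j then 2 else 0))"
        using False by (intro sum.cong) auto
      then show "4 dvd (\<Sum>k\<in>UNIV. if k = i \<or> k = j then 2 else 0 :: int)" by (simp add: sum.distrib)
      have "{k. odd (if k = i \<or> k = j then 2 else 0 :: int)} = {}" by auto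
      then show "Inr ` {k. odd (if k = i \<or> k = j then 2 else 0 :: int)} \<in> C" by (simp add: golay_empty)
    qed
    also have "\<xi> \<bullet> leech_vec (\<lambda>k. 2 * (if k = i \<or> k = j then 2 else 0)) = real_of_int (\<Sum>k\<in>UNIV. z k * (2 * (if k = i \<or> k = j then 2 else 0))) / 8"
      by (simp only: z leech_vec_inner)
    also have "(\<Sum>k\<in>UNIV. z k * (2 * (if k = i \<or> k = j then 2 else 0))) = (\<Sum>k\<in>UNIV. (if k = i then 4 * z k else 0) + (if k = j then 4 * z k else 0))"
      using False by (intro sum.cong) auto
    also have "\<dots> = 4 * (z i + z j)" by (simp add: sum.distrib)
    finally obtain n where "real_of_int (4 * (z i + z j)) / 8 = real_of_int n" by (auto elim: Ints_cases)
    then have "real_of_int (z i + z j) = real_of_int (2 * n)" by simp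
    then show ?thesis by (simp only: of_int_eq_iff) simp
  qed simp
  define m c where "m = z 0 mod 2" and "c j = (z j - m) div 2" for j
  have zc: "z j = m + 2 * c j" for j
  proof -
    have "even (z j - m)" using par[of j 0] unfolding m_def by presburger
    then show ?thesis by (simp add: c_def)
  qed
  have "Inr ` {j. odd (c j)} \<in> dual_code (range Inr) (shortened C (range Inr))"
    unfolding dual_code_def
  proof (intro CollectI conjI ballI)
    fix S assume "S \<in> shortened C (range Inr)"
    then have S: "S \<in> C" "S \<subseteq> range Inr" by (auto simp: shortened_def)
    define S' where "S' = {j. Inr j \<in> S}"
    have SS: "S = Inr ` S'" using S by (auto simp: S'_def)
    then have cS: "card S = card S'" by (simp add: card_image)
    have "\<xi> \<bullet> leech_vec (\<lambda>j. 2 * of_bool (j \<in> S')) \<in> \<int>"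
    proof (rule int)
      have "(\<Sum>j\<in>UNIV. of_bool (j \<in> S') :: int) = int (card S')" by (simp add: of_bool_def sum.If_cases)
      then show "4 dvd (\<Sum>j\<in>UNIV. of_bool (j \<in> S') :: int)"
        using golay_doubly_even[OF C S(1)] cS by (metis int_dvd_int_iff of_nat_numeral)
      show "Inr ` {j. odd (of_bool (j \<in> S') :: int)} \<in> C" using S(1) SS by simp
    qed
    also have "\<xi> \<bullet> leech_vec (\<lambda>j. 2 * of_bool (j \<in> S')) = real_of_int (\<Sum>j\<in>UNIV. z j * (2 * of_bool (j \<in> S'))) / 8"
      by (simp only: z leech_vec_inner)
    also have "(\<Sum>j\<in>UNIV. z j * (2 * of_bool (j \<in> S'))) = (\<Sum>j\<in>UNIV. if j \<in> S' then 2 * m + 4 * c j else 0)"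
      by (intro sum.cong) (auto simp: zc)
    also have "\<dots> = 2 * m * int (card S') + 4 * (\<Sum>j\<in>S'. c j)"
      by (simp add: sum.If_cases sum.distrib sum_distrib_left[symmetric])
    finally obtain n where n: "real_of_int (2 * m * int (card S') + 4 * (\<Sum>j\<in>S'. c j)) / 8 = real_of_int n"
      by (auto elim: Ints_cases)
    then have "real_of_int (2 * m * int (card S') + 4 * (\<Sum>j\<in>S'. c j)) = real_of_int (8 * n)" by simp
    then have n8: "2 * m * int (card S') + 4 * (\<Sum>j\<in>S'. c j) = 8 * n" by (simp only: of_int_eq_iff)
    obtain k where "card S' = 4 * k" using golay_doubly_even[OF C S(1)] cS by auto
    then have "(\<Sum>j\<in>S'. c j) = 2 * (n - m * int k)" using n8 by (simp add: algebra_simps)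
    then have "even (\<Sum>j\<in>S'. c j)" by simp
    then have "even (card {j \<in> S'. odd (c j)})" by (subst (asm) even_sum_iff) simp_all
    moreover have "S \<inter> Inr ` {j. odd (c j)} = Inr ` {j \<in> S'. odd (c j)}" by (auto simp: SS)
    ultimately show "even (card (S \<inter> Inr ` {j. odd (c j)}))" by (simp add: card_image)
  qed auto
  then have "Inr ` {j. odd (c j)} \<in> punctured C (range Inr)" by (simp add: dual_shortened[OF C])
  from leech_over_V[OF this, of m] obtain w where "w \<in> leech_lattice C" "proj_V w = leech_vec (\<lambda>j. m + 2 * c j)" by blast
  moreover have "z = (\<lambda>j. m + 2 * c j)" using zc by auto
  ultimately show "\<xi> \<in> proj_V ` leech_lattice C" using z by force
qed

end


section \<open>Cosets of the section lattice\<close>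

lemma coset_presentation:
  fixes \<Lambda> :: "'a::euclidean_space set"
  assumes L: "is_lattice \<Lambda>" and I: "finite I" "I \<noteq> {}"
    and inj: "\<And>i j. i \<in> I \<Longrightarrow> j \<in> I \<Longrightarrow> r i - r j \<in> \<Lambda> \<Longrightarrow> i = j"
    and P: "\<And>x. x \<in> P \<longleftrightarrow> (\<exists>i\<in>I. x - r i \<in> \<Lambda>)"
  shows "presentation \<Lambda> (r ` I) P" and "inj_on r I"
proof -
  obtain B where "lattice_basis B \<Lambda>" using L by (auto simp: is_lattice_def)
  then obtain D where "lattice_coords B D \<Lambda>" using lattice_coords_exist by blast
  then interpret lattice_coords B D \<Lambda> .
  show inj_r: "inj_on r I"
    by (rule inj_onI) (metis inj diff_self zero_mem)
  have mem: "x \<in> (+) v ` \<Lambda> \<longleftrightarrow> x - v \<in> \<Lambda>" for x v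
    by (auto simp: image_iff intro: bexI[of _ "x - v"])
  show "presentation \<Lambda> (r ` I) P"
    unfolding presentation_def
  proof (intro conjI)
    show "inj_on (\<lambda>v. (+) v ` \<Lambda>) (r ` I)"
      by (rule inj_onI) (auto simp: coset_eq_iff dest: inj)
    show "P = (\<Union>v\<in>r ` I. (+) v ` \<Lambda>)"
      by (rule set_eqI) (simp only: P UN_iff mem bex_simps)
  qed (use L I in auto)
qed

text \<open>Integer quadruples stand for functions on the index type 4, so that the finite checks below are
  computations with integers.\<close>

type_synonym quad = "int \<times> int \<times> int \<times> int"

definition quad_fun :: "quad \<Rightarrow> 4 \<Rightarrow> int" where
  "quad_fun = (\<lambda>(a, b, c, d) i. if i = 1 then a else if i = 2 then b else if i = 3 then c else d)"

lemma quad_fun_simps [simp]: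
  "quad_fun (a, b, c, d) 1 = a" "quad_fun (a, b, c, d) 2 = b"
  "quad_fun (a, b, c, d) 3 = c" "quad_fun (a, b, c, d) 4 = d"
  by (simp_all add: quad_fun_def)

definition quad_diff :: "quad \<Rightarrow> quad \<Rightarrow> quad" where
  "quad_diff = (\<lambda>(a, b, c, d) (a', b', c', d'). (a - a', b - b', c - c', d - d'))"

definition quad_dot :: "quad \<Rightarrow> quad \<Rightarrow> int" where
  "quad_dot = (\<lambda>(a, b, c, d) (a', b', c', d'). a * a' + b * b' + c * c' + d * d')"

text \<open>Equal parity of the four entries characterizes the \<open>U\<close>-parts of lattice vectors.\<close>

definition quad_par :: "quad \<Rightarrow> bool" where
  "quad_par = (\<lambda>(a, b, c, d). even (b - a) \<and> even (c - a) \<and> even (d - a))"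

definition quad_in_section_U :: "quad \<Rightarrow> bool" where
  "quad_in_section_U = (\<lambda>(a, b, c, d). 4 dvd a \<and> 4 dvd b \<and> 4 dvd c \<and> 4 dvd d \<and> 8 dvd a + b + c + d)"

definition quad_emb :: "quad \<Rightarrow> real ^ 4" where
  "quad_emb y = leech_vec (quad_fun y)"

lemma quad_emb_diff: "quad_emb y - quad_emb z = quad_emb (quad_diff y z)"
  by (cases y; cases z) (simp add: quad_emb_def leech_vec_diff quad_diff_def fun_eq_iff forall_4)

lemma quad_emb_inner: "quad_emb y \<bullet> quad_emb z = real_of_int (quad_dot y z) / 8"
  by (cases y; cases z) (simp add: quad_emb_def leech_vec_inner quad_dot_def sum_4)

lemma quad_emb_zero: "quad_emb (0, 0, 0, 0) = 0"
  by (simp add: quad_emb_def vec_eq_iff forall_4)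

lemma in_section_U_quad: "in_section_U (quad_fun y) \<longleftrightarrow> quad_in_section_U y"
  by (cases y) (simp add: in_section_U_def quad_in_section_U_def forall_4 sum_4)

lemma quad_dot_even: "quad_par y \<Longrightarrow> quad_par z \<Longrightarrow> even (quad_dot y z)"
proof -
  assume yz: "quad_par y" "quad_par z"
  obtain a b c d where y: "y = (a, b, c, d)" by (cases y)
  obtain a' b' c' d' where z: "z = (a', b', c', d')" by (cases z)
  show ?thesis using yz by (auto simp: y z quad_par_def quad_dot_def)
qed

text \<open>Both configurations have this form, and so does \<open>L*\<close>.\<close>

definition glued_config :: "idx set set \<Rightarrow> quad set \<Rightarrow> (real ^ 20) set" where
  "glued_config C A = {proj_V w | w. w \<in> leech_lattice C \<and> proj_U w \<in> quad_emb ` A}"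

definition quads_A :: "quad list" where
  "quads_A = [(0,0,0,0), (1,1,1,1), (2,0,0,0), (1,1,1,-1)]"

definition quads_A_star :: "quad list" where
  "quads_A_star = [(0,0,0,0), (1,-1,1,1), (0,0,2,0), (1,-1,3,1), (0,0,2,2), (3,-3,5,5), (0,0,8,2), (3,-3,11,5),
    (4,2,2,0), (5,1,3,1), (4,2,4,0), (5,1,5,1), (4,2,4,2), (7,-1,7,5), (4,2,10,2), (7,-1,13,5)]"

text \<open>Representatives of the 64 classes of the \<open>U\<close>-projection modulo the \<open>U\<close>-section.\<close>

definition glue_reps :: "quad list" where
  "glue_reps = [(m + 2 * q1 + 4 * s, m + 2 * q2, m + 2 * q3, m + 2 * q4).
     m \<leftarrow> [0, 1], q1 \<leftarrow> [0, 1], q2 \<leftarrow> [0, 1], q3 \<leftarrow> [0, 1], q4 \<leftarrow> [0, 1], s \<leftarrow> [0, 1]]"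

lemma vector_4_nth:
  "(vector [a, b, c, d] :: real ^ 4) $ 1 = a" "(vector [a, b, c, d] :: real ^ 4) $ 2 = b"
  "(vector [a, b, c, d] :: real ^ 4) $ 3 = c" "(vector [a, b, c, d] :: real ^ 4) $ 4 = d"
  by (simp_all add: vector_def)

lemma quad_emb_vector:
  "(1 / sqrt 8) *\<^sub>R vector [real_of_int a, real_of_int b, real_of_int c, real_of_int d] = quad_emb (a, b, c, d)"
  by (simp add: quad_emb_def vec_eq_iff forall_4 vector_4_nth)

lemma config_A_eq: "config_A = quad_emb ` set quads_A"
  using quad_emb_vector[of 0 0 0 0] quad_emb_vector[of 1 1 1 1] quad_emb_vector[of 2 0 0 0]
    quad_emb_vector[of 1 1 1 "-1"]
  by (simp add: config_A_def quads_A_def)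

lemma r_vec_quad:
  "r_vec (real_of_int a, real_of_int b, real_of_int c) = quad_emb (c, - c, 2 * a + 2 * b + c, 2 * a + c)"
  and quad_emb_shift: "quad_emb (a, b, c, d) + shift_v = quad_emb (a + 4, b + 2, c + 2, d)"
  by (simp_all add: r_vec_def f1_def f2_def f3_def shift_v_def quad_emb_def vec_eq_iff forall_4 vector_4_nth
      add_divide_distrib diff_divide_distrib mult.commute)

lemma config_A_star_eq: "config_A_star = quad_emb ` set quads_A_star"
proof -
  define T :: "(int \<times> int \<times> int) set" where
    "T = {(0,0,0), (0,0,1), (0,1,0), (0,1,1), (1,0,0), (1,0,3), (1,3,0), (1,3,3)}"
  have T: "index_T = (\<lambda>(a, b, c). (real_of_int a, real_of_int b, real_of_int c)) ` T"
    by (simp add: index_T_def T_def)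
  have "config_A_star = (\<lambda>(a, b, c). quad_emb (c, - c, 2 * a + 2 * b + c, 2 * a + c)) ` T
      \<union> (\<lambda>(a, b, c). quad_emb (c + 4, 2 - c, 2 * a + 2 * b + c + 2, 2 * a + c)) ` T"
    unfolding config_A_star_def T image_image by (simp add: case_prod_unfold r_vec_quad quad_emb_shift)
  also have "\<dots> = quad_emb ` set quads_A_star"
    by (simp add: T_def quads_A_star_def insert_commute)
  finally show ?thesis .
qed

section \<open>A finite Fourier computation\<close>

definition cos4 :: "int \<Rightarrow> int" where
  "cos4 k = (if k mod 4 = 0 then 1 else if k mod 4 = 2 then - 1 else 0)"

definition sin4 :: "int \<Rightarrow> int" where
  "sin4 k = (if k mod 4 = 1 then 1 else if k mod 4 = 3 then - 1 else 0)"

text \<open>The powers of \<open>- \<i>\<close>, split into integer real and imaginary parts so that the character sums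
  can be computed over the integers.\<close>

lemma exp_quarter:
  "exp (2 * pi * \<i> * complex_of_real (- real_of_int k / 4)) = Complex (real_of_int (cos4 k)) (- real_of_int (sin4 k))"
proof -
  define r where "r = nat (k mod 4)"
  have k: "k = 4 * (k div 4) + int r" by (simp add: r_def)
  have "exp (2 * pi * \<i> * complex_of_real (- real_of_int k / 4)) = cis (- (pi / 2) * real_of_int k)"
    by (simp add: cis_conv_exp mult_ac)
  also have "- (pi / 2) * real_of_int k = real r * (- (pi / 2)) + 2 * pi * real_of_int (- (k div 4))"
    by (subst k) (simp add: algebra_simps)
  also have "cis \<dots> = cis (real r * (- (pi / 2)))"
    by (simp only: cis_mult[symmetric] cis_multiple_2pi[OF Ints_of_int]) simp
  also have "\<dots> = (- \<i>) ^ r"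
  proof -
    have "cis (- (pi / 2)) = - \<i>" by (simp add: complex_eq_iff)
    moreover have "cis (- (pi / 2)) ^ r = cis (real r * (- (pi / 2)))" by (rule Complex.DeMoivre)
    ultimately show ?thesis by (simp only:)
  qed
  also have "\<dots> = Complex (real_of_int (cos4 k)) (- real_of_int (sin4 k))"
  proof -
    have "r = 0 \<or> r = 1 \<or> r = 2 \<or> r = 3" unfolding r_def by auto
    moreover have "k mod 4 = int r" by (simp add: r_def)
    ultimately show ?thesis
      by (auto simp: cos4_def sin4_def complex_eq_iff power2_eq_square power3_eq_cube)
  qed
  finally show ?thesis .
qed

definition quad_count :: "quad \<Rightarrow> nat" where
  "quad_count z = length (filter (\<lambda>(a, b). quad_in_section_U (quad_diff z (quad_diff a b))) (List.product quads_A quads_A))"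

text \<open>In the first statement the left-hand side is the squared modulus of a sum of 16 fourth roots of
  unity; the factor is \<open>64 = 16\<^sup>2 / 4\<close>.\<close>

lemma finite_fourier_check:
  "\<forall>z\<in>set glue_reps. (\<Sum>y\<leftarrow>quads_A_star. cos4 (quad_dot y z div 2))\<^sup>2
      + (\<Sum>y\<leftarrow>quads_A_star. sin4 (quad_dot y z div 2))\<^sup>2 = 64 * int (quad_count z)"
  and quads_star_distinct: "distinct quads_A_star" "distinct quads_A"
  and glue_reps_card: "card (set glue_reps) = 64"
  and quads_star_par: "\<forall>y\<in>set quads_A_star. quad_par y" "\<forall>y\<in>set quads_A. quad_par y" "\<forall>y\<in>set glue_reps. quad_par y"
  and quads_star_cosets:
  "\<forall>y\<in>set quads_A_star. \<forall>z\<in>set quads_A_star. quad_in_section_U (quad_diff y z) \<longrightarrow> y = z"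
  "\<forall>y\<in>set quads_A. \<forall>z\<in>set quads_A. quad_in_section_U (quad_diff y z) \<longrightarrow> y = z"
  and quads_A_norm:
  "\<forall>y\<in>set quads_A. \<forall>z\<in>set quads_A. quad_dot (quad_diff y z) (quad_diff y z) \<le> 4"
  by code_simp+

lemma bits_mod_4:
  fixes a b a' b' :: int
  assumes "a \<in> {0, 1}" "a' \<in> {0, 1}" "b \<in> {0, 1}" "b' \<in> {0, 1}" "4 dvd (a + 2 * b) - (a' + 2 * b')"
  shows "a = a' \<and> b = b'"
  using assms by auto

context
  fixes C :: "idx set set"
  assumes C: "extended_golay_code C"
begin

lemma in_cubic_iff:
  fixes v :: "real ^ 20"
  shows "v \<in> cubic_lattice (real_of_int c / sqrt 8) \<longleftrightarrow> (\<exists>x. v = leech_vec (\<lambda>j. c * x j))"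
proof -
  have "v \<in> cubic_lattice (real_of_int c / sqrt 8) \<longleftrightarrow> (\<forall>j. \<exists>k::int. v $ j = real_of_int (c * k) / sqrt 8)"
    by (auto simp: cubic_lattice_def Basis_vec_def inner_axis)
  also have "\<dots> \<longleftrightarrow> (\<exists>x. \<forall>j. v $ j = real_of_int (c * x j) / sqrt 8)"
    by (rule choice_iff)
  finally show ?thesis by (simp add: vec_eq_iff)
qed

lemma is_lattice_L: "is_lattice (lattice_L C)"
proof (rule subgroup_is_lattice[where c = "1 / sqrt 8" and k = 8])
  show "lattice_L C \<subseteq> cubic_lattice (1 / sqrt 8)"
  proof
    fix v assume "v \<in> lattice_L C"
    then obtain m a where "v = proj_V (leech_vec (\<lambda>i. m + 2 * a i))"
      unfolding lattice_L_eq[OF C] leech_iff[OF C] by blast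
    then have "v = leech_vec (\<lambda>j. 1 * (m + 2 * a (Inr j)))" by (simp add: comp_def)
    then show "v \<in> cubic_lattice (1 / sqrt 8)" using in_cubic_iff[of v 1] by auto
  qed
  show "cubic_lattice (1 / sqrt 8 * real_of_int 8) \<subseteq> lattice_L C"
  proof
    fix v :: "real ^ 20" assume "v \<in> cubic_lattice (1 / sqrt 8 * real_of_int 8)"
    then obtain x where v: "v = leech_vec (\<lambda>j. 8 * x j)" using in_cubic_iff[of v 8] by auto
    have "leech_vec (\<lambda>j. 2 * (4 * x j)) \<in> lattice_L C"
      by (rule lattice_L_memI[OF C]) (simp_all add: sum_distrib_left[symmetric] golay_empty[OF C])
    then show "v \<in> lattice_L C" by (simp add: v)
  qed
  show "x - y \<in> lattice_L C" if xy: "x \<in> lattice_L C" "y \<in> lattice_L C" for x y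
  proof -
    obtain v w where v: "v \<in> leech_lattice C" "proj_U v = 0" "x = proj_V v"
      and w: "w \<in> leech_lattice C" "proj_U w = 0" "y = proj_V w"
      using xy unfolding lattice_L_eq[OF C] by blast
    then show ?thesis unfolding lattice_L_eq[OF C]
      by (intro CollectI exI[of _ "v - w"]) (simp add: proj_diff leech_diff[OF C])
  qed
qed simp_all

lemma dual_L_lattice: "is_lattice (dual_lattice (lattice_L C))"
  and dual_dual_L: "dual_lattice (dual_lattice (lattice_L C)) = lattice_L C"
proof -
  obtain B where "lattice_basis B (lattice_L C)" using is_lattice_L by (auto simp: is_lattice_def)
  then obtain D where "lattice_coords B D (lattice_L C)" using lattice_coords_exist by blast
  then interpret lattice_coords B D "lattice_L C" .
  show "dual_lattice (dual_lattice (lattice_L C)) = lattice_L C" by (rule dual_dual)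
  show "is_lattice (dual_lattice (lattice_L C))"
    using lattice_coords.basis[OF dual_coords] by (auto simp: is_lattice_def)
qed

text \<open>Modulo the cubic lattice of vectors with all entries divisible by 4, the dual lattice has the
  representatives \<open>m + 2 c\<close> with \<open>m\<close> a bit and \<open>c\<close> one of the \<open>2\<^sup>1\<^sup>2\<close> punctured codewords; the cubic
  lattice has covolume \<open>(4 / sqrt 8)\<^sup>2\<^sup>0 = 2\<^sup>1\<^sup>0\<close>.\<close>

lemma covolume_dual_L: "covolume (dual_lattice (lattice_L C)) = 1 / 8"
proof -
  let ?X = "range (Inr :: 20 \<Rightarrow> idx)"
  define r :: "int \<times> idx set \<Rightarrow> real ^ 20" where
    "r = (\<lambda>(m, P). leech_vec (\<lambda>j. m + 2 * of_bool (Inr j \<in> P)))"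
  let ?I = "{0, 1} \<times> punctured C ?X"
  have finp: "finite (punctured C ?X)" by simp
  have "card (- ?X) = card (range (Inl :: 4 \<Rightarrow> idx))"
    by (rule arg_cong[of _ _ card]) (auto, metis sum.exhaust rangeI)
  then have "card (- ?X) < 8" by (simp add: card_image)
  then have cp: "card (punctured C ?X) = 2 ^ 12" by (rule card_punctured_large[OF C])
  have c4: "1 / sqrt 8 * 4 = real_of_int 4 / sqrt 8" by simp
  have lat: "is_lattice (cubic_lattice (real_of_int 4 / sqrt 8) :: (real ^ 20) set)"
    using cubic_lattice_basis[of "real_of_int 4 / sqrt 8"] by (auto simp: is_lattice_def)
  have I: "finite ?I" "?I \<noteq> {}" using finp cp by auto
  have inj: "i = j" if ij: "i \<in> ?I" "j \<in> ?I" "r i - r j \<in> cubic_lattice (real_of_int 4 / sqrt 8)" for i j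
  proof -
    obtain m P m' P' where eq: "i = (m, P)" "j = (m', P')" by fastforce
    have mP: "m \<in> {0, 1}" "m' \<in> {0, 1}" "P \<subseteq> ?X" "P' \<subseteq> ?X" using ij eq by (auto simp: punctured_def)
    obtain x where x: "r i - r j = leech_vec (\<lambda>j. 4 * x j)" using ij(3) in_cubic_iff by blast
    have "(m + 2 * of_bool (Inr k \<in> P)) - (m' + 2 * of_bool (Inr k \<in> P')) = 4 * x k" for k
      using x unfolding r_def eq by (simp add: leech_vec_diff fun_eq_iff)
    then have "4 dvd (m + 2 * of_bool (Inr k \<in> P)) - (m' + 2 * of_bool (Inr k \<in> P'))" for k
      by simp
    from bits_mod_4[OF mP(1,2) _ _ this] have "m = m' \<and> (Inr k \<in> P \<longleftrightarrow> Inr k \<in> P')" for k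
      by (simp add: of_bool_eq_iff)
    then have "m = m'" "P = P'" using mP(3,4) by auto
    then show ?thesis by (simp add: eq)
  qed
  have mem: "v \<in> dual_lattice (lattice_L C) \<longleftrightarrow> (\<exists>i\<in>?I. v - r i \<in> cubic_lattice (real_of_int 4 / sqrt 8))" for v
  proof
    assume "v \<in> dual_lattice (lattice_L C)"
    then obtain w where w: "w \<in> leech_lattice C" "v = proj_V w" unfolding dual_L[OF C] by blast
    obtain m a where m01: "m \<in> {0, 1}" and la: "leech_coord C m a" and wa: "w = leech_vec (\<lambda>i. m + 2 * a i)"
      using w(1) by (rule leech_normal_form[OF C])
    have va: "v = leech_vec (\<lambda>j. m + 2 * a (Inr j))" by (simp add: w(2) wa comp_def)
    let ?P = "{i. odd (a i)} \<inter> ?X"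
    have "(m, ?P) \<in> ?I" using la m01 by (auto simp: punctured_def leech_coord_def)
    moreover have "v - r (m, ?P) = leech_vec (\<lambda>j. 4 * (a (Inr j) div 2))"
      unfolding va r_def prod.case leech_vec_diff leech_vec_eq_iff
    proof (rule ext)
      fix j
      have "2 * x - 2 * of_bool (odd x) = 4 * (x div 2)" for x :: int
        by (cases "even x") (auto elim!: evenE oddE)
      from this[of "a (Inr j)"]
      show "m + 2 * a (Inr j) - (m + 2 * of_bool (Inr j \<in> ?P)) = 4 * (a (Inr j) div 2)" by simp
    qed
    then have "v - r (m, ?P) \<in> cubic_lattice (real_of_int 4 / sqrt 8)" unfolding in_cubic_iff
      by (intro exI[of _ "\<lambda>j. a (Inr j) div 2"])
    ultimately show "\<exists>i\<in>?I. v - r i \<in> cubic_lattice (real_of_int 4 / sqrt 8)" by blast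
  next
    assume "\<exists>i\<in>?I. v - r i \<in> cubic_lattice (real_of_int 4 / sqrt 8)"
    then obtain m P x where mP: "P \<in> punctured C ?X" "v - r (m, P) = leech_vec (\<lambda>j. 4 * x j)"
      unfolding in_cubic_iff by auto
    define c where "c j = of_bool (Inr j \<in> P) + 2 * x j" for j
    have "v = r (m, P) + leech_vec (\<lambda>j. 4 * x j)" using mP(2) by (simp add: algebra_simps)
    then have v: "v = leech_vec (\<lambda>j. m + 2 * c j)"
      by (simp add: r_def c_def vec_eq_iff add_divide_distrib[symmetric])
    have "P \<subseteq> ?X" using mP(1) by (auto simp: punctured_def)
    then have "Inr ` {j. odd (c j)} = P" by (auto simp: c_def)
    with leech_over_V[OF C, of c m] mP(1) v show "v \<in> dual_lattice (lattice_L C)"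
      unfolding dual_L[OF C] by force
  qed
  have pres: "presentation (cubic_lattice (real_of_int 4 / sqrt 8)) (r ` ?I) (dual_lattice (lattice_L C))"
    and inj_r: "inj_on r ?I"
    using coset_presentation[OF lat I inj mem] by blast+
  have "card (r ` ?I) = 2 ^ 13" by (simp add: card_image[OF inj_r] card_cartesian_product cp)
  moreover have "covolume (cubic_lattice (real_of_int 4 / sqrt 8) :: (real ^ 20) set) = 2 ^ 10"
  proof -
    have "(real_of_int 4 / sqrt 8) ^ 20 = ((real_of_int 4 / sqrt 8)\<^sup>2) ^ 10" by (simp only: power_mult[symmetric]) simp
    also have "(real_of_int 4 / sqrt 8)\<^sup>2 = 2" by (simp add: power_divide)
    finally show ?thesis by (subst covolume_cubic) simp_all
  qed
  ultimately show ?thesis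
    using covolume_sublattice[OF pres dual_L_lattice] by simp
qed

section \<open>The configurations as unions of cosets\<close>

definition leech_lift :: "quad \<Rightarrow> real ^ idx" where
  "leech_lift y = (SOME w. w \<in> leech_lattice C \<and> proj_U w = quad_emb y)"

definition coset_rep :: "quad \<Rightarrow> real ^ 20" where
  "coset_rep y = proj_V (leech_lift y)"

lemma leech_lift_props:
  assumes "quad_par y" shows "leech_lift y \<in> leech_lattice C \<and> proj_U (leech_lift y) = quad_emb y"
proof -
  obtain a b c d where y: "y = (a, b, c, d)" by (cases y)
  have "quad_fun y = (\<lambda>i. a + 2 * ((quad_fun y i - a) div 2))"
    using assms by (auto simp: fun_eq_iff forall_4 y quad_par_def)
  with leech_over_U[OF C, of a "\<lambda>i. (quad_fun y i - a) div 2"]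
  have "\<exists>w. w \<in> leech_lattice C \<and> proj_U w = quad_emb y" by (simp add: quad_emb_def)
  then show ?thesis unfolding leech_lift_def by (rule someI_ex)
qed

lemma coset_rep_iff:
  assumes y: "quad_par y" and w: "w \<in> leech_lattice C" "proj_U w = quad_emb z"
  shows "proj_V w - coset_rep y \<in> lattice_L C \<longleftrightarrow> quad_in_section_U (quad_diff z y)"
proof -
  have "w - leech_lift y \<in> leech_lattice C" "proj_U (w - leech_lift y) = leech_vec (quad_fun (quad_diff z y))"
    using leech_lift_props[OF y] w leech_diff[OF C]
    by (simp_all add: proj_diff quad_emb_diff quad_emb_def[symmetric])
  from section_glue[OF C this] show ?thesis by (simp add: coset_rep_def proj_diff in_section_U_quad)
qed

lemma glued_config_presentation:
  assumes A: "finite A" "A \<noteq> {}" and par: "\<And>y. y \<in> A \<Longrightarrow> quad_par y"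
    and inj: "\<And>y z. y \<in> A \<Longrightarrow> z \<in> A \<Longrightarrow> quad_in_section_U (quad_diff y z) \<Longrightarrow> y = z"
  shows "presentation (lattice_L C) (coset_rep ` A) (glued_config C A)" "inj_on coset_rep A"
proof -
  have 1: "y = z" if "y \<in> A" "z \<in> A" "coset_rep y - coset_rep z \<in> lattice_L C" for y z
    using inj[OF that(1,2)] that(3) coset_rep_iff[OF par[OF that(2)]] leech_lift_props[OF par[OF that(1)]]
    by (metis coset_rep_def)
  have 2: "x \<in> glued_config C A \<longleftrightarrow> (\<exists>y\<in>A. x - coset_rep y \<in> lattice_L C)" for x
  proof
    assume "x \<in> glued_config C A"
    then obtain w y where w: "w \<in> leech_lattice C" "y \<in> A" "proj_U w = quad_emb y" "x = proj_V w"
      by (auto simp: glued_config_def)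
    have "quad_in_section_U (quad_diff y y)" by (cases y) (simp add: quad_in_section_U_def quad_diff_def)
    then show "\<exists>y\<in>A. x - coset_rep y \<in> lattice_L C" using coset_rep_iff[OF par[OF w(2)] w(1,3)] w by blast
  next
    assume "\<exists>y\<in>A. x - coset_rep y \<in> lattice_L C"
    then obtain y w where y: "y \<in> A" and w: "w \<in> leech_lattice C" "proj_U w = 0" "x - coset_rep y = proj_V w"
      unfolding lattice_L_eq[OF C] by blast
    have "x = proj_V (leech_lift y + w)" using w(3) by (simp add: proj_add coset_rep_def algebra_simps)
    moreover have "leech_lift y + w \<in> leech_lattice C" "proj_U (leech_lift y + w) = quad_emb y"
      using leech_lift_props[OF par[OF y]] w leech_add[OF C] by (auto simp: proj_add)
    ultimately show "x \<in> glued_config C A" unfolding glued_config_def using y by blast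
  qed
  show "presentation (lattice_L C) (coset_rep ` A) (glued_config C A)" "inj_on coset_rep A"
    using coset_presentation[OF is_lattice_L A, of coset_rep "glued_config C A"] 1 2 by blast+
qed

lemma glue_reps_iff:
  "z \<in> set glue_reps \<longleftrightarrow> (\<exists>m\<in>{0,1}. \<exists>q1\<in>{0,1}. \<exists>q2\<in>{0,1}. \<exists>q3\<in>{0,1}. \<exists>q4\<in>{0,1}. \<exists>s\<in>{0,1}.
    z = (m + 2 * q1 + 4 * s, m + 2 * q2, m + 2 * q3, m + 2 * q4))"
  unfolding glue_reps_def by simp

lemma glue_reps_distinct:
  assumes "y \<in> set glue_reps" "z \<in> set glue_reps" "quad_in_section_U (quad_diff y z)"
  shows "y = z"
proof -
  obtain m q1 q2 q3 q4 s where y: "m \<in> {0,1}" "q1 \<in> {0,1}" "q2 \<in> {0,1}" "q3 \<in> {0,1}" "q4 \<in> {0,1}" "s \<in> {0,1}"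
    "y = (m + 2 * q1 + 4 * s, m + 2 * q2, m + 2 * q3, m + 2 * q4)"
    using assms(1) unfolding glue_reps_iff by blast
  obtain m' q1' q2' q3' q4' s' where z: "m' \<in> {0,1}" "q1' \<in> {0,1}" "q2' \<in> {0,1}" "q3' \<in> {0,1}" "q4' \<in> {0,1}" "s' \<in> {0,1}"
    "z = (m' + 2 * q1' + 4 * s', m' + 2 * q2', m' + 2 * q3', m' + 2 * q4')"
    using assms(2) unfolding glue_reps_iff by blast
  have d: "4 dvd (m + 2 * q1 + 4 * s) - (m' + 2 * q1' + 4 * s')" "4 dvd (m + 2 * q2) - (m' + 2 * q2')"
     "4 dvd (m + 2 * q3) - (m' + 2 * q3')" "4 dvd (m + 2 * q4) - (m' + 2 * q4')"
    and d8: "8 dvd (m + 2 * q1 + 4 * s) - (m' + 2 * q1' + 4 * s') + ((m + 2 * q2) - (m' + 2 * q2'))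
      + ((m + 2 * q3) - (m' + 2 * q3')) + ((m + 2 * q4) - (m' + 2 * q4'))"
    using assms(3) unfolding y z quad_diff_def quad_in_section_U_def by simp_all
  have "4 dvd (m + 2 * q1) - (m' + 2 * q1')" using d(1) by presburger
  from bits_mod_4[OF y(1) z(1) y(2) z(2) this] have e1: "m = m'" "q1 = q1'" by auto
  have e2: "q2 = q2'" "q3 = q3'" "q4 = q4'"
    using bits_mod_4[OF y(1) z(1) y(3) z(3) d(2)] bits_mod_4[OF y(1) z(1) y(4) z(4) d(3)] bits_mod_4[OF y(1) z(1) y(5) z(5) d(4)] by auto
  have "8 dvd 4 * s - 4 * s'" using d8 e1 e2 by simp
  then have "s = s'" using y(6) z(6) by auto
  with e1 e2 y(7) z(7) show ?thesis by simp
qed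

text \<open>Adding a vector of the \<open>U\<close>-section changes only the \<open>U\<close>-part, which can thus be brought into
  the system of representatives.\<close>

lemma leech_reduce:
  assumes w: "w \<in> leech_lattice C"
  shows "\<exists>w' z. w' \<in> leech_lattice C \<and> proj_V w' = proj_V w \<and> z \<in> set glue_reps \<and> proj_U w' = quad_emb z"
proof -
  obtain m a where m01: "m \<in> {0, 1}" and a: "w = leech_vec (\<lambda>i. m + 2 * a i)"
    using w by (rule leech_normal_form[OF C])
  define c where "c i = a (Inl i)" for i
  have Uw: "proj_U w = leech_vec (\<lambda>i. m + 2 * c i)" by (simp add: a comp_def c_def)
  define q h where "q i = c i mod 2" and "h i = c i div 2" for i
  \<comment> \<open>the last bit restores the divisibility of the sum of the entries by 8\<close>
  define s where "s = (h 1 + h 2 + h 3 + h 4) mod 2"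
  define z where "z = (m + 2 * q 1 + 4 * s, m + 2 * q 2, m + 2 * q 3, m + 2 * q 4)"
  have z: "z \<in> set glue_reps"
  proof -
    have bits: "m \<in> {0,1}" "s \<in> {0,1}" "\<And>i. q i \<in> {0,1}" using m01 by (auto simp: s_def q_def)
    show ?thesis unfolding glue_reps_iff z_def
      by (rule bexI[of _ m], rule bexI[of _ "q 1"], rule bexI[of _ "q 2"], rule bexI[of _ "q 3"],
          rule bexI[of _ "q 4"], rule bexI[of _ s]) (rule refl bits)+
  qed
  define y where "y = (m + 2 * c 1, m + 2 * c 2, m + 2 * c 3, m + 2 * c 4)"
  have Uy: "proj_U w = quad_emb y" unfolding Uw quad_emb_def y_def
    by (simp add: fun_eq_iff forall_4)
  have ch: "c i = 2 * h i + q i" for i by (simp add: q_def h_def)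
  have "quad_in_section_U (quad_diff y z)"
  proof -
    have "(h 1 + h 2 + h 3 + h 4) - s = 2 * ((h 1 + h 2 + h 3 + h 4) div 2)"
      unfolding s_def by (simp add: minus_mod_eq_mult_div)
    then have "4 * (h 1 + h 2 + h 3 + h 4) - 4 * s = 8 * ((h 1 + h 2 + h 3 + h 4) div 2)" by simp
    then have "8 dvd 4 * (h 1 + h 2 + h 3 + h 4) - 4 * s" by simp
    then show ?thesis unfolding y_def z_def quad_diff_def quad_in_section_U_def ch by (simp add: algebra_simps)
  qed
  then have "in_section_U (quad_fun (quad_diff y z))" by (simp add: in_section_U_quad)
  then obtain w0 where w0: "w0 \<in> leech_lattice C" "proj_V w0 = 0" "proj_U w0 = quad_emb (quad_diff y z)"
    unfolding leech_U_iff[OF C, symmetric] quad_emb_def by auto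
  have "proj_U (w - w0) = quad_emb z"
    unfolding proj_diff Uy w0(3) quad_emb_diff[symmetric] by simp
  moreover have "w - w0 \<in> leech_lattice C" "proj_V (w - w0) = proj_V w"
    using w w0 leech_diff[OF C] by (auto simp: proj_diff)
  ultimately show ?thesis using z by blast
qed

lemma glued_config_reps: "glued_config C (set glue_reps) = dual_lattice (lattice_L C)"
proof -
  have "proj_V w \<in> glued_config C (set glue_reps)" if "w \<in> leech_lattice C" for w
    using leech_reduce[OF that] unfolding glued_config_def by (metis (mono_tags, lifting) image_eqI mem_Collect_eq)
  then show ?thesis unfolding dual_L[OF C] by (auto simp: glued_config_def)
qed

text \<open>The dual lattice is the union of 64 cosets of \<open>L\<close>.\<close>

lemma covolume_L: "covolume (lattice_L C) = 8"
proof -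
  have ne: "set glue_reps \<noteq> {}" using glue_reps_card by force
  note pres = glued_config_presentation[OF finite_set ne bspec[OF quads_star_par(3)] glue_reps_distinct]
  have "covolume (lattice_L C) = real (card (coset_rep ` set glue_reps)) * covolume (dual_lattice (lattice_L C))"
    using covolume_sublattice[OF pres(1)] dual_L_lattice by (simp add: glued_config_reps)
  then show ?thesis using glue_reps_card
    by (simp add: card_image[OF pres(2)] covolume_dual_L)
qed

lemma presentation_V20_star: "presentation (lattice_L C) (coset_rep ` set quads_A_star) (V20_star C)"
    and inj_coset_rep_star: "inj_on coset_rep (set quads_A_star)"
  and presentation_V20: "presentation (lattice_L C) (coset_rep ` set quads_A) (V20 C)"
    and inj_coset_rep: "inj_on coset_rep (set quads_A)"
proof -
  have ne: "set quads_A_star \<noteq> {}" "set quads_A \<noteq> {}" by (auto simp: quads_A_star_def quads_A_def)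
  have eq: "V20_star C = glued_config C (set quads_A_star)" "V20 C = glued_config C (set quads_A)"
    by (simp_all add: V20_star_def V20_def glued_config_def config_A_eq config_A_star_eq)
  show "presentation (lattice_L C) (coset_rep ` set quads_A_star) (V20_star C)" "inj_on coset_rep (set quads_A_star)"
    unfolding eq using glued_config_presentation[OF finite_set ne(1)] quads_star_par(1) quads_star_cosets(1) by blast+
  show "presentation (lattice_L C) (coset_rep ` set quads_A) (V20 C)" "inj_on coset_rep (set quads_A)"
    unfolding eq using glued_config_presentation[OF finite_set ne(2)] quads_star_par(2) quads_star_cosets(2) by blast+
qed

lemma card_coset_reps_star: "card (coset_rep ` set quads_A_star) = 16" and card_coset_reps: "card (coset_rep ` set quads_A) = 4"
proof -
  show "card (coset_rep ` set quads_A_star) = 16"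
    using card_image[OF inj_coset_rep_star] distinct_card[OF quads_star_distinct(1)] by (simp add: quads_A_star_def)
  show "card (coset_rep ` set quads_A) = 4"
    using card_image[OF inj_coset_rep] distinct_card[OF quads_star_distinct(2)] by (simp add: quads_A_def)
qed

text \<open>The two parts of the integer \<open>leech_lift y \<bullet> w\<close> have opposite fractional parts, and the one from \<open>U\<close> is
  an integer multiple of 1/4.\<close>

lemma character_coset_rep:
  assumes y: "quad_par y" and z: "quad_par z" and w: "w \<in> leech_lattice C" "proj_U w = quad_emb z"
  shows "character (proj_V w) (coset_rep y) = Complex (real_of_int (cos4 (quad_dot y z div 2))) (- real_of_int (sin4 (quad_dot y z div 2)))"
proof -
  have "leech_lift y \<bullet> w = quad_emb y \<bullet> quad_emb z + coset_rep y \<bullet> proj_V w"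
    using leech_lift_props[OF y] w(2) by (simp add: inner_proj coset_rep_def)
  then have ip: "coset_rep y \<bullet> proj_V w = leech_lift y \<bullet> w - real_of_int (quad_dot y z) / 8"
    by (simp add: quad_emb_inner)
  obtain n where n: "leech_lift y \<bullet> w = real_of_int n"
    using leech_integral[OF C conjunct1[OF leech_lift_props[OF y]] w(1)] by (auto elim: Ints_cases)
  obtain k where k: "quad_dot y z = 2 * k" using quad_dot_even[OF y z] by blast
  have "character (proj_V w) (coset_rep y) = exp (2 * pi * \<i> * complex_of_real (- real_of_int k / 4) + 2 * of_int n * pi * \<i>)"
    unfolding character_def ip n k by (rule arg_cong[of _ _ exp]) (simp add: algebra_simps)
  also have "\<dots> = exp (2 * pi * \<i> * complex_of_real (- real_of_int k / 4))"
  proof -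
    have "exp (2 * of_int n * pi * \<i>) = 1" by (auto simp: exp_eq_1)
    then show ?thesis by (simp only: exp_add mult_1_right)
  qed
  finally show ?thesis unfolding exp_quarter by (simp add: k)
qed

lemma phase_average_count:
  assumes z: "z \<in> set glue_reps" and w: "w \<in> leech_lattice C" "proj_U w = quad_emb z"
  shows "4 * (cmod (phase_average (coset_rep ` set quads_A_star) (proj_V w)))\<^sup>2 = real (quad_count z)"
proof -
  have par: "quad_par z" using z quads_star_par by blast
  let ?c = "\<Sum>y\<leftarrow>quads_A_star. cos4 (quad_dot y z div 2)" and ?s = "\<Sum>y\<leftarrow>quads_A_star. sin4 (quad_dot y z div 2)"
  have "(\<Sum>v\<in>coset_rep ` set quads_A_star. character (proj_V w) v) = (\<Sum>y\<in>set quads_A_star. character (proj_V w) (coset_rep y))"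
    by (simp add: sum.reindex[OF inj_coset_rep_star])
  also have "\<dots> = (\<Sum>y\<in>set quads_A_star. Complex (real_of_int (cos4 (quad_dot y z div 2))) (- real_of_int (sin4 (quad_dot y z div 2))))"
    using quads_star_par(1) by (intro sum.cong refl character_coset_rep par w) blast
  also have "\<dots> = Complex (real_of_int ?c) (- real_of_int ?s)"
    by (simp add: sum_list_distinct_conv_sum_set[OF quads_star_distinct(1)] complex_eq_iff sum_negf)
  finally have "16 * phase_average (coset_rep ` set quads_A_star) (proj_V w) = Complex (real_of_int ?c) (- real_of_int ?s)"
    unfolding phase_average_def card_coset_reps_star character_def[symmetric] by simp
  then have "cmod (16 * phase_average (coset_rep ` set quads_A_star) (proj_V w)) ^ 2 = real_of_int (?c\<^sup>2 + ?s\<^sup>2)"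
    by (simp add: cmod_power2)
  also have "?c\<^sup>2 + ?s\<^sup>2 = 64 * int (quad_count z)" using finite_fourier_check z by blast
  finally show ?thesis by (simp add: norm_mult power_mult_distrib)
qed

lemma card_coset_rep_differences:
  assumes w: "w \<in> leech_lattice C" "proj_U w = quad_emb z"
  shows "card {(a, b). a \<in> coset_rep ` set quads_A \<and> b \<in> coset_rep ` set quads_A \<and> proj_V w - (a - b) \<in> lattice_L C} = quad_count z"
proof -
  let ?S = "{(y, y') \<in> set quads_A \<times> set quads_A. quad_in_section_U (quad_diff z (quad_diff y y'))}"
  have mem: "proj_V w - (coset_rep y - coset_rep y') \<in> lattice_L C \<longleftrightarrow> quad_in_section_U (quad_diff z (quad_diff y y'))"
    if y: "y \<in> set quads_A" "y' \<in> set quads_A" for y y'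
  proof -
    have l: "leech_lift y \<in> leech_lattice C" "proj_U (leech_lift y) = quad_emb y" "leech_lift y' \<in> leech_lattice C" "proj_U (leech_lift y') = quad_emb y'"
      using leech_lift_props quads_star_par(2) y by blast+
    have 1: "w - (leech_lift y - leech_lift y') \<in> leech_lattice C" using w l leech_diff[OF C] by blast
    have 2: "proj_U (w - (leech_lift y - leech_lift y')) = leech_vec (quad_fun (quad_diff z (quad_diff y y')))"
      by (simp add: proj_diff w l quad_emb_diff quad_emb_def[symmetric])
    from section_glue[OF C 1 2] show ?thesis by (simp add: proj_diff coset_rep_def in_section_U_quad)
  qed
  have "{(a, b). a \<in> coset_rep ` set quads_A \<and> b \<in> coset_rep ` set quads_A \<and> proj_V w - (a - b) \<in> lattice_L C}
      = map_prod coset_rep coset_rep ` ?S"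
    using mem by (force simp: image_iff)
  moreover have "inj_on (map_prod coset_rep coset_rep) ?S"
    by (rule inj_on_subset[OF map_prod_inj_on[OF inj_coset_rep inj_coset_rep]]) auto
  moreover have "card ?S = quad_count z"
  proof -
    have S: "?S = set (filter (\<lambda>(a, b). quad_in_section_U (quad_diff z (quad_diff a b))) (List.product quads_A quads_A))"
      by auto
    show ?thesis unfolding S quad_count_def
      by (intro distinct_card distinct_filter distinct_product quads_star_distinct)
  qed
  ultimately show ?thesis by (simp add: card_image)
qed

lemma phase_differences:
  assumes xi: "\<xi> \<in> dual_lattice (lattice_L C)"
  shows "real (card (coset_rep ` set quads_A)) * (cmod (phase_average (coset_rep ` set quads_A_star) \<xi>))\<^sup>2
    = real (card {(a, b). a \<in> coset_rep ` set quads_A \<and> b \<in> coset_rep ` set quads_A \<and> \<xi> - (a - b) \<in> lattice_L C})"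
proof -
  obtain w0 where "w0 \<in> leech_lattice C" "\<xi> = proj_V w0" using xi unfolding dual_L[OF C] by blast
  then obtain w z where w: "w \<in> leech_lattice C" "\<xi> = proj_V w" "z \<in> set glue_reps" "proj_U w = quad_emb z"
    using leech_reduce by metis
  show ?thesis
    unfolding w(2) card_coset_rep_differences[OF w(1,4)] using phase_average_count[OF w(3,1,4)] by (simp add: card_coset_reps)
qed

lemma L_subset_dual: "lattice_L C \<subseteq> dual_lattice (lattice_L C)"
  using dual_L[OF C] lattice_L_eq[OF C] by blast

lemma coset_rep_diff_dual:
  assumes "a \<in> coset_rep ` set quads_A" "b \<in> coset_rep ` set quads_A"
  shows "a - b \<in> dual_lattice (lattice_L C)"
proof -
  obtain y z where "a = proj_V (leech_lift y)" "b = proj_V (leech_lift z)" "leech_lift y \<in> leech_lattice C" "leech_lift z \<in> leech_lattice C"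
    using assms leech_lift_props quads_star_par(2) by (auto simp: coset_rep_def)
  then show ?thesis unfolding dual_L[OF C]
    by (intro image_eqI[of _ _ "leech_lift y - leech_lift z"]) (simp_all add: proj_diff leech_diff[OF C])
qed

theorem V20_star_formally_dual: "formally_dual (V20_star C) (V20 C)"
  by (rule formally_dualI[OF presentation_V20_star presentation_V20 L_subset_dual coset_rep_diff_dual phase_differences])

lemma density_V20_star: "particle_density (V20_star C) = 2"
  by (simp add: particle_density_eq[OF presentation_V20_star] card_coset_reps_star covolume_L)

text \<open>A nonzero average makes \<open>\<xi>\<close> the \<open>V\<close>-part of a lattice vector whose \<open>U\<close>-part is a difference in \<open>A\<close>.\<close>

lemma norm_ge_of_phase_nonzero:
  assumes xi: "\<xi> \<in> dual_lattice (lattice_L C)" "\<xi> \<noteq> 0" "phase_average (coset_rep ` set quads_A_star) \<xi> \<noteq> 0"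
  shows "sqrt (7 / 2) \<le> norm \<xi>"
proof -
  let ?S = "{(a, b). a \<in> coset_rep ` set quads_A \<and> b \<in> coset_rep ` set quads_A \<and> \<xi> - (a - b) \<in> lattice_L C}"
  have "0 < 4 * (cmod (phase_average (coset_rep ` set quads_A_star) \<xi>))\<^sup>2" using xi(3) by simp
  moreover have "4 * (cmod (phase_average (coset_rep ` set quads_A_star) \<xi>))\<^sup>2 = real (card ?S)"
    using phase_differences[OF xi(1)] by (simp only: card_coset_reps of_nat_numeral)
  ultimately have "0 < real (card ?S)" by linarith
  then have "card ?S \<noteq> 0" by (simp only: of_nat_0_less_iff)
  then have "?S \<noteq> {}" by (metis card.empty)
  then obtain y z where yz: "y \<in> set quads_A" "z \<in> set quads_A" "\<xi> - (coset_rep y - coset_rep z) \<in> lattice_L C" by auto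
  then obtain w0 where w0: "w0 \<in> leech_lattice C" "proj_U w0 = 0" "\<xi> - (coset_rep y - coset_rep z) = proj_V w0"
    unfolding lattice_L_eq[OF C] by blast
  have l: "leech_lift y \<in> leech_lattice C" "proj_U (leech_lift y) = quad_emb y" "leech_lift z \<in> leech_lattice C" "proj_U (leech_lift z) = quad_emb z"
    using leech_lift_props quads_star_par(2) yz by blast+
  define w where "w = w0 + (leech_lift y - leech_lift z)"
  have w: "w \<in> leech_lattice C" unfolding w_def by (intro leech_add[OF C] leech_diff[OF C] w0 l)
  have V: "proj_V w = \<xi>" using w0(3) by (simp add: w_def proj_add proj_diff coset_rep_def algebra_simps)
  have U: "proj_U w = quad_emb (quad_diff y z)" by (simp add: w_def proj_add proj_diff w0 l quad_emb_diff)
  have "w \<noteq> 0" using V xi(2) proj_zero(2) by metis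
  then have n1: "4 \<le> w \<bullet> w" using leech_min_norm[OF C w] by (simp add: power2_norm_eq_inner)
  have n2: "w \<bullet> w = real_of_int (quad_dot (quad_diff y z) (quad_diff y z)) / 8 + (norm \<xi>)\<^sup>2"
    by (simp add: inner_proj U V quad_emb_inner power2_norm_eq_inner)
  have n3: "real_of_int (quad_dot (quad_diff y z) (quad_diff y z)) \<le> 4"
    using quads_A_norm yz by (metis of_int_le_iff of_int_numeral)
  have "7 / 2 \<le> (norm \<xi>)\<^sup>2" using n1 n2 n3 by linarith
  then show ?thesis by (simp add: real_le_lsqrt)
qed

lemma phase_nonzero_attained:
  "\<exists>\<xi>. \<xi> \<in> dual_lattice (lattice_L C) \<and> \<xi> \<noteq> 0 \<and> phase_average (coset_rep ` set quads_A_star) \<xi> \<noteq> 0 \<and> norm \<xi> = sqrt (7 / 2)"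
proof -
  \<comment> \<open>the vector with one entry \<open>-3\<close> in \<open>V\<close> and all other entries 1\<close>
  define a :: "idx \<Rightarrow> int" where "a i = (if i = Inr 0 then - 2 else 0)" for i
  have "leech_coord C 1 a" by (simp add: leech_coord_def a_def golay_empty[OF C])
  define w where "w = leech_vec (\<lambda>i. 1 + 2 * a i)"
  have w: "w \<in> leech_lattice C" unfolding w_def leech_iff[OF C] using \<open>leech_coord C 1 a\<close> by blast
  have U: "proj_U w = quad_emb (1, 1, 1, 1)"
    by (simp add: w_def a_def quad_emb_def fun_eq_iff forall_4)
  have "(\<Sum>i\<in>UNIV. (1 + 2 * a i) * (1 + 2 * a i)) = (\<Sum>i\<in>(UNIV :: idx set). if i = Inr 0 then 9 else 1 :: int)"
    by (intro sum.cong) (auto simp: a_def)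
  also have "\<dots> = 9 + (\<Sum>i\<in>UNIV - {Inr 0 :: idx}. 1)"
    by (subst sum.remove[of UNIV "Inr 0"]) auto
  also have "\<dots> = 32" by (simp add: card_Diff_subset)
  finally have "w \<bullet> w = 4" by (simp add: w_def leech_vec_inner)
  moreover have "w \<bullet> w = 1 / 2 + (norm (proj_V w))\<^sup>2"
    by (simp add: inner_proj U quad_emb_inner quad_dot_def power2_norm_eq_inner)
  ultimately have n2: "(norm (proj_V w))\<^sup>2 = 7 / 2" by simp
  then have norm: "norm (proj_V w) = sqrt (7 / 2)" by (metis norm_ge_zero real_sqrt_unique)
  have dual: "proj_V w \<in> dual_lattice (lattice_L C)" unfolding dual_L[OF C] using w by blast
  have "(1, 1, 1, 1) \<in> set quads_A" "(0, 0, 0, 0) \<in> set quads_A" by (auto simp: quads_A_def)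
  moreover have "proj_V w - (coset_rep (1, 1, 1, 1) - coset_rep (0, 0, 0, 0)) \<in> lattice_L C"
  proof -
    have l: "leech_lift y \<in> leech_lattice C" "proj_U (leech_lift y) = quad_emb y" if "y \<in> set quads_A" for y
      using leech_lift_props quads_star_par(2) that by blast+
    note l1 = l[OF \<open>(1, 1, 1, 1) \<in> set quads_A\<close>] and l0 = l[OF \<open>(0, 0, 0, 0) \<in> set quads_A\<close>]
    have 1: "w - (leech_lift (1, 1, 1, 1) - leech_lift (0, 0, 0, 0)) \<in> leech_lattice C"
      using w l1 l0 leech_diff[OF C] by blast
    have 2: "proj_U (w - (leech_lift (1, 1, 1, 1) - leech_lift (0, 0, 0, 0))) = leech_vec (quad_fun (0, 0, 0, 0))"
      by (simp add: proj_diff U l1 l0 quad_emb_diff quad_diff_def quad_emb_def[symmetric] quad_emb_zero)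
    from section_glue[OF C 1 2] show ?thesis by (simp add: proj_diff coset_rep_def in_section_U_quad quad_in_section_U_def)
  qed
  ultimately have "(coset_rep (1, 1, 1, 1), coset_rep (0, 0, 0, 0)) \<in> {(a, b). a \<in> coset_rep ` set quads_A \<and> b \<in> coset_rep ` set quads_A \<and> proj_V w - (a - b) \<in> lattice_L C}"
    (is "_ \<in> ?S") by blast
  moreover have "finite ?S" by (rule finite_subset[of _ "coset_rep ` set quads_A \<times> coset_rep ` set quads_A"]) auto
  ultimately have "card ?S > 0" by (subst card_gt_0_iff) blast
  then have "phase_average (coset_rep ` set quads_A_star) (proj_V w) \<noteq> 0"
    using phase_differences[OF dual] by (intro notI) simp
  moreover have "proj_V w \<noteq> 0" using n2 by auto
  ultimately show ?thesis using dual norm by blast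
qed

lemma stealth_V20_star: "stealth_radius (unit_density_rescaling (V20_star C)) = 2 powr (- 1 / 20) * sqrt (7 / 2)"
proof -
  obtain \<xi> where xi: "\<xi> \<in> dual_lattice (lattice_L C)" "\<xi> \<noteq> 0" "phase_average (coset_rep ` set quads_A_star) \<xi> \<noteq> 0" "norm \<xi> = sqrt (7 / 2)"
    using phase_nonzero_attained by blast
  have "stealth_radius (unit_density_rescaling (V20_star C)) = sqrt (7 / 2) / 2 powr (1 / 20)"
  proof (rule stealth_radius_unit_density[OF _ presentation_V20_star _ norm_ge_of_phase_nonzero xi])
    have "(2 powr (1 / 20)) ^ 20 = (2 powr (1 / 20)) powr real 20" by (subst powr_realpow) simp_all
    also have "\<dots> = (2::real)" by (subst powr_powr) simp
    finally show "(2 powr (1 / 20)) ^ DIM(real ^ 20) = particle_density (V20_star C)"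
      by (simp add: density_V20_star)
  qed simp_all
  also have "\<dots> = 2 powr (- 1 / 20) * sqrt (7 / 2)" by (simp add: powr_minus field_simps)
  finally show ?thesis .
qed

lemma stealth_dual_L: "stealth_radius (unit_density_rescaling (dual_lattice (lattice_L C))) = 2 powr (17 / 20)"
proof -
  let ?L = "lattice_L C"
  have pres: "presentation (dual_lattice ?L) {0} (dual_lattice ?L)" by (rule lattice_presentation[OF dual_L_lattice])
  have density: "particle_density (dual_lattice ?L) = 8"
    by (simp add: particle_density_eq[OF pres] covolume_dual_L)
  have phase: "phase_average {0} \<xi> = 1" for \<xi> :: "real ^ 20" by (simp add: phase_average_def)
  have low: "2 \<le> norm \<xi>" if "\<xi> \<in> dual_lattice (dual_lattice ?L)" "\<xi> \<noteq> 0" for \<xi>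
  proof -
    have "\<xi> \<in> ?L" using that by (simp add: dual_dual_L)
    then obtain w where w: "w \<in> leech_lattice C" "proj_U w = 0" "\<xi> = proj_V w" unfolding lattice_L_eq[OF C] by blast
    have "w \<noteq> 0" using w that(2) proj_zero(2) by metis
    then have "4 \<le> (norm w)\<^sup>2" by (rule leech_min_norm[OF C w(1)])
    also have "\<dots> = (norm \<xi>)\<^sup>2" by (simp add: power2_norm_eq_inner inner_proj w)
    finally have "2\<^sup>2 \<le> (norm \<xi>)\<^sup>2" by simp
    then show ?thesis by (rule power2_le_imp_le) simp
  qed
  \<comment> \<open>the vector \<open>(4, 4, 0, ..., 0)\<close>\<close>
  define c :: "20 \<Rightarrow> int" where "c j = (if j = 0 then 2 else 0) + (if j = 1 then 2 else 0)" for j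
  have "(\<Sum>j\<in>UNIV. c j) = 4" unfolding c_def sum.distrib by simp
  moreover have "{j. odd (c j)} = {}" by (auto simp: c_def)
  ultimately have "leech_vec (\<lambda>j. 2 * c j) \<in> ?L" by (intro lattice_L_memI[OF C]) (simp_all add: golay_empty[OF C])
  then have att: "leech_vec (\<lambda>j. 2 * c j) \<in> dual_lattice (dual_lattice ?L)" by (simp add: dual_dual_L)
  have "(\<Sum>j\<in>UNIV. (2 * c j)\<^sup>2) = (\<Sum>j\<in>(UNIV :: 20 set). (if j = 0 then 16 else 0) + (if j = 1 then 16 else 0))"
    by (intro sum.cong) (auto simp: c_def)
  also have "\<dots> = 32" unfolding sum.distrib by simp
  finally have n2: "(norm (leech_vec (\<lambda>j. 2 * c j)))\<^sup>2 = 4" by (simp only: norm_leech_vec)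
  then have norm: "norm (leech_vec (\<lambda>j. 2 * c j)) = 2"
    by (intro power2_eq_imp_eq[of _ 2]) (simp_all only: n2, simp_all)
  have nz: "leech_vec (\<lambda>j. 2 * c j) \<noteq> 0" using norm by auto
  have "stealth_radius (unit_density_rescaling (dual_lattice ?L)) = 2 / 2 powr (3 / 20)"
  proof (rule stealth_radius_unit_density[OF _ pres _ low att nz _ norm])
    have "(2 powr (3 / 20)) ^ 20 = (2 powr (3 / 20)) powr real 20" by (subst powr_realpow) simp_all
    also have "\<dots> = (2::real) powr real 3" by (subst powr_powr) simp
    also have "\<dots> = 8" by (subst powr_realpow) simp_all
    finally show "(2 powr (3 / 20)) ^ DIM(real ^ 20) = particle_density (dual_lattice ?L)"
      by (simp add: density)
  qed (simp_all add: phase)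
  also have "\<dots> = 2 powr 1 / 2 powr (3 / 20)" by simp
  also have "\<dots> = 2 powr (1 - 3 / 20)" by (rule powr_diff[symmetric])
  finally show ?thesis by simp
qed

end

text \<open>After multiplication by \<open>2 powr (1/20)\<close> and raising to the power 20 this is \<open>2\<^sup>1\<^sup>8 < (7/2)\<^sup>1\<^sup>0\<close>.\<close>

lemma stealth_comparison: "2 powr (- 1 / 20) * sqrt (7 / 2) > (2 powr (17 / 20) :: real)"
proof -
  have "(2 powr (18 / 20)) ^ 20 = (2 powr (18 / 20)) powr real 20" by (subst powr_realpow) simp_all
  also have "\<dots> = (2::real) powr real 18" by (subst powr_powr) simp
  also have "\<dots> = 2 ^ 18" by (rule powr_realpow) simp
  also have "(2::real) ^ 18 < (7 / 2) ^ 10" by (simp add: power_divide field_simps)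
  also have "(7 / 2 :: real) ^ 10 = sqrt (7 / 2) ^ 20"
    using real_sqrt_pow2[of "7 / 2"] by (metis (no_types, lifting) divide_nonneg_nonneg mult_2 numeral_Bit0 power_mult zero_le_numeral)
  finally have "2 powr (18 / 20) < sqrt (7 / 2)" by (rule power_less_imp_less_base) simp
  then have lt: "2 powr (- 1 / 20) * 2 powr (18 / 20) < 2 powr (- 1 / 20) * sqrt (7 / 2)"
    by (intro mult_strict_left_mono) simp_all
  have eq: "2 powr (- 1 / 20) * 2 powr (18 / 20) = (2 powr (17 / 20) :: real)"
    by (simp add: powr_add[symmetric])
  show ?thesis using lt unfolding eq .
qed

theorem mainTheorem2:
  fixes C :: "(4 + 20) set set"
  assumes "extended_golay_code C"
  shows "formally_dual (V20_star C) (V20 C)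
    \<and> particle_density (V20_star C) = 2
    \<and> stealth_radius (unit_density_rescaling (V20_star C)) = 2 powr (- 1 / 20) * sqrt (7 / 2)
    \<and> stealth_radius (unit_density_rescaling (dual_lattice (lattice_L C))) = 2 powr (17 / 20)
    \<and> 2 powr (- 1 / 20) * sqrt (7 / 2) > (2 powr (17 / 20) :: real)"
  using V20_star_formally_dual[OF assms] density_V20_star[OF assms] stealth_V20_star[OF assms]
    stealth_dual_L[OF assms] stealth_comparison by blast

end
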